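(* Let $G_n\to_{lwc}\mu$ and consider the Ising model on $G_n$. Then for every $\beta\ge 0$ and $B>0$ the limit $\phi(\beta,B)=\lim_{n\to\infty}\phi_n(\beta,B)$ exists and $$\phi(\beta,B)=\Phi_\mu(\beta,B,h^{\mathrm f})=\Phi_\mu(\beta,B,h^{+}).$$ Moreover, for every $\beta\ge0$ and $B>0$ the limit $\phi(\beta,-B)$ exists and $\phi(\beta,B)=\phi(\beta,-B)$, and $\phi(\beta,0)$ exists and equals $\lim_{B\to 0}\phi(\beta,B)$.
   Context: Graphs are undirected and locally finite. For a vertex $v$, $\partial v$ is its set of neighbours, $D_v=|\partial v|$, and $B_t(v)$ is the subgraph induced by vertices at graph distance $\le t$ from $v$. $\mathcal G_*$ is the space of isomorphism classes of rooted connected locally finite graphs $(G,o)$ with metric $1/(1+R)$, $R$ the largest radius such that the rooted balls of radius $R$ are isomorphic; $\mathcal T_*\subset\mathcal G_*$ is the subspace of rooted trees $(T,o)$; $T_t=B_t(o)$; $T_0$ is the one-vertex tree and $\mathcal T_*^+=\mathcal T_*\setminus\{T_0\}$. A Borel probability measure $\mu$ on $\mathcal G_*$ is unimodular if $\mathbb E_\mu[\sum_{x}f(G,o,x)]=\mathbb E_\mu[\sum_x f(G,x,o)]$ for every nonnegative Borel $f$ on the space of isomorphism classes of doubly-rooted connected graphs. For random finite graphs $G_n=(V_n=[n],E_n)$ with $I_n$ uniform on $V_n$ and $\mathbb E_n$ expectation over $G_n,I_n$: $G_n$ converges locally weakly to the random tree $T$ of law $\mu$ if $B_t(I_n)\to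 T_t$ in law in $\mathcal G_*$ for each $t$; $G_n$ is uniformly sparse if $\lim_{L\to\infty}\limsup_n\mathbb E_n[D_{I_n}\mathbf 1\{D_{I_n}\ge L\}]=0$. "$G_n\to_{lwc}\mu$" means: $(G_n)$ is uniformly sparse, converges locally weakly to a random tree with law $\mu$ on $\mathcal T_*$ (such $\mu$ is unimodular), and $\mu(D_o=0)<1$. Factor models: for a finite set $\mathscr X$, a symmetric $\psi=\psi^\beta:\mathscr X^2\to[0,\infty)$ and $\bar\psi=\bar\psi^B:\mathscr X\to[0,\infty)$, the factor model on a finite graph $G=(V,E)$ is $\nu_G(\vec\sigma)=Z_G(\beta,B)^{-1}\prod_{(ij)\in E}\psi(\sigma_i,\sigma_j)\prod_{i\in V}\bar\psi(\sigma_i)$, $\vec\sigma\in\mathscr X^V$; $\phi_n(\beta,B)=\frac1n\mathbb E_n[\log Z_{G_n}(\beta,B)]$. The Ising model is the case $\mathscr X=\{\pm1\}$, $\psi(\sigma,\sigma')=e^{\beta\sigma\sigma'}$, $\bar\psi(\sigma)=e^{B\sigma}$. Messages and Bethe functional: $\mathcal T_\to$ is the space of isomorphism classes of trees rooted at a directed edge $x\to y$ ($x\sim y$); for $(T,x\to y)$, $T_{x\to y}$ is the component containing $x$ of $T$ minus the edge $(x,y)$, rooted at $x$. A message is a measurable map $(T,x\to y)\mapsto h_{x\to y}\in\Delta_{\mathscr X}$ (probability vectors on $\mathscr X$), possibly depending on $(\beta,B)$. For $T\in\mathcal T_*$ and a message $h$, $$\Phi_T(\beta,B,h)=\log\Big\{\sum_\sigma\bar\psi(\sigma)\prod_{j\in\partial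 o}\sum_{\sigma_j}\psi(\sigma,\sigma_j)h_{j\to o}(\sigma_j)\Big\}-\frac12\sum_{j\in\partial o}\log\Big\{\sum_{\sigma,\sigma_j}\psi(\sigma,\sigma_j)h_{j\to o}(\sigma_j)h_{o\to j}(\sigma)\Big\},$$ (empty product $=1$, empty sum $=0$), with $h_{j\to o}$ the message at $(T,j\to o)$, and $\Phi_\mu(\beta,B,h)=\mathbb E_\mu[\Phi_T(\beta,B,h)]$. Ising messages: for $T\in\mathcal T_*$, $t\ge0$, let $\bar h^{t,\mathrm f}_T$ be the law of $\sigma_o$ under the Ising model on the finite tree $T_t$, and $\bar h^{t,+}_T$ the law of $\sigma_o$ under the Ising measure on $T_{t+1}$ conditioned on $\sigma_v=+1$ for all $v$ at distance $t+1$ from $o$. The limits $\bar h^{\ddagger}_T=\lim_{t\to\infty}\bar h^{t,\ddagger}_T$ ($\ddagger\in\{\mathrm f,+\}$) exist, and $h^\ddagger_{x\to y}:=\bar h^\ddagger_{T_{x\to y}}$. *)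

theory Defs
  imports "HOL-Probability.Probability"
begin

definition simple_graph_on :: "nat \<Rightarrow> (nat \<Rightarrow> nat \<Rightarrow> bool) \<Rightarrow> bool" where
  "simple_graph_on n E \<longleftrightarrow> (\<forall>i j. E i j \<longrightarrow> i < n \<and> j < n \<and> i \<noteq> j \<and> E j i)"

definition deg :: "(nat \<Rightarrow> nat \<Rightarrow> bool) \<Rightarrow> nat \<Rightarrow> nat" where
  "deg E i = card {j. E i j}"

definition ball_verts :: "(nat \<Rightarrow> nat \<Rightarrow> bool) \<Rightarrow> nat \<Rightarrow> nat \<Rightarrow> nat set" where
  "ball_verts E t v = {u. \<exists>k\<le>t. (v, u) \<in> {(x, y). E x y} ^^ k}"

text \<open>E_n[F(G_n, I_n)] with I_n uniform on {0..<n}.\<close>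
definition En :: "(nat \<Rightarrow> (nat \<Rightarrow> nat \<Rightarrow> bool) pmf) \<Rightarrow> nat \<Rightarrow>
    ((nat \<Rightarrow> nat \<Rightarrow> bool) \<Rightarrow> nat \<Rightarrow> real) \<Rightarrow> real" where
  "En G n F = measure_pmf.expectation (G n) (\<lambda>E. \<Sum>i<n. F E i) / real n"

text \<open>A rooted locally finite tree is encoded by c: the vertices are the lists xs with
  xs!i < c (take i xs); the root is [] and the children of xs are xs@[i], i < c xs.
  Every rooted locally finite tree is isomorphic to such an encoding.\<close>

definition tree_space :: "(nat list \<Rightarrow> nat) measure" where
  "tree_space = PiM UNIV (\<lambda>_. count_space UNIV)"

definition tree_verts :: "(nat list \<Rightarrow> nat) \<Rightarrow> nat list set" where
  "tree_verts c = {xs. \<forall>i<length xs. xs ! i < c (take i xs)}"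

definition tree_ball :: "(nat list \<Rightarrow> nat) \<Rightarrow> nat \<Rightarrow> nat list set" where
  "tree_ball c t = {xs \<in> tree_verts c. length xs \<le> t}"

definition tree_adj :: "nat list \<Rightarrow> nat list \<Rightarrow> bool" where
  "tree_adj x y \<longleftrightarrow> (\<exists>i. y = x @ [i]) \<or> (\<exists>i. x = y @ [i])"

definition ball_iso_tree :: "(nat \<Rightarrow> nat \<Rightarrow> bool) \<Rightarrow> nat \<Rightarrow> nat \<Rightarrow> (nat list \<Rightarrow> nat) \<Rightarrow> bool" where
  "ball_iso_tree E v t c \<longleftrightarrow> (\<exists>f. bij_betw f (tree_ball c t) (ball_verts E t v) \<and> f [] = v \<and>
      (\<forall>x\<in>tree_ball c t. \<forall>y\<in>tree_ball c t. E (f x) (f y) \<longleftrightarrow> tree_adj x y))"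

definition tree_ball_iso :: "nat \<Rightarrow> (nat list \<Rightarrow> nat) \<Rightarrow> (nat list \<Rightarrow> nat) \<Rightarrow> bool" where
  "tree_ball_iso t c c' \<longleftrightarrow> (\<exists>f. bij_betw f (tree_ball c t) (tree_ball c' t) \<and> f [] = [] \<and>
      (\<forall>x\<in>tree_ball c t. \<forall>y\<in>tree_ball c t. tree_adj (f x) (f y) \<longleftrightarrow> tree_adj x y))"

definition subtree :: "(nat list \<Rightarrow> nat) \<Rightarrow> nat \<Rightarrow> (nat list \<Rightarrow> nat)" where
  "subtree c i = (\<lambda>xs. c (i # xs))"

definition remove_child :: "(nat list \<Rightarrow> nat) \<Rightarrow> nat \<Rightarrow> (nat list \<Rightarrow> nat)" where
  "remove_child c i = (\<lambda>xs. case xs of [] \<Rightarrow> c [] - 1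
       | k # ys \<Rightarrow> c ((if k < i then k else Suc k) # ys))"

definition uniformly_sparse :: "(nat \<Rightarrow> (nat \<Rightarrow> nat \<Rightarrow> bool) pmf) \<Rightarrow> bool" where
  "uniformly_sparse G \<longleftrightarrow>
     ((\<lambda>L::nat. limsup (\<lambda>n. ereal (En G n (\<lambda>E i. real (deg E i) * of_bool (deg E i \<ge> L)))))
        \<longlongrightarrow> 0) sequentially"

definition lwc :: "(nat \<Rightarrow> (nat \<Rightarrow> nat \<Rightarrow> bool) pmf) \<Rightarrow> (nat list \<Rightarrow> nat) measure \<Rightarrow> bool" where
  "lwc G \<mu> \<longleftrightarrow>
     (\<forall>n. \<forall>E\<in>set_pmf (G n). simple_graph_on n E) \<and>
     prob_space \<mu> \<and> sets \<mu> = sets tree_space \<and>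
     uniformly_sparse G \<and>
     (\<forall>t c'. (\<lambda>n. En G n (\<lambda>E i. of_bool (ball_iso_tree E i t c')))
               \<longlonglongrightarrow> measure \<mu> {c \<in> space \<mu>. tree_ball_iso t c c'}) \<and>
     measure \<mu> {c \<in> space \<mu>. c [] = 0} < 1"

definition factor_Z :: "'a set \<Rightarrow> ('a \<Rightarrow> 'a \<Rightarrow> real) \<Rightarrow> ('a \<Rightarrow> real) \<Rightarrow> nat \<Rightarrow>
    (nat \<Rightarrow> nat \<Rightarrow> bool) \<Rightarrow> real" where
  "factor_Z X psi psibar n E =
     (\<Sum>\<sigma>\<in>{0..<n} \<rightarrow>\<^sub>E X. (\<Prod>(i, j)\<in>{(i, j). i < j \<and> j < n \<and> E i j}. psi (\<sigma> i) (\<sigma> j)) *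
                        (\<Prod>i\<in>{0..<n}. psibar (\<sigma> i)))"

definition factor_phi_n :: "'a set \<Rightarrow> ('a \<Rightarrow> 'a \<Rightarrow> real) \<Rightarrow> ('a \<Rightarrow> real) \<Rightarrow>
    (nat \<Rightarrow> (nat \<Rightarrow> nat \<Rightarrow> bool) pmf) \<Rightarrow> nat \<Rightarrow> real" where
  "factor_phi_n X psi psibar G n =
     measure_pmf.expectation (G n) (\<lambda>E. ln (factor_Z X psi psibar n E)) / real n"

text \<open>Bethe functional Phi_T for messages h_{x->y} = m (T_{x->y}).\<close>
definition bethe_T :: "'a set \<Rightarrow> ('a \<Rightarrow> 'a \<Rightarrow> real) \<Rightarrow> ('a \<Rightarrow> real) \<Rightarrow>
    ((nat list \<Rightarrow> nat) \<Rightarrow> 'a \<Rightarrow> real) \<Rightarrow> (nat list \<Rightarrow> nat) \<Rightarrow> real" where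
  "bethe_T X psi psibar m c =
     ln (\<Sum>s\<in>X. psibar s * (\<Prod>i<c []. \<Sum>s'\<in>X. psi s s' * m (subtree c i) s'))
     - 1/2 * (\<Sum>i<c []. ln (\<Sum>s\<in>X. \<Sum>s'\<in>X.
                 psi s s' * m (subtree c i) s' * m (remove_child c i) s))"

definition bethe_mu :: "'a set \<Rightarrow> ('a \<Rightarrow> 'a \<Rightarrow> real) \<Rightarrow> ('a \<Rightarrow> real) \<Rightarrow>
    (nat list \<Rightarrow> nat) measure \<Rightarrow> ((nat list \<Rightarrow> nat) \<Rightarrow> 'a \<Rightarrow> real) \<Rightarrow> real" where
  "bethe_mu X psi psibar \<mu> m = integral\<^sup>L \<mu> (bethe_T X psi psibar m)"

definition spins :: "real set" where "spins = {-1, 1}"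

definition ising_psi :: "real \<Rightarrow> real \<Rightarrow> real \<Rightarrow> real" where
  "ising_psi \<beta> s s' = exp (\<beta> * s * s')"

definition ising_psibar :: "real \<Rightarrow> real \<Rightarrow> real" where
  "ising_psibar B s = exp (B * s)"

definition ising_phi_n :: "(nat \<Rightarrow> (nat \<Rightarrow> nat \<Rightarrow> bool) pmf) \<Rightarrow> real \<Rightarrow> real \<Rightarrow> nat \<Rightarrow> real" where
  "ising_phi_n G \<beta> B n = factor_phi_n spins (ising_psi \<beta>) (ising_psibar B) G n"

definition ising_tree_weight :: "real \<Rightarrow> real \<Rightarrow> nat list set \<Rightarrow> (nat list \<Rightarrow> real) \<Rightarrow> real" where
  "ising_tree_weight \<beta> B V \<sigma> =
     exp (\<beta> * (\<Sum>v\<in>V. \<Sum>w\<in>V. if (\<exists>i. w = v @ [i]) then \<sigma> v * \<sigma> w else 0)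
          + B * (\<Sum>v\<in>V. \<sigma> v))"

definition free_marg :: "real \<Rightarrow> real \<Rightarrow> (nat list \<Rightarrow> nat) \<Rightarrow> nat \<Rightarrow> real \<Rightarrow> real" where
  "free_marg \<beta> B c t s =
     (\<Sum>\<sigma>\<in>{\<sigma> \<in> tree_ball c t \<rightarrow>\<^sub>E spins. \<sigma> [] = s}. ising_tree_weight \<beta> B (tree_ball c t) \<sigma>) /
     (\<Sum>\<sigma>\<in>tree_ball c t \<rightarrow>\<^sub>E spins. ising_tree_weight \<beta> B (tree_ball c t) \<sigma>)"

definition plus_marg :: "real \<Rightarrow> real \<Rightarrow> (nat list \<Rightarrow> nat) \<Rightarrow> nat \<Rightarrow> real \<Rightarrow> real" where
  "plus_marg \<beta> B c t s =
     (\<Sum>\<sigma>\<in>{\<sigma> \<in> tree_ball c (Suc t) \<rightarrow>\<^sub>E spins.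
               (\<forall>v\<in>tree_ball c (Suc t). length v = Suc t \<longrightarrow> \<sigma> v = 1) \<and> \<sigma> [] = s}.
         ising_tree_weight \<beta> B (tree_ball c (Suc t)) \<sigma>) /
     (\<Sum>\<sigma>\<in>{\<sigma> \<in> tree_ball c (Suc t) \<rightarrow>\<^sub>E spins.
               (\<forall>v\<in>tree_ball c (Suc t). length v = Suc t \<longrightarrow> \<sigma> v = 1)}.
         ising_tree_weight \<beta> B (tree_ball c (Suc t)) \<sigma>)"

text \<open>Messages h^f and h^+: the limits t -> infinity (their existence is a known fact).\<close>
definition h_free :: "real \<Rightarrow> real \<Rightarrow> (nat list \<Rightarrow> nat) \<Rightarrow> real \<Rightarrow> real" where
  "h_free \<beta> B c s = lim (\<lambda>t. free_marg \<beta> B c t s)"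

definition h_plus :: "real \<Rightarrow> real \<Rightarrow> (nat list \<Rightarrow> nat) \<Rightarrow> real \<Rightarrow> real" where
  "h_plus \<beta> B c s = lim (\<lambda>t. plus_marg \<beta> B c t s)"

end

theory Submission
  imports Defs
begin

text \<open>
  Write the law of a spin as $e^{h s} / (2 \cosh h)$. The tree recursion becomes
  $h = B + \sum_i \xi(h_i)$ with $\xi$ concave on $[0, \infty)$, and strict concavity makes the
  ratio of plus and free fields contract geometrically on every locally finite tree when $B > 0$;
  hence $h^{\mathrm f} = h^+$. By the Griffiths inequalities the magnetization of a vertex of $G_n$
  whose ball is a tree lies between the free and plus values on that ball, so
  $\partial_B \phi_n$ converges to $\mathbb E_\mu[\tanh h_o]$.

  The Bethe functional has the same derivative in $B$: its first variation in the messages is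
  antisymmetric under reversal of edges, hence has mean zero by mass transport, which is a double
  sum over directed edges on $G_n$ and passes to $\mu$ in the limit. As $B \to \infty$ both
  $\phi_n$ and $\Phi_\mu$ are asymptotic to $B + \beta\,\mathbb E[D] / 2$, uniformly in $n$,
  and integrating from infinity identifies them. The cases $B \le 0$ follow from spin flip symmetry
  and the Lipschitz bound $|\partial_B \phi_n| \le 1$.
\<close>

section \<open>The message map of the Ising recursion\<close>

text \<open>The free energy is differentiated in \<open>B\<close> rather than in
  \<open>\<beta>\<close> because that derivative involves one-vertex marginals only, which the
  Griffiths inequalities bound on a single ball; a derivative in \<open>\<beta>\<close> would need
  pair correlations. The obstacle throughout is that degrees are unbounded and only their first
  moment is finite. Plus and free fields at a vertex may differ by a multiple of its degree, so
  their ratio is contracted instead of their difference: a common bound on ratios survives a sum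
  over any number of children. For the same reason only \<open>tanh\<close> of a field is Lipschitz
  in \<open>B\<close> uniformly over trees, and the second-order error at a vertex is truncated (the
  \<open>min 2\<close> terms) to stay integrable without a second moment. The messages are never
  differentiated: the Bethe functional is expanded over a finite increment of \<open>B\<close>, and
  the linear part not due to \<open>B\<close> itself is exactly antisymmetric. Weak convergence is
  available only as convergence of the probabilities of ball classes, hence a Fatou-type bound, with
  uniform sparsity making the degree a dominating function.\<close>

definition xi :: "real \<Rightarrow> real \<Rightarrow> real" where
  "xi \<beta> h = (ln (cosh (h + \<beta>)) - ln (cosh (h - \<beta>))) / 2"

definition xi_slope :: "real \<Rightarrow> real \<Rightarrow> real" where
  "xi_slope \<beta> h = sinh (2 * \<beta>) / (cosh (2 * h) + cosh (2 * \<beta>))"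

text \<open>The derivative of \<open>xi\<close> as the chain rule delivers it. After 2 cosh a cosh b
  = cosh (a + b) + cosh (a - b) the numerator is constant and the denominator grows with
  \<open>h\<close> >= 0, so concavity can be read off.\<close>

lemma tanh_add_diff_tanh_diff:
  fixes h \<beta> :: real
  shows "(tanh (h + \<beta>) - tanh (h - \<beta>)) / 2 = xi_slope \<beta> h"
proof -
  have e: "h + \<beta> + (h - \<beta>) = 2 * h" "h + \<beta> - (h - \<beta>) = 2 * \<beta>" by simp_all
  have "cosh (a + b) + cosh (a - b) = 2 * (cosh a * cosh b)" for a b :: real
    by (simp add: cosh_add cosh_diff)
  from this[of "h + \<beta>" "h - \<beta>"]
  have "cosh (2 * h) + cosh (2 * \<beta>) = 2 * (cosh (h + \<beta>) * cosh (h - \<beta>))"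
    unfolding e .
  moreover have "sinh (2 * \<beta>) = sinh (h + \<beta>) * cosh (h - \<beta>) - cosh (h + \<beta>) * sinh (h - \<beta>)"
    using sinh_diff[of "h + \<beta>" "h - \<beta>"] unfolding e .
  ultimately show ?thesis
    unfolding xi_slope_def tanh_def by (simp add: diff_frac_eq mult_ac)
qed

lemma xi_has_derivative: "(xi \<beta> has_real_derivative xi_slope \<beta> h) (at h within A)"
proof -
  have "(xi \<beta> has_real_derivative (tanh (h + \<beta>) - tanh (h - \<beta>)) / 2) (at h)"
    unfolding xi_def[abs_def]
    by (auto intro!: derivative_eq_intros simp: tanh_def field_simps)
  thus ?thesis
    by (simp add: tanh_add_diff_tanh_diff has_field_derivative_at_within)
qed

lemma tendsto_xi [tendsto_intros]:
  assumes "(f \<longlongrightarrow> l) F"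
  shows "((\<lambda>x. xi \<beta> (f x)) \<longlongrightarrow> xi \<beta> l) F"
proof -
  have "isCont (xi \<beta>) l"
    by (rule DERIV_isCont[OF xi_has_derivative])
  thus ?thesis by (rule isCont_tendsto_compose[OF _ assms])
qed

lemma xi_0 [simp]: "xi \<beta> 0 = 0"
  by (simp add: xi_def)

lemma xi_0_left [simp]: "xi 0 h = 0"
  by (simp add: xi_def)

lemma xi_slope_nonneg: "0 \<le> \<beta> \<Longrightarrow> 0 \<le> xi_slope \<beta> h"
  by (simp add: xi_slope_def add_pos_pos cosh_real_pos less_imp_le)

lemma xi_slope_antimono:
  assumes "0 \<le> \<beta>" "0 \<le> h" "h \<le> h'"
  shows "xi_slope \<beta> h' \<le> xi_slope \<beta> h"
  unfolding xi_slope_def using assms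
  by (intro divide_left_mono mult_pos_pos add_pos_pos cosh_real_pos)
    (auto simp: cosh_real_nonneg_le_iff)

lemma xi_slope_strict_antimono:
  assumes "0 < \<beta>" "0 \<le> h" "h < h'"
  shows "xi_slope \<beta> h' < xi_slope \<beta> h"
  unfolding xi_slope_def using assms
  by (intro divide_strict_left_mono mult_pos_pos add_pos_pos cosh_real_pos) (auto simp: cosh_real_strict_mono)

lemma xi_mono: "0 \<le> \<beta> \<Longrightarrow> h \<le> h' \<Longrightarrow> xi \<beta> h \<le> xi \<beta> h'"
  by (rule DERIV_nonneg_imp_nondecreasing) (auto intro: xi_has_derivative xi_slope_nonneg)

lemma xi_nonneg: "0 \<le> \<beta> \<Longrightarrow> 0 \<le> h \<Longrightarrow> 0 \<le> xi \<beta> h"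
  using xi_mono[of \<beta> 0 h] by simp

text \<open>Shifting the argument of cosh by 2 \<beta> changes it by a factor of at most exp (2
  \<beta>). An edge therefore transmits at most \<open>\<beta>\<close>, which is the message of a
  spin frozen at +1.\<close>

lemma xi_le: 
  assumes "0 \<le> \<beta>"
  shows "xi \<beta> h \<le> \<beta>"
proof -
  have "cosh (h + \<beta>) \<le> exp (2 * \<beta>) * cosh (h - \<beta>)"
  proof -
    have "exp (-h - \<beta>) \<le> exp (3 * \<beta> - h)" using assms by simp
    moreover have "exp (2 * \<beta>) * cosh (h - \<beta>) = (exp (h + \<beta>) + exp (3 * \<beta> - h)) / 2"
      by (simp add: cosh_def distrib_left exp_add[symmetric] algebra_simps)
    ultimately show ?thesis by (simp add: cosh_def)
  qed
  hence "ln (cosh (h + \<beta>)) \<le> ln (exp (2 * \<beta>) * cosh (h - \<beta>))"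
    by (subst ln_le_cancel_iff) (auto simp: cosh_real_pos)
  thus ?thesis by (simp add: xi_def ln_mult cosh_real_pos)
qed

text \<open>What has to be bounded is the logarithmic slope h xi'(h) / xi(h). The tangent at
  \<open>h\<close> meets the vertical axis at xi(h) - h xi'(h), a quantity that grows with
  \<open>h\<close> by concavity and equals \<open>gap\<close> > 0 at \<open>B\<close>; as xi never
  exceeds \<open>\<beta>\<close>, the logarithmic slope is at most 1 - gap / \<beta>. The constant
  depends on \<open>\<beta>\<close> and \<open>B\<close> alone, so the contraction is the same at
  every vertex of every tree.\<close>

lemma xi_contraction:
  assumes "0 \<le> \<beta>" "0 < B"
  obtains \<kappa> where "0 \<le> \<kappa>" "\<kappa> < 1"
    "\<And>h \<epsilon>. B \<le> h \<Longrightarrow> 0 \<le> \<epsilon> \<Longrightarrow> xi \<beta> ((1 + \<epsilon>) * h) \<le> (1 + \<kappa> * \<epsilon>) * xi \<beta> h"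
proof (cases "\<beta> = 0")
  case True
  thus ?thesis using that[of 0] by simp
next
  case False
  hence \<beta>: "0 < \<beta>" using assms by simp
  have mvt: "\<exists>z. a < z \<and> z < b \<and> xi \<beta> b - xi \<beta> a = (b - a) * xi_slope \<beta> z" if "a < b" for a b
    using MVT2[OF that, of "xi \<beta>" "xi_slope \<beta>"] xi_has_derivative by auto
  define gap where "gap = xi \<beta> B - B * xi_slope \<beta> B"
  \<comment> \<open>Strict concavity on [0, B] is what makes \<open>gap\<close> positive; this is
    where \<open>B > 0\<close> enters.\<close>
  obtain z0 where z0: "0 < z0" "z0 < B" "xi \<beta> B - xi \<beta> 0 = (B - 0) * xi_slope \<beta> z0"
    using mvt[OF assms(2)] by blast
  have "B * xi_slope \<beta> B < B * xi_slope \<beta> z0"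
    using z0 assms xi_slope_strict_antimono[OF \<beta>, of z0 B] by simp
  hence gap: "0 < gap" using z0 unfolding gap_def by simp
  have gap_le: "gap \<le> \<beta>"
    using xi_le[OF assms(1), of B] mult_nonneg_nonneg[of B "xi_slope \<beta> B"]
      xi_slope_nonneg[OF assms(1), of B] assms(2)
    unfolding gap_def by linarith
  define \<kappa> where "\<kappa> = 1 - gap / \<beta>"
  have key: "h * xi_slope \<beta> h \<le> \<kappa> * xi \<beta> h" if h: "B \<le> h" for h
  proof -
    have "xi \<beta> h - xi \<beta> B \<ge> (h - B) * xi_slope \<beta> h"
    proof (cases "B = h")
      case False
      then obtain z where z: "B < z" "z < h" "xi \<beta> h - xi \<beta> B = (h - B) * xi_slope \<beta> z"
        using mvt[of B h] h by auto
      have "xi_slope \<beta> h \<le> xi_slope \<beta> z" using z assms by (intro xi_slope_antimono) auto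
      thus ?thesis using z h by (simp add: mult_left_mono)
    qed simp
    moreover have "B * xi_slope \<beta> h \<le> B * xi_slope \<beta> B"
      using h assms by (intro mult_left_mono xi_slope_antimono) auto
    ultimately have "h * xi_slope \<beta> h \<le> xi \<beta> h - gap"
      unfolding gap_def by (simp add: algebra_simps)
    also have "gap * (xi \<beta> h / \<beta>) \<le> gap * 1"
      using xi_le[OF assms(1), of h] \<beta> gap by (intro mult_left_mono) auto
    hence "xi \<beta> h - gap \<le> \<kappa> * xi \<beta> h" by (simp add: \<kappa>_def algebra_simps)
    finally show ?thesis .
  qed
  show ?thesis
  proof (rule that[of \<kappa>])
    show "0 \<le> \<kappa>" using gap_le \<beta> by (simp add: \<kappa>_def)
    show "\<kappa> < 1" using gap \<beta> by (simp add: \<kappa>_def)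
    fix h \<epsilon> :: real
    assume h: "B \<le> h" and \<epsilon>: "0 \<le> \<epsilon>"
    show "xi \<beta> ((1 + \<epsilon>) * h) \<le> (1 + \<kappa> * \<epsilon>) * xi \<beta> h"
    proof (cases "\<epsilon> = 0")
      case False
      have "h < (1 + \<epsilon>) * h" using False \<epsilon> h assms by simp
      then obtain z where z: "h < z" "xi \<beta> ((1 + \<epsilon>) * h) - xi \<beta> h = ((1 + \<epsilon>) * h - h) * xi_slope \<beta> z"
        using mvt by blast
      have "xi_slope \<beta> z \<le> xi_slope \<beta> h" using z h assms by (intro xi_slope_antimono) auto
      hence "xi \<beta> ((1 + \<epsilon>) * h) - xi \<beta> h \<le> \<epsilon> * (h * xi_slope \<beta> h)"
        using z h assms \<epsilon> by (simp add: algebra_simps mult_left_mono)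
      also have "\<dots> \<le> \<epsilon> * (\<kappa> * xi \<beta> h)" using key[OF h] \<epsilon> by (rule mult_left_mono)
      finally show ?thesis by (simp add: algebra_simps)
    qed simp
  qed
qed

text \<open>Concavity of tanh on the positive axis, together with tanh 0 = 0. It turns a bound on
  the ratio of two fields into a bound on the difference of magnetizations.\<close>

lemma tanh_scale_le:
  fixes h l :: real
  assumes "0 \<le> h" "1 \<le> l"
  shows "tanh (l * h) \<le> l * tanh h"
proof (cases "h = 0 \<or> l = 1")
  case False
  hence h: "0 < h" "1 < l" using assms by auto
  have mvt: "\<exists>z. a < z \<and> z < b \<and> tanh b - tanh a = (b - a) * (1 - tanh z ^ 2)" if "a < b" for a b :: real
    by (rule MVT2[OF that]) (auto intro!: derivative_eq_intros)
  have anti: "1 - tanh b ^ 2 \<le> 1 - tanh a ^ 2" if "0 \<le> a" "a \<le> b" for a b :: real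
    using that by (simp add: power_mono)
  obtain z where z: "h < z" "tanh (l * h) - tanh h = (l * h - h) * (1 - tanh z ^ 2)"
    using mvt[of h "l * h"] h by auto
  obtain z' where z': "0 < z'" "z' < h" "tanh h - tanh 0 = (h - 0) * (1 - tanh z' ^ 2)"
    using mvt[of 0 h] h by auto
  have "tanh (l * h) - tanh h = (l - 1) * h * (1 - tanh z ^ 2)"
    using z(2) by (simp add: algebra_simps)
  also have "\<dots> \<le> (l - 1) * h * (1 - tanh h ^ 2)"
    using z h by (intro mult_left_mono anti) auto
  also have "\<dots> = (l - 1) * (h * (1 - tanh h ^ 2))" by simp
  also have "\<dots> \<le> (l - 1) * tanh h"
    using z' h anti[of z' h] by (intro mult_left_mono) (auto intro!: mult_left_mono)
  finally show ?thesis by (simp add: algebra_simps)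
qed auto

section \<open>Cavity fields on rooted trees\<close>

lemma xi_pos:
  assumes "0 < \<beta>" "0 < h"
  shows "0 < xi \<beta> h"
proof -
  have "0 < xi_slope \<beta> x" for x
    using assms(1) by (simp add: xi_slope_def add_pos_pos)
  hence "xi \<beta> 0 < xi \<beta> h"
    by (meson DERIV_pos_imp_increasing assms(2) xi_has_derivative)
  thus ?thesis by simp
qed

lemma xi_scale_le:
  assumes "0 \<le> \<beta>" "0 < h" "1 \<le> l"
  shows "xi \<beta> (l * h) \<le> l * xi \<beta> h"
proof -
  obtain \<kappa> where \<kappa>: "\<kappa> < 1"
    "\<And>g \<epsilon>. h \<le> g \<Longrightarrow> 0 \<le> \<epsilon> \<Longrightarrow> xi \<beta> ((1 + \<epsilon>) * g) \<le> (1 + \<kappa> * \<epsilon>) * xi \<beta> g"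
    using xi_contraction[OF assms(1,2)] by metis
  have "xi \<beta> (l * h) \<le> (1 + \<kappa> * (l - 1)) * xi \<beta> h"
    using \<kappa>(2)[of h "l - 1"] assms by simp
  also have "\<kappa> * (l - 1) \<le> 1 * (l - 1)"
    using \<kappa>(1) assms by (intro mult_right_mono) auto
  hence "(1 + \<kappa> * (l - 1)) * xi \<beta> h \<le> l * xi \<beta> h"
    using xi_nonneg[of \<beta> h] assms by (intro mult_right_mono) auto
  finally show ?thesis .
qed

text \<open>The argument \<open>a\<close> is the field put on the subtrees cut off at depth
  \<open>t\<close>. It sees the whole subtree, so that a starting value may depend on the
  degree.\<close>

primrec tree_field ::
  "real \<Rightarrow> real \<Rightarrow> ((nat list \<Rightarrow> nat) \<Rightarrow> real) \<Rightarrow> nat \<Rightarrow> (nat list \<Rightarrow> nat) \<Rightarrow> real" where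
  "tree_field \<beta> B a 0 = a"
| "tree_field \<beta> B a (Suc t) = (\<lambda>c. B + (\<Sum>i<c []. xi \<beta> (tree_field \<beta> B a t (subtree c i))))"

abbreviation free_field :: "real \<Rightarrow> real \<Rightarrow> nat \<Rightarrow> (nat list \<Rightarrow> nat) \<Rightarrow> real" where
  "free_field \<beta> B \<equiv> tree_field \<beta> B (\<lambda>_. B)"

text \<open>The starting value is the field at a vertex all of whose children are frozen at +1.
  Depth \<open>t\<close> of this recursion thus corresponds to a plus boundary at depth
  \<open>t + 1\<close>.\<close>

abbreviation plus_field :: "real \<Rightarrow> real \<Rightarrow> nat \<Rightarrow> (nat list \<Rightarrow> nat) \<Rightarrow> real" where
  "plus_field \<beta> B \<equiv> tree_field \<beta> B (\<lambda>c. B + \<beta> * real (c []))"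

lemma tree_field_mono:
  assumes "0 \<le> \<beta>" "B \<le> B'" "\<And>c. a c \<le> a' c"
  shows "tree_field \<beta> B a t c \<le> tree_field \<beta> B' a' t c"
  by (induction t arbitrary: c) (auto intro!: add_mono sum_mono xi_mono assms)

text \<open>Peels a level off at the boundary instead of the root: depths \<open>t\<close> and
  \<open>t + 1\<close> become two boundary values for the same recursion of depth \<open>t\<close>,
  to which \<open>tree_field_mono\<close> applies.\<close>

lemma tree_field_Suc': "tree_field \<beta> B a (Suc t) = tree_field \<beta> B (tree_field \<beta> B a (Suc 0)) t"
  by (induction t) (simp_all add: fun_eq_iff)

lemma tree_field_ge:
  assumes "0 \<le> \<beta>" "0 \<le> B" "\<And>c. B \<le> a c"
  shows "B \<le> tree_field \<beta> B a t c"
proof (induction t arbitrary: c)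
  case (Suc t)
  have "0 \<le> (\<Sum>i<c []. xi \<beta> (tree_field \<beta> B a t (subtree c i)))"
    using Suc assms by (intro sum_nonneg xi_nonneg) (auto intro: order_trans)
  thus ?case by simp
qed (simp add: assms)

lemma tree_field_le:
  assumes "0 \<le> \<beta>" "\<And>c. a c \<le> B + \<beta> * real (c [])"
  shows "tree_field \<beta> B a t c \<le> B + \<beta> * real (c [])"
proof (cases t)
  case (Suc s)
  have "(\<Sum>i<c []. xi \<beta> (tree_field \<beta> B a s (subtree c i))) \<le> (\<Sum>i<c []. \<beta>)"
    by (intro sum_mono xi_le assms)
  thus ?thesis using Suc by (simp add: mult.commute)
qed (simp add: assms)

lemma free_field_ge: "0 \<le> \<beta> \<Longrightarrow> 0 \<le> B \<Longrightarrow> B \<le> free_field \<beta> B t c"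
  by (rule tree_field_ge) auto

lemma free_field_le: "0 \<le> \<beta> \<Longrightarrow> free_field \<beta> B t c \<le> B + \<beta> * real (c [])"
  by (rule tree_field_le) auto

lemma free_field_le_plus_field: "0 \<le> \<beta> \<Longrightarrow> free_field \<beta> B t c \<le> plus_field \<beta> B t c"
  by (rule tree_field_mono) auto

lemma free_field_mono: "0 \<le> \<beta> \<Longrightarrow> B \<le> B' \<Longrightarrow> free_field \<beta> B t c \<le> free_field \<beta> B' t c"
  by (rule tree_field_mono) auto

lemma free_field_incseq:
  assumes "0 \<le> \<beta>" "0 \<le> B"
  shows "incseq (\<lambda>t. free_field \<beta> B t c)"
proof (rule incseq_SucI)
  fix t
  show "free_field \<beta> B t c \<le> free_field \<beta> B (Suc t) c"
    unfolding tree_field_Suc'[of _ _ _ t] using assms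
    by (intro tree_field_mono) (auto intro!: mult_nonneg_nonneg xi_nonneg)
qed

text \<open>A concave function vanishing at 0 satisfies xi(l h) <= l xi(h) for l >= 1, so
  multiplying the external field by l multiplies no field in the tree by more than l. This replaces
  differentiability of the fields in \<open>B\<close>.\<close>

lemma free_field_scale:
  assumes "0 \<le> \<beta>" "0 < B" "B \<le> B'"
  shows "free_field \<beta> B' t c \<le> B' / B * free_field \<beta> B t c"
proof (induction t arbitrary: c)
  case (Suc t)
  have "xi \<beta> (free_field \<beta> B' t d) \<le> B' / B * xi \<beta> (free_field \<beta> B t d)" for d
  proof -
    have "xi \<beta> (free_field \<beta> B' t d) \<le> xi \<beta> (B' / B * free_field \<beta> B t d)"
      by (intro xi_mono Suc assms)
    also have "\<dots> \<le> B' / B * xi \<beta> (free_field \<beta> B t d)"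
      using free_field_ge[of \<beta> B t d] assms by (intro xi_scale_le) (auto simp: divide_simps)
    finally show ?thesis .
  qed
  thus ?case using assms by (auto simp: distrib_left sum_distrib_left intro!: sum_mono)
qed (use assms in auto)

section \<open>Limiting fields: uniqueness and dependence on the external field\<close>

definition lim_field :: "real \<Rightarrow> real \<Rightarrow> (nat list \<Rightarrow> nat) \<Rightarrow> real" where
  "lim_field \<beta> B c = lim (\<lambda>t. free_field \<beta> B t c)"

lemma free_field_tendsto:
  assumes "0 \<le> \<beta>" "0 \<le> B"
  shows "(\<lambda>t. free_field \<beta> B t c) \<longlonglongrightarrow> lim_field \<beta> B c"
proof -
  obtain L where "(\<lambda>t. free_field \<beta> B t c) \<longlonglongrightarrow> L"
    using incseq_convergent[OF free_field_incseq[OF assms], of c] free_field_le[OF assms(1)] by metis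
  thus ?thesis unfolding lim_field_def by (simp add: limI)
qed

lemma lim_field_ge: "0 \<le> \<beta> \<Longrightarrow> 0 \<le> B \<Longrightarrow> B \<le> lim_field \<beta> B c"
  by (rule LIMSEQ_le_const[OF free_field_tendsto]) (auto intro: free_field_ge)

text \<open>A sum of positive terms has at most the largest ratio of its terms, and the common
  summand \<open>B\<close> has ratio 1, so a relative error does not grow at a vertex of any degree
  and shrinks by \<open>\<kappa>\<close> at each edge. The bound begins at depth
  \<open>Suc t\<close> because the plus starting value contains the degree and has no bounded ratio
  to \<open>B\<close> until \<open>xi\<close> has capped it.\<close>

lemma plus_field_le_scale:
  assumes "0 \<le> \<beta>" "0 < B"
  obtains \<kappa> K where "0 \<le> \<kappa>" "\<kappa> < 1"
    "\<And>t c. plus_field \<beta> B (Suc t) c \<le> (1 + K * \<kappa> ^ t) * free_field \<beta> B (Suc t) c"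
proof -
  obtain \<kappa> where \<kappa>: "0 \<le> \<kappa>" "\<kappa> < 1"
    "\<And>h \<epsilon>. B \<le> h \<Longrightarrow> 0 \<le> \<epsilon> \<Longrightarrow> xi \<beta> ((1 + \<epsilon>) * h) \<le> (1 + \<kappa> * \<epsilon>) * xi \<beta> h"
    using xi_contraction[OF assms] by metis
  \<comment> \<open>At depth 0 the plus message is at most \<open>\<beta>\<close> and the free one
    is \<open>xi \<beta> B\<close>, so \<open>K\<close> bounds the relative excess. At
    \<open>\<beta> = 0\<close> this is 0 / 0 = 0 and both messages vanish.\<close>
  define K where "K = \<beta> / xi \<beta> B"
  have K: "0 \<le> K" unfolding K_def using assms xi_nonneg[of \<beta> B] by auto
  have step: "plus_field \<beta> B (Suc t) c \<le> (1 + K * \<kappa> ^ t) * free_field \<beta> B (Suc t) c"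
    if "\<And>d. xi \<beta> (plus_field \<beta> B t d) \<le> (1 + K * \<kappa> ^ t) * xi \<beta> (free_field \<beta> B t d)" for t c
  proof -
    have "B \<le> (1 + K * \<kappa> ^ t) * B"
      using K \<kappa>(1) assms by simp
    moreover have "(\<Sum>i<c []. xi \<beta> (plus_field \<beta> B t (subtree c i)))
        \<le> (\<Sum>i<c []. (1 + K * \<kappa> ^ t) * xi \<beta> (free_field \<beta> B t (subtree c i)))"
      by (intro sum_mono that)
    ultimately show ?thesis by (simp add: distrib_left sum_distrib_left)
  qed
  have main: "xi \<beta> (plus_field \<beta> B t c) \<le> (1 + K * \<kappa> ^ t) * xi \<beta> (free_field \<beta> B t c)" for t c
  proof (induction t arbitrary: c)
    case 0
    show ?case
    proof (cases "\<beta> = 0")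
      case False
      hence "xi \<beta> B > 0" using assms by (intro xi_pos) auto
      moreover have "xi \<beta> (plus_field \<beta> B 0 c) \<le> \<beta>" by (rule xi_le[OF assms(1)])
      ultimately show ?thesis by (simp add: K_def distrib_right)
    qed simp
  next
    case (Suc t)
    have "xi \<beta> (plus_field \<beta> B (Suc t) c) \<le> xi \<beta> ((1 + K * \<kappa> ^ t) * free_field \<beta> B (Suc t) c)"
      by (intro xi_mono assms step Suc.IH)
    also have "\<dots> \<le> (1 + \<kappa> * (K * \<kappa> ^ t)) * xi \<beta> (free_field \<beta> B (Suc t) c)"
      using K \<kappa>(1) assms by (intro \<kappa>(3) free_field_ge) auto
    finally show ?case by (simp add: mult_ac)
  qed
  show ?thesis
    by (rule that[OF \<kappa>(1,2) step[OF main]])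
qed

lemma plus_field_tendsto:
  assumes "0 \<le> \<beta>" "0 < B"
  shows "(\<lambda>t. plus_field \<beta> B t c) \<longlonglongrightarrow> lim_field \<beta> B c"
proof -
  obtain \<kappa> K where \<kappa>: "0 \<le> \<kappa>" "\<kappa> < 1"
    "\<And>t c. plus_field \<beta> B (Suc t) c \<le> (1 + K * \<kappa> ^ t) * free_field \<beta> B (Suc t) c"
    using plus_field_le_scale[OF assms] by metis
  have free: "(\<lambda>t. free_field \<beta> B (Suc t) c) \<longlonglongrightarrow> lim_field \<beta> B c"
    using LIMSEQ_Suc[OF free_field_tendsto[of \<beta> B c]] assms by simp
  have "(\<lambda>t. (1 + K * \<kappa> ^ t) * free_field \<beta> B (Suc t) c) \<longlonglongrightarrow> (1 + K * 0) * lim_field \<beta> B c"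
    using \<kappa> by (intro tendsto_intros LIMSEQ_power_zero free) auto
  hence up: "(\<lambda>t. (1 + K * \<kappa> ^ t) * free_field \<beta> B (Suc t) c) \<longlonglongrightarrow> lim_field \<beta> B c"
    by simp
  have "(\<lambda>t. plus_field \<beta> B (Suc t) c) \<longlonglongrightarrow> lim_field \<beta> B c"
  proof (rule tendsto_sandwich[OF _ _ free up])
    show "\<forall>\<^sub>F t in sequentially. free_field \<beta> B (Suc t) c \<le> plus_field \<beta> B (Suc t) c"
      using free_field_le_plus_field[OF assms(1)] by (rule always_eventually[OF allI])
    show "\<forall>\<^sub>F t in sequentially. plus_field \<beta> B (Suc t) c \<le> (1 + K * \<kappa> ^ t) * free_field \<beta> B (Suc t) c"
      using \<kappa>(3) by (rule always_eventually[OF allI])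
  qed
  thus ?thesis by (rule LIMSEQ_imp_Suc)
qed

lemma lim_field_rec:
  assumes "0 \<le> \<beta>" "0 \<le> B"
  shows "lim_field \<beta> B c = B + (\<Sum>i<c []. xi \<beta> (lim_field \<beta> B (subtree c i)))"
proof (rule LIMSEQ_unique)
  show "(\<lambda>t. free_field \<beta> B (Suc t) c) \<longlonglongrightarrow> lim_field \<beta> B c"
    by (rule LIMSEQ_Suc[OF free_field_tendsto[OF assms]])
  show "(\<lambda>t. free_field \<beta> B (Suc t) c) \<longlonglongrightarrow> B + (\<Sum>i<c []. xi \<beta> (lim_field \<beta> B (subtree c i)))"
    by (auto intro!: tendsto_intros free_field_tendsto assms)
qed

lemma lim_field_mono:
  assumes "0 \<le> \<beta>" "0 \<le> B" "B \<le> B'"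
  shows "lim_field \<beta> B c \<le> lim_field \<beta> B' c"
  using assms by (intro LIMSEQ_le[OF free_field_tendsto free_field_tendsto]) (auto intro: free_field_mono)

lemma lim_field_scale:
  assumes "0 \<le> \<beta>" "0 < B" "B \<le> B'"
  shows "lim_field \<beta> B' c \<le> B' / B * lim_field \<beta> B c"
proof (rule LIMSEQ_le)
  show "(\<lambda>t. free_field \<beta> B' t c) \<longlonglongrightarrow> lim_field \<beta> B' c"
    using assms by (intro free_field_tendsto) auto
  show "(\<lambda>t. B' / B * free_field \<beta> B t c) \<longlonglongrightarrow> B' / B * lim_field \<beta> B c"
    using assms by (intro tendsto_intros free_field_tendsto) auto
qed (use free_field_scale[OF assms] in auto)

text \<open>The field itself grows with the degree, but its relative change is at most B' / B - 1,
  and concavity transfers this to tanh, which is at most 1. The constant 1 / b is then the same for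
  all trees.\<close>

lemma tanh_lim_field_lipschitz:
  assumes "0 \<le> \<beta>" "0 < b" "b \<le> B" "b \<le> B'"
  shows "\<bar>tanh (lim_field \<beta> B c) - tanh (lim_field \<beta> B' c)\<bar> \<le> \<bar>B - B'\<bar> / b"
proof -
  have *: "\<bar>tanh (lim_field \<beta> B c) - tanh (lim_field \<beta> B' c)\<bar> \<le> (B' - B) / b"
    if "b \<le> B" "B \<le> B'" for B B'
  proof -
    have B: "0 < B" using assms that by simp
    have "tanh (lim_field \<beta> B' c) \<le> tanh (B' / B * lim_field \<beta> B c)"
      using lim_field_scale[OF assms(1) B that(2)] by simp
    also have "\<dots> \<le> B' / B * tanh (lim_field \<beta> B c)"
      using lim_field_ge[of \<beta> B c] assms B that by (intro tanh_scale_le) (auto simp: divide_simps)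
    finally have "tanh (lim_field \<beta> B' c) - tanh (lim_field \<beta> B c) \<le> (B' / B - 1) * tanh (lim_field \<beta> B c)"
      by (simp add: algebra_simps)
    also have "\<dots> \<le> (B' / B - 1) * 1"
      using B that tanh_real_lt_1[of "lim_field \<beta> B c"] by (intro mult_left_mono) (auto simp: divide_simps)
    also have "\<dots> = (B' - B) / B" using B by (simp add: diff_divide_distrib)
    also have "\<dots> \<le> (B' - B) / b" using assms that by (intro divide_left_mono) auto
    finally have "tanh (lim_field \<beta> B' c) - tanh (lim_field \<beta> B c) \<le> (B' - B) / b" .
    moreover have "tanh (lim_field \<beta> B c) \<le> tanh (lim_field \<beta> B' c)"
      using lim_field_mono[OF assms(1), of B B' c] B that by simp
    ultimately show ?thesis by simp
  qed
  show ?thesis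
    using *[of B B'] *[of B' B] assms by (cases "B \<le> B'") (auto simp: abs_minus_commute)
qed

section \<open>Root marginals on finite tree balls\<close>

lemma finite_spins [simp]: "finite spins"
  by (simp add: spins_def)

lemma sum_spins: "(\<Sum>s\<in>spins. f s) = f (-1) + f 1"
  by (simp add: spins_def)

lemma Nil_in_tree_ball [simp]: "[] \<in> tree_ball c t"
  by (simp add: tree_ball_def tree_verts_def)

lemma Cons_in_tree_verts [simp]:
  "i # y \<in> tree_verts c \<longleftrightarrow> i < c [] \<and> y \<in> tree_verts (subtree c i)"
  by (auto simp: tree_verts_def All_less_Suc2 subtree_def)

lemma Cons_in_tree_ball [simp]:
  "i # y \<in> tree_ball c (Suc t) \<longleftrightarrow> i < c [] \<and> y \<in> tree_ball (subtree c i) t"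
  by (auto simp: tree_ball_def)

lemma tree_ball_0: "tree_ball c 0 = {[]}"
  by (auto simp: tree_ball_def tree_verts_def)

lemma tree_ball_Suc:
  "tree_ball c (Suc t) = insert [] (\<Union>i<c []. (#) i ` tree_ball (subtree c i) t)"
proof (rule set_eqI)
  fix x show "x \<in> tree_ball c (Suc t) \<longleftrightarrow> x \<in> insert [] (\<Union>i<c []. (#) i ` tree_ball (subtree c i) t)"
    by (cases x) auto
qed

lemma finite_tree_ball [simp]: "finite (tree_ball c t)"
  by (induction t arbitrary: c) (auto simp: tree_ball_0 tree_ball_Suc)

lemma sum_tree_ball_Suc:
  fixes f :: "nat list \<Rightarrow> real"
  shows "sum f (tree_ball c (Suc t)) = f [] + (\<Sum>i<c []. \<Sum>y\<in>tree_ball (subtree c i) t. f (i # y))"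
proof -
  have "sum f (\<Union>i\<in>{..<c []}. (#) i ` tree_ball (subtree c i) t) =
      (\<Sum>i<c []. sum f ((#) i ` tree_ball (subtree c i) t))"
    by (rule sum.UNION_disjoint) auto
  thus ?thesis unfolding tree_ball_Suc
    by (subst sum.insert) (auto simp: sum.reindex)
qed

lemma ising_tree_weight_Suc:
  "ising_tree_weight \<beta> B (tree_ball c (Suc t)) \<sigma> =
     exp (B * \<sigma> []) * (\<Prod>i<c []. exp (\<beta> * \<sigma> [] * \<sigma> [i]) *
       ising_tree_weight \<beta> B (tree_ball (subtree c i) t) (\<lambda>y. \<sigma> (i # y)))"
proof -
  have root: "(\<Sum>w\<in>tree_ball c (Suc t). if \<exists>k. w = [] @ [k] then \<sigma> [] * \<sigma> w else 0) = (\<Sum>i<c []. \<sigma> [] * \<sigma> [i])"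
    unfolding sum_tree_ball_Suc
    by (auto intro!: sum.cong simp: if_distrib[of "\<lambda>u. u = _"] sum.delta cong: if_cong)
  have inner: "(\<Sum>w\<in>tree_ball c (Suc t). if \<exists>k. w = (i # y) @ [k] then \<sigma> (i # y) * \<sigma> w else 0) =
      (\<Sum>z\<in>tree_ball (subtree c i) t. if \<exists>k. z = y @ [k] then \<sigma> (i # y) * \<sigma> (i # z) else 0)"
    if "i < c []" for i y
  proof -
    have "(\<Sum>w\<in>tree_ball c (Suc t). if \<exists>k. w = (i # y) @ [k] then \<sigma> (i # y) * \<sigma> w else 0) =
      (\<Sum>j<c []. if j = i then \<Sum>z\<in>tree_ball (subtree c i) t. if \<exists>k. z = y @ [k] then \<sigma> (i # y) * \<sigma> (i # z) else 0 else 0)"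
      unfolding sum_tree_ball_Suc
    proof -
      have "(\<Sum>z\<in>tree_ball (subtree c j) t. if \<exists>k. j # z = (i # y) @ [k] then \<sigma> (i # y) * \<sigma> (j # z) else 0) =
        (if j = i then \<Sum>z\<in>tree_ball (subtree c i) t. if \<exists>k. z = y @ [k] then \<sigma> (i # y) * \<sigma> (i # z) else 0 else 0)"
        for j by (cases "j = i") auto
      thus "(if \<exists>k. [] = (i # y) @ [k] then \<sigma> (i # y) * \<sigma> [] else 0) +
          (\<Sum>j<c []. \<Sum>z\<in>tree_ball (subtree c j) t. if \<exists>k. j # z = (i # y) @ [k] then \<sigma> (i # y) * \<sigma> (j # z) else 0) =
        (\<Sum>j<c []. if j = i then \<Sum>z\<in>tree_ball (subtree c i) t. if \<exists>k. z = y @ [k] then \<sigma> (i # y) * \<sigma> (i # z) else 0 else 0)"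
        by simp
    qed
    thus ?thesis using that by simp
  qed
  have "(\<Sum>v\<in>tree_ball c (Suc t). \<Sum>w\<in>tree_ball c (Suc t). if \<exists>k. w = v @ [k] then \<sigma> v * \<sigma> w else 0) =
     (\<Sum>i<c []. \<sigma> [] * \<sigma> [i]) + (\<Sum>i<c []. \<Sum>y\<in>tree_ball (subtree c i) t. \<Sum>z\<in>tree_ball (subtree c i) t.
        if \<exists>k. z = y @ [k] then \<sigma> (i # y) * \<sigma> (i # z) else 0)"
    by (subst sum_tree_ball_Suc, subst root) (simp add: inner del: append_Cons)
  hence "ising_tree_weight \<beta> B (tree_ball c (Suc t)) \<sigma> = exp (B * \<sigma> [] + (\<Sum>i<c []. \<beta> * \<sigma> [] * \<sigma> [i] +
     (\<beta> * (\<Sum>y\<in>tree_ball (subtree c i) t. \<Sum>z\<in>tree_ball (subtree c i) t.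
        if \<exists>k. z = y @ [k] then \<sigma> (i # y) * \<sigma> (i # z) else 0) + B * (\<Sum>y\<in>tree_ball (subtree c i) t. \<sigma> (i # y)))))"
    unfolding ising_tree_weight_def
    by (simp add: sum_tree_ball_Suc sum.distrib sum_distrib_left algebra_simps)
  thus ?thesis by (simp add: exp_add exp_sum ising_tree_weight_def)
qed

lemma ising_tree_weight_cong:
  assumes "\<And>v. v \<in> V \<Longrightarrow> \<sigma> v = \<tau> v"
  shows "ising_tree_weight \<beta> B V \<sigma> = ising_tree_weight \<beta> B V \<tau>"
  unfolding ising_tree_weight_def using assms by (simp cong: sum.cong if_cong)

text \<open>\<open>A k\<close> is the set of spins allowed at height \<open>k\<close> above the
  boundary sphere. Indexing by height, not depth, makes the configurations on a child subtree an
  instance of the same definition with \<open>t\<close> lowered by one, and covers free and plus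
  boundaries together.\<close>

definition tree_configs :: "(nat \<Rightarrow> real set) \<Rightarrow> (nat list \<Rightarrow> nat) \<Rightarrow> nat \<Rightarrow> (nat list \<Rightarrow> real) set" where
  "tree_configs A c t = (\<Pi>\<^sub>E v\<in>tree_ball c t. A (t - length v))"

lemma tree_configs_root: "\<sigma> \<in> tree_configs A c t \<Longrightarrow> \<sigma> [] \<in> A t"
  using PiE_mem[of \<sigma> "tree_ball c t" "\<lambda>v. A (t - length v)" "[]"] by (simp add: tree_configs_def)

definition tree_Z :: "real \<Rightarrow> real \<Rightarrow> (nat \<Rightarrow> real set) \<Rightarrow> (nat list \<Rightarrow> nat) \<Rightarrow> nat \<Rightarrow> real \<Rightarrow> real" where
  "tree_Z \<beta> B A c t s =
     (\<Sum>\<sigma>\<in>{\<sigma>\<in>tree_configs A c t. \<sigma> [] = s}. ising_tree_weight \<beta> B (tree_ball c t) \<sigma>)"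

text \<open>Given the root spin, a configuration is an independent choice on each child subtree;
  \<open>?g\<close> cuts it into these pieces and \<open>?f\<close> glues them, with
  \<open>restrict\<close> keeping both sides extensional. Membership of \<open>s\<close> in
  \<open>A (Suc t)\<close> excludes an empty left side.\<close>

lemma tree_Z_Suc:
  assumes A: "\<And>k. A k \<subseteq> spins" and s: "s \<in> A (Suc t)"
  shows "tree_Z \<beta> B A c (Suc t) s =
     exp (B * s) * (\<Prod>i<c []. \<Sum>s'\<in>spins. exp (\<beta> * s * s') * tree_Z \<beta> B A (subtree c i) t s')"
proof -
  let ?I = "{..<c []}" and ?b = "\<lambda>i. tree_ball (subtree c i) t" and ?C = "\<lambda>i. tree_configs A (subtree c i) t"
  let ?w = "\<lambda>i \<tau>. exp (\<beta> * s * \<tau> []) * ising_tree_weight \<beta> B (?b i) \<tau>"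
  let ?f = "\<lambda>\<tau>. restrict (\<lambda>x. case x of [] \<Rightarrow> s | i # y \<Rightarrow> \<tau> i y) (tree_ball c (Suc t))"
  let ?g = "\<lambda>\<sigma>. restrict (\<lambda>i. restrict (\<lambda>y. \<sigma> (i # y)) (?b i)) ?I"
  have finA: "finite (A k)" for k using A finite_subset[OF _ finite_spins] by blast
  have fin: "finite (?C i)" for i
    unfolding tree_configs_def by (intro finite_PiE finite_tree_ball finA)
  have "tree_Z \<beta> B A c (Suc t) s = (\<Sum>\<tau>\<in>PiE ?I ?C. exp (B * s) * (\<Prod>i\<in>?I. ?w i (\<tau> i)))"
    unfolding tree_Z_def
  proof (rule sum.reindex_bij_witness[where i = ?f and j = ?g])
    fix \<sigma> assume "\<sigma> \<in> {\<sigma> \<in> tree_configs A c (Suc t). \<sigma> [] = s}"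
    hence \<sigma>: "\<sigma> \<in> (\<Pi>\<^sub>E v\<in>tree_ball c (Suc t). A (Suc t - length v))" "\<sigma> [] = s"
      by (auto simp: tree_configs_def)
    show "?f (?g \<sigma>) = \<sigma>"
    proof
      fix x show "?f (?g \<sigma>) x = \<sigma> x"
        using \<sigma> by (cases x) (auto simp: PiE_def extensional_def restrict_def)
    qed
    have "\<sigma> (i # y) \<in> A (t - length y)" if "i < c []" "y \<in> ?b i" for i y
      using PiE_mem[OF \<sigma>(1), of "i # y"] that by simp
    thus "?g \<sigma> \<in> PiE ?I ?C" by (auto simp: tree_configs_def)
    have "ising_tree_weight \<beta> B (?b i) (?g \<sigma> i) = ising_tree_weight \<beta> B (?b i) (\<lambda>y. \<sigma> (i # y))"
      if "i \<in> ?I" for i using that by (intro ising_tree_weight_cong) auto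
    thus "exp (B * s) * (\<Prod>i\<in>?I. ?w i (?g \<sigma> i)) = ising_tree_weight \<beta> B (tree_ball c (Suc t)) \<sigma>"
      unfolding ising_tree_weight_Suc \<sigma>(2)
      by (intro arg_cong2[where f = "(*)"] prod.cong refl) auto
  next
    fix \<tau> assume \<tau>: "\<tau> \<in> PiE ?I ?C"
    show "?g (?f \<tau>) = \<tau>"
    proof (rule ext)
      fix i show "?g (?f \<tau>) i = \<tau> i"
      proof (cases "i \<in> ?I")
        case True
        hence "\<tau> i \<in> ?C i" using \<tau> by auto
        thus ?thesis using True
          by (auto simp: tree_configs_def PiE_def extensional_def restrict_def fun_eq_iff)
      qed (use \<tau> in \<open>auto simp: PiE_def extensional_def\<close>)
    qed
    show "?f \<tau> \<in> {\<sigma> \<in> tree_configs A c (Suc t). \<sigma> [] = s}"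
    proof -
      have "?f \<tau> x \<in> A (Suc t - length x)" if "x \<in> tree_ball c (Suc t)" for x
        using that \<tau> s by (cases x) (fastforce simp: tree_configs_def PiE_iff)+
      thus ?thesis by (auto simp: tree_configs_def)
    qed
  qed
  also have "\<dots> = exp (B * s) * (\<Prod>i\<in>?I. \<Sum>\<tau>\<in>?C i. ?w i \<tau>)"
    by (subst prod_sum_PiE) (auto simp: fin sum_distrib_left)
  finally have total: "tree_Z \<beta> B A c (Suc t) s = exp (B * s) * (\<Prod>i\<in>?I. \<Sum>\<tau>\<in>?C i. ?w i \<tau>)" .
  have "(\<Sum>\<tau>\<in>?C i. ?w i \<tau>) = (\<Sum>s'\<in>spins. exp (\<beta> * s * s') * tree_Z \<beta> B A (subtree c i) t s')" for i
  proof -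
    have "(\<Sum>s'\<in>spins. \<Sum>\<tau>\<in>{\<tau>\<in>?C i. \<tau> [] = s'}. ?w i \<tau>) = (\<Sum>\<tau>\<in>?C i. ?w i \<tau>)"
    proof (rule sum.group[OF fin finite_spins])
      show "(\<lambda>\<tau>. \<tau> []) ` ?C i \<subseteq> spins"
        using A[of t] tree_configs_root by blast
    qed
    thus ?thesis by (auto simp: tree_Z_def sum_distrib_left intro!: sum.cong)
  qed
  thus ?thesis using total by simp
qed

lemma tree_Z_0: "tree_Z \<beta> B A c 0 s = (if s \<in> A 0 then exp (B * s) else 0)"
proof -
  have "{\<sigma>\<in>tree_configs A c 0. \<sigma> [] = s} = (if s \<in> A 0 then {restrict (\<lambda>_. s) {[]}} else {})"
    by (auto simp: tree_configs_def tree_ball_0 PiE_def extensional_def fun_eq_iff)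
  thus ?thesis by (simp add: tree_Z_def ising_tree_weight_def tree_ball_0)
qed

text \<open>A positive function on two spins is a constant times exp (x s): the constant is the
  geometric mean of its values and x half their log ratio. Applied to cosh (h + \<beta> s), this is
  the origin of \<open>xi\<close>.\<close>

lemma cosh_add_spin:
  assumes "s \<in> spins"
  shows "2 * cosh (h + \<beta> * s) = 2 * sqrt (cosh (h + \<beta>) * cosh (h - \<beta>)) * exp (xi \<beta> h * s)"
proof -
  have ln_eq: "ln (sqrt (cosh (h + \<beta>) * cosh (h - \<beta>))) = (ln (cosh (h + \<beta>)) + ln (cosh (h - \<beta>))) / 2"
    by (simp add: ln_sqrt ln_mult)
  have "cosh (h + \<beta> * s) = exp (ln (cosh (h + \<beta> * s)))" by simp
  also have "ln (cosh (h + \<beta> * s)) = ln (sqrt (cosh (h + \<beta>) * cosh (h - \<beta>))) + xi \<beta> h * s"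
    using assms unfolding ln_eq by (auto simp: spins_def xi_def field_simps)
  finally show ?thesis by (simp add: exp_add)
qed

definition gibbs1 :: "real \<Rightarrow> real \<Rightarrow> real" where
  "gibbs1 h s = exp (h * s) / (2 * cosh h)"

text \<open>Partition functions with given root spin are followed only up to a positive factor: the
  factor cancels in a marginal, and products of such functions simply add their fields.\<close>

definition prop_gibbs :: "(real \<Rightarrow> real) \<Rightarrow> real \<Rightarrow> bool" where
  "prop_gibbs z h \<longleftrightarrow> (\<exists>K>0. \<forall>s\<in>spins. z s = K * exp (h * s))"

lemma prop_gibbs_normalize:
  assumes "prop_gibbs z h" "s \<in> spins"
  shows "z s / (\<Sum>s\<in>spins. z s) = gibbs1 h s"
proof -
  obtain K where K: "K > 0" "\<And>s. s \<in> spins \<Longrightarrow> z s = K * exp (h * s)"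
    using assms(1) by (auto simp: prop_gibbs_def)
  have "(\<Sum>s\<in>spins. z s) = K * (2 * cosh h)"
    using K(2)[of 1] K(2)[of "-1"] by (simp add: sum_spins cosh_def spins_def algebra_simps)
  thus ?thesis using K assms(2) by (simp add: gibbs1_def)
qed

lemma prop_gibbs_step:
  assumes "\<And>i. i \<in> I \<Longrightarrow> prop_gibbs (z i) (h i)" "finite I"
    "\<And>s. s \<in> spins \<Longrightarrow> z' s = exp (B * s) * (\<Prod>i\<in>I. \<Sum>s'\<in>spins. exp (\<beta> * s * s') * z i s')"
  shows "prop_gibbs z' (B + (\<Sum>i\<in>I. xi \<beta> (h i)))"
proof -
  have "\<forall>i\<in>I. \<exists>K>0. \<forall>s\<in>spins. z i s = K * exp (h i * s)"
    using assms(1) by (simp add: prop_gibbs_def)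
  then obtain K where K: "\<And>i. i \<in> I \<Longrightarrow> K i > 0" "\<And>i s. i \<in> I \<Longrightarrow> s \<in> spins \<Longrightarrow> z i s = K i * exp (h i * s)"
    by metis
  let ?K = "\<Prod>i\<in>I. K i * (2 * sqrt (cosh (h i + \<beta>) * cosh (h i - \<beta>)))"
  have "?K > 0" using K(1) by (intro prod_pos) auto
  moreover have "z' s = ?K * exp ((B + (\<Sum>i\<in>I. xi \<beta> (h i))) * s)" if s: "s \<in> spins" for s
  proof -
    have "(\<Sum>s'\<in>spins. exp (\<beta> * s * s') * z i s') = K i * (2 * sqrt (cosh (h i + \<beta>) * cosh (h i - \<beta>))) * exp (xi \<beta> (h i) * s)"
      if "i \<in> I" for i
    proof -
      have "(\<Sum>s'\<in>spins. exp (\<beta> * s * s') * z i s') = K i * (exp (h i + \<beta> * s) + exp (- (h i + \<beta> * s)))"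
        using K(2)[OF that, of 1] K(2)[OF that, of "-1"]
        by (simp add: sum_spins spins_def algebra_simps exp_add[symmetric])
      also have "exp (h i + \<beta> * s) + exp (- (h i + \<beta> * s)) = 2 * cosh (h i + \<beta> * s)"
        by (simp add: cosh_def)
      finally show ?thesis using cosh_add_spin[OF s, of "h i" \<beta>] by simp
    qed
    hence "z' s = exp (B * s) * (?K * (\<Prod>i\<in>I. exp (xi \<beta> (h i) * s)))"
      using assms(3)[OF s] by (simp add: prod.distrib[symmetric])
    moreover have "exp ((B + (\<Sum>i\<in>I. xi \<beta> (h i))) * s) = exp (B * s) * (\<Prod>i\<in>I. exp (xi \<beta> (h i) * s))"
      by (simp add: exp_sum[OF assms(2), symmetric] sum_distrib_right distrib_right exp_add)
    ultimately show ?thesis by simp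
  qed
  ultimately show ?thesis unfolding prop_gibbs_def by blast
qed

section \<open>Free and plus boundary conditions in terms of fields\<close>

definition plus_spins :: "nat \<Rightarrow> real set" where
  "plus_spins k = (if k = 0 then {1} else spins)"

lemma tree_Z_free: "prop_gibbs (tree_Z \<beta> B (\<lambda>_. spins) c t) (free_field \<beta> B t c)"
proof (induction t arbitrary: c)
  case 0
  show ?case by (auto simp: prop_gibbs_def tree_Z_0 intro!: exI[of _ 1])
next
  case (Suc t)
  show ?case unfolding tree_field.simps
    by (rule prop_gibbs_step[OF Suc]) (simp_all add: tree_Z_Suc)
qed

text \<open>The radii differ by one: the sphere at depth \<open>t + 1\<close> is frozen, so the
  first sphere carrying a field is at depth \<open>t\<close>, with the starting value of
  \<open>plus_field\<close>.\<close>

lemma tree_Z_plus: "prop_gibbs (tree_Z \<beta> B plus_spins c (Suc t)) (plus_field \<beta> B t c)"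
proof (induction t arbitrary: c)
  case 0
  have "tree_Z \<beta> B plus_spins c (Suc 0) s = exp (B * real (c [])) * exp ((B + \<beta> * real (c [])) * s)"
    if "s \<in> spins" for s
    using that
    by (subst tree_Z_Suc)
       (auto simp: plus_spins_def tree_Z_0 sum_spins exp_add[symmetric] exp_of_nat_mult[symmetric] spins_def algebra_simps)
  thus ?case by (auto simp: prop_gibbs_def intro!: exI[of _ "exp (B * real (c []))"])
next
  case (Suc t)
  have "s \<in> spins \<Longrightarrow> tree_Z \<beta> B plus_spins c (Suc (Suc t)) s = exp (B * s) *
      (\<Prod>i<c []. \<Sum>s'\<in>spins. exp (\<beta> * s * s') * tree_Z \<beta> B plus_spins (subtree c i) (Suc t) s')" for s
    by (rule tree_Z_Suc) (auto simp: plus_spins_def spins_def)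
  thus ?case unfolding tree_field.simps by (intro prop_gibbs_step[OF Suc]) auto
qed

lemma sum_tree_Z:
  assumes "\<And>k. A k \<subseteq> spins"
  shows "(\<Sum>s\<in>spins. tree_Z \<beta> B A c t s) = (\<Sum>\<sigma>\<in>tree_configs A c t. ising_tree_weight \<beta> B (tree_ball c t) \<sigma>)"
  unfolding tree_Z_def
proof (rule sum.group)
  have "finite (A k)" for k using assms finite_subset[OF _ finite_spins] by blast
  thus "finite (tree_configs A c t)"
    unfolding tree_configs_def by (intro finite_PiE finite_tree_ball)
  show "(\<lambda>\<sigma>. \<sigma> []) ` tree_configs A c t \<subseteq> spins"
    using assms[of t] tree_configs_root by blast
qed simp

lemma free_marg_eq:
  assumes "s \<in> spins"
  shows "free_marg \<beta> B c t s = gibbs1 (free_field \<beta> B t c) s"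
proof -
  have "free_marg \<beta> B c t s = tree_Z \<beta> B (\<lambda>_. spins) c t s / (\<Sum>s\<in>spins. tree_Z \<beta> B (\<lambda>_. spins) c t s)"
    by (simp add: sum_tree_Z) (simp add: free_marg_def tree_Z_def tree_configs_def)
  thus ?thesis using prop_gibbs_normalize[OF tree_Z_free assms] by simp
qed

lemma tree_configs_plus:
  "tree_configs plus_spins c (Suc t) = {\<sigma> \<in> tree_ball c (Suc t) \<rightarrow>\<^sub>E spins.
     \<forall>v\<in>tree_ball c (Suc t). length v = Suc t \<longrightarrow> \<sigma> v = 1}"
proof -
  have "(\<forall>v\<in>tree_ball c (Suc t). \<sigma> v \<in> plus_spins (Suc t - length v)) \<longleftrightarrow>
      (\<forall>v\<in>tree_ball c (Suc t). \<sigma> v \<in> spins \<and> (length v = Suc t \<longrightarrow> \<sigma> v = 1))" for \<sigma>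
    by (intro ball_cong) (auto simp: plus_spins_def spins_def tree_ball_def)
  thus ?thesis unfolding tree_configs_def by (intro set_eqI) (simp add: PiE_iff, blast)
qed

lemma plus_marg_eq:
  assumes "s \<in> spins"
  shows "plus_marg \<beta> B c t s = gibbs1 (plus_field \<beta> B t c) s"
proof -
  have "plus_spins k \<subseteq> spins" for k by (auto simp: plus_spins_def spins_def)
  hence "plus_marg \<beta> B c t s = tree_Z \<beta> B plus_spins c (Suc t) s / (\<Sum>s\<in>spins. tree_Z \<beta> B plus_spins c (Suc t) s)"
    by (simp add: sum_tree_Z) (simp add: plus_marg_def tree_Z_def tree_configs_plus conj_assoc)
  thus ?thesis using prop_gibbs_normalize[OF tree_Z_plus assms] by simp
qed

lemma tendsto_gibbs1: "(f \<longlongrightarrow> l) F \<Longrightarrow> ((\<lambda>x. gibbs1 (f x) s) \<longlongrightarrow> gibbs1 l s) F"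
  unfolding gibbs1_def by (intro tendsto_intros) auto

lemma h_free_eq:
  assumes "0 \<le> \<beta>" "0 < B" "s \<in> spins"
  shows "h_free \<beta> B c s = gibbs1 (lim_field \<beta> B c) s"
  unfolding h_free_def free_marg_eq[OF assms(3)] using assms
  by (intro limI tendsto_gibbs1 free_field_tendsto) auto

text \<open>Same right-hand side as in \<open>h_free_eq\<close>, since both recursions have the
  limit \<open>lim_field\<close>; hence the two messages agree on \<open>spins\<close>.\<close>

lemma h_plus_eq:
  assumes "0 \<le> \<beta>" "0 < B" "s \<in> spins"
  shows "h_plus \<beta> B c s = gibbs1 (lim_field \<beta> B c) s"
  unfolding h_plus_def plus_marg_eq[OF assms(3)] using assms
  by (intro limI tendsto_gibbs1 plus_field_tendsto) auto

section \<open>Griffiths inequalities\<close>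

abbreviation configs :: "'a set \<Rightarrow> ('a \<Rightarrow> real) set" where
  "configs V \<equiv> V \<rightarrow>\<^sub>E spins"

text \<open>The Walsh characters of the group of configurations. Natural exponents, of which only
  the parity matters, turn products of characters into sums of exponents.\<close>

definition spin_char :: "'a set \<Rightarrow> ('a \<Rightarrow> nat) \<Rightarrow> ('a \<Rightarrow> real) \<Rightarrow> real" where
  "spin_char V k \<sigma> = (\<Prod>v\<in>V. \<sigma> v ^ k v)"

text \<open>All Walsh coefficients of \<open>f\<close> are nonnegative. The class is closed under
  multiplication by a + b times a character with a, b >= 0, which is the whole mechanism of the
  Griffiths inequalities.\<close>

definition gks :: "'a set \<Rightarrow> (('a \<Rightarrow> real) \<Rightarrow> real) \<Rightarrow> bool" where
  "gks V f \<longleftrightarrow> (\<forall>k. 0 \<le> (\<Sum>\<sigma>\<in>configs V. f \<sigma> * spin_char V k \<sigma>))"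

lemma finite_configs [simp]: "finite V \<Longrightarrow> finite (configs V)"
  by (intro finite_PiE) auto

lemma configs_square: "\<sigma> \<in> configs V \<Longrightarrow> v \<in> V \<Longrightarrow> \<sigma> v * \<sigma> v = 1"
  using PiE_mem[of \<sigma> V "\<lambda>_. spins" v] by (auto simp: spins_def)

lemma spin_char_add: "spin_char V (\<lambda>v. k v + l v) \<sigma> = spin_char V k \<sigma> * spin_char V l \<sigma>"
  by (simp add: spin_char_def power_add prod.distrib)

lemma spin_char_single:
  assumes "finite V" "v \<in> V"
  shows "spin_char V (\<lambda>u. if u = v then 1 else 0) \<sigma> = \<sigma> v"
proof -
  have "spin_char V (\<lambda>u. if u = v then 1 else 0) \<sigma> = (\<Prod>u\<in>V. if u = v then \<sigma> u else 1)"
    unfolding spin_char_def by (intro prod.cong) auto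
  thus ?thesis using assms by simp
qed

lemma spin_char_in_spins:
  assumes "\<sigma> \<in> configs V"
  shows "spin_char V k \<sigma> \<in> spins"
proof -
  have "\<bar>spin_char V k \<sigma>\<bar> = (\<Prod>v\<in>V. \<bar>\<sigma> v\<bar> ^ k v)"
    by (simp add: spin_char_def abs_prod power_abs)
  also have "\<dots> = 1"
  proof (intro prod.neutral ballI)
    fix v assume "v \<in> V"
    hence "\<bar>\<sigma> v\<bar> = 1" using PiE_mem[OF assms, of v] by (auto simp: spins_def)
    thus "\<bar>\<sigma> v\<bar> ^ k v = 1" by simp
  qed
  finally show ?thesis by (auto simp: spins_def)
qed

text \<open>The sum factorizes over vertices into sums of s ^ k over the two spins, each equal to 0
  or 2.\<close>

lemma gks_one:
  assumes "finite V"
  shows "gks V (\<lambda>_. 1)"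
  unfolding gks_def
proof
  fix k :: "'a \<Rightarrow> nat"
  have "(\<Sum>\<sigma>\<in>configs V. spin_char V k \<sigma>) = (\<Prod>v\<in>V. \<Sum>s\<in>spins. s ^ k v)"
    unfolding spin_char_def using assms by (subst prod_sum_PiE) auto
  also have "\<dots> \<ge> 0"
    by (intro prod_nonneg) (simp add: sum_spins minus_one_power_iff)
  finally show "0 \<le> (\<Sum>\<sigma>\<in>configs V. 1 * spin_char V k \<sigma>)" by simp
qed

lemma gks_cong: "(\<And>\<sigma>. \<sigma> \<in> configs V \<Longrightarrow> f \<sigma> = g \<sigma>) \<Longrightarrow> gks V f = gks V g"
  unfolding gks_def by (simp cong: sum.cong)

lemma gks_mult_affine:
  assumes "gks V f" "0 \<le> a" "0 \<le> b"
  shows "gks V (\<lambda>\<sigma>. f \<sigma> * (a + b * spin_char V l \<sigma>))"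
  unfolding gks_def
proof
  fix k
  have "(\<Sum>\<sigma>\<in>configs V. f \<sigma> * (a + b * spin_char V l \<sigma>) * spin_char V k \<sigma>) =
      a * (\<Sum>\<sigma>\<in>configs V. f \<sigma> * spin_char V k \<sigma>) +
      b * (\<Sum>\<sigma>\<in>configs V. f \<sigma> * spin_char V (\<lambda>v. l v + k v) \<sigma>)"
    by (simp add: spin_char_add sum_distrib_left sum.distrib[symmetric] algebra_simps)
  thus "0 \<le> (\<Sum>\<sigma>\<in>configs V. f \<sigma> * (a + b * spin_char V l \<sigma>) * spin_char V k \<sigma>)"
    using assms by (simp add: gks_def)
qed

lemma exp_mult_spin: "s \<in> spins \<Longrightarrow> exp (J * s) = cosh J + sinh J * s"
  by (auto simp: spins_def cosh_def sinh_def field_simps)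

text \<open>On spins, exp (J s) = cosh J + sinh J s, which is affine with nonnegative coefficients
  when J >= 0.\<close>

lemma gks_mult_exp:
  assumes "gks V f" "0 \<le> J"
  shows "gks V (\<lambda>\<sigma>. f \<sigma> * exp (J * spin_char V l \<sigma>))"
proof -
  have "gks V (\<lambda>\<sigma>. f \<sigma> * exp (J * spin_char V l \<sigma>)) =
      gks V (\<lambda>\<sigma>. f \<sigma> * (cosh J + sinh J * spin_char V l \<sigma>))"
    by (intro gks_cong) (simp add: exp_mult_spin[OF spin_char_in_spins])
  thus ?thesis using gks_mult_affine[OF assms(1)] assms(2) by simp
qed

lemma gks_mult_exp_sum:
  assumes "finite I" "\<And>i. i \<in> I \<Longrightarrow> 0 \<le> J i" "gks V f"
  shows "gks V (\<lambda>\<sigma>. f \<sigma> * exp (\<Sum>i\<in>I. J i * spin_char V (l i) \<sigma>))"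
  using assms(1,2)
proof (induction I rule: finite_induct)
  case (insert x F)
  have "gks V (\<lambda>\<sigma>. f \<sigma> * exp (\<Sum>i\<in>F. J i * spin_char V (l i) \<sigma>) * exp (J x * spin_char V (l x) \<sigma>))"
    by (intro gks_mult_exp insert.IH) (auto intro: insert.prems)
  thus ?case using insert.hyps by (simp add: exp_add mult_ac)
qed (use assms in simp)

text \<open>On spins, 1 + \<sigma> v is twice the indicator of \<sigma> v = 1, so this puts plus
  boundary conditions into the Griffiths class.\<close>

lemma gks_prod_one_plus:
  assumes "finite V" "W \<subseteq> V"
  shows "gks V (\<lambda>\<sigma>. \<Prod>v\<in>W. 1 + \<sigma> v)"
  using finite_subset[OF assms(2,1)] assms(2)
proof (induction W rule: finite_induct)
  case (insert x F)
  have "gks V (\<lambda>\<sigma>. (\<Prod>v\<in>F. 1 + \<sigma> v) * (1 + 1 * spin_char V (\<lambda>u. if u = x then 1 else 0) \<sigma>))"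
    using insert by (intro gks_mult_affine) auto
  thus ?case using insert assms(1) by (simp add: spin_char_single mult.commute)
qed (simp add: gks_one assms)

section \<open>Duplicated variables and comparison of couplings\<close>

definition flip :: "'a set \<Rightarrow> ('a \<Rightarrow> real) \<Rightarrow> ('a \<Rightarrow> real) \<Rightarrow> 'a \<Rightarrow> real" where
  "flip V \<sigma> \<rho> = (\<lambda>v\<in>V. \<sigma> v * \<rho> v)"

lemma flip_in_configs:
  assumes "\<sigma> \<in> configs V" "\<rho> \<in> configs V"
  shows "flip V \<sigma> \<rho> \<in> configs V"
  using PiE_mem[OF assms(1)] PiE_mem[OF assms(2)]
  by (fastforce simp: flip_def spins_def)

lemma flip_flip:
  assumes "\<sigma> \<in> configs V" "\<rho> \<in> configs V"
  shows "flip V \<sigma> (flip V \<sigma> \<rho>) = \<rho>"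
proof
  fix v show "flip V \<sigma> (flip V \<sigma> \<rho>) v = \<rho> v"
    using configs_square[OF assms(1), of v] assms(2)
    by (cases "v \<in> V") (auto simp: flip_def mult.assoc[symmetric] PiE_def extensional_def)
qed

text \<open>Ginibre's argument: write the difference as a double sum over pairs \<sigma>, \<tau> and
  substitute \<tau> = \<sigma> \<rho>. For fixed \<rho> the factor 1 - \<chi>(\<rho>) >= 0 comes
  out, because characters are multiplicative, and what remains is a Walsh coefficient in \<sigma> of
  the function assumed to be in the class.\<close>

lemma ginibre:
  assumes V: "finite V"
    and pq: "\<And>\<rho>. \<rho> \<in> configs V \<Longrightarrow> gks V (\<lambda>\<sigma>. p \<sigma> * q (flip V \<sigma> \<rho>))"
  shows "(\<Sum>\<sigma>\<in>configs V. p \<sigma>) * (\<Sum>\<sigma>\<in>configs V. spin_char V k \<sigma> * q \<sigma>)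
     \<le> (\<Sum>\<sigma>\<in>configs V. spin_char V k \<sigma> * p \<sigma>) * (\<Sum>\<sigma>\<in>configs V. q \<sigma>)"
proof -
  let ?C = "configs V" and ?\<chi> = "spin_char V k"
  have \<chi>: "?\<chi> (flip V \<sigma> \<rho>) = ?\<chi> \<sigma> * ?\<chi> \<rho>" for \<sigma> \<rho>
    by (simp add: flip_def spin_char_def power_mult_distrib prod.distrib)
  have "(\<Sum>\<sigma>\<in>?C. ?\<chi> \<sigma> * p \<sigma>) * (\<Sum>\<sigma>\<in>?C. q \<sigma>) - (\<Sum>\<sigma>\<in>?C. p \<sigma>) * (\<Sum>\<sigma>\<in>?C. ?\<chi> \<sigma> * q \<sigma>)
      = (\<Sum>\<sigma>\<in>?C. \<Sum>\<tau>\<in>?C. (?\<chi> \<sigma> - ?\<chi> \<tau>) * (p \<sigma> * q \<tau>))"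
    unfolding sum_product sum_subtractf[symmetric]
    by (intro sum.cong refl) (simp add: algebra_simps)
  also have "\<dots> = (\<Sum>\<sigma>\<in>?C. \<Sum>\<rho>\<in>?C. (?\<chi> \<sigma> - ?\<chi> (flip V \<sigma> \<rho>)) * (p \<sigma> * q (flip V \<sigma> \<rho>)))"
  proof (rule sum.cong[OF refl])
    fix \<sigma> assume \<sigma>: "\<sigma> \<in> ?C"
    show "(\<Sum>\<tau>\<in>?C. (?\<chi> \<sigma> - ?\<chi> \<tau>) * (p \<sigma> * q \<tau>)) =
        (\<Sum>\<rho>\<in>?C. (?\<chi> \<sigma> - ?\<chi> (flip V \<sigma> \<rho>)) * (p \<sigma> * q (flip V \<sigma> \<rho>)))"
      by (rule sum.reindex_bij_witness[where i = "flip V \<sigma>" and j = "flip V \<sigma>"])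
        (simp_all add: flip_flip[OF \<sigma>] flip_in_configs[OF \<sigma>])
  qed
  also have "\<dots> = (\<Sum>\<rho>\<in>?C. \<Sum>\<sigma>\<in>?C. (?\<chi> \<sigma> - ?\<chi> (flip V \<sigma> \<rho>)) * (p \<sigma> * q (flip V \<sigma> \<rho>)))"
    by (rule sum.swap)
  also have "\<dots> = (\<Sum>\<rho>\<in>?C. (1 - ?\<chi> \<rho>) * (\<Sum>\<sigma>\<in>?C. p \<sigma> * q (flip V \<sigma> \<rho>) * ?\<chi> \<sigma>))"
    by (simp add: \<chi> sum_distrib_left algebra_simps)
  also have "\<dots> \<ge> 0"
  proof (rule sum_nonneg, rule mult_nonneg_nonneg)
    fix \<rho> assume \<rho>: "\<rho> \<in> ?C"
    show "0 \<le> 1 - ?\<chi> \<rho>" using spin_char_in_spins[OF \<rho>, of k] by (auto simp: spins_def)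
    show "0 \<le> (\<Sum>\<sigma>\<in>?C. p \<sigma> * q (flip V \<sigma> \<rho>) * ?\<chi> \<sigma>)" using pq[OF \<rho>] by (simp add: gks_def)
  qed
  finally show ?thesis by simp
qed

text \<open>Couplings and fields depend on the site so that a model on a subset of the vertices is a
  model on all of them with some couplings set to 0.\<close>

definition coupling_weight ::
  "('a \<Rightarrow> 'a \<Rightarrow> real) \<Rightarrow> ('a \<Rightarrow> real) \<Rightarrow> 'a set \<Rightarrow> ('a \<Rightarrow> real) \<Rightarrow> real" where
  "coupling_weight J b V \<sigma> = exp ((\<Sum>v\<in>V. \<Sum>w\<in>V. J v w * (\<sigma> v * \<sigma> w)) + (\<Sum>v\<in>V. b v * \<sigma> v))"

lemma gks_mult_coupling_weight:
  assumes "finite V" "gks V f" "\<And>v w. v \<in> V \<Longrightarrow> w \<in> V \<Longrightarrow> 0 \<le> J v w" "\<And>v. v \<in> V \<Longrightarrow> 0 \<le> b v"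
  shows "gks V (\<lambda>\<sigma>. f \<sigma> * coupling_weight J b V \<sigma>)"
proof -
  let ?one = "\<lambda>v u. if u = v then 1 else 0 :: nat"
  have "gks V (\<lambda>\<sigma>. f \<sigma> * exp (\<Sum>p\<in>V \<times> V. J (fst p) (snd p) * spin_char V (\<lambda>u. ?one (fst p) u + ?one (snd p) u) \<sigma>) *
      exp (\<Sum>v\<in>V. b v * spin_char V (?one v) \<sigma>))"
    using assms by (intro gks_mult_exp_sum) auto
  also have "(\<lambda>\<sigma>. f \<sigma> * exp (\<Sum>p\<in>V \<times> V. J (fst p) (snd p) * spin_char V (\<lambda>u. ?one (fst p) u + ?one (snd p) u) \<sigma>) *
      exp (\<Sum>v\<in>V. b v * spin_char V (?one v) \<sigma>)) = (\<lambda>\<sigma>. f \<sigma> * coupling_weight J b V \<sigma>)"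
    using assms(1)
    by (auto simp: fun_eq_iff coupling_weight_def exp_add spin_char_add spin_char_single sum.cartesian_product intro!: sum.cong)
  finally show ?thesis .
qed

text \<open>After the substitution the duplicated system has couplings J + J' \<rho> v \<rho> w and
  fields b + b' \<rho> v, nonnegative because 0 <= J' <= J and 0 <= b' <= b. Empty \<open>W\<close>
  yields monotonicity in the couplings; equal couplings yield the effect of freezing
  \<open>W\<close> at +1.\<close>

lemma coupling_comparison:
  assumes V: "finite V" "W \<subseteq> V" "i \<in> V"
    and J: "\<And>v w. v \<in> V \<Longrightarrow> w \<in> V \<Longrightarrow> 0 \<le> J' v w \<and> J' v w \<le> J v w"
    and b: "\<And>v. v \<in> V \<Longrightarrow> 0 \<le> b' v \<and> b' v \<le> b v"
  shows "(\<Sum>\<sigma>\<in>configs V. (\<Prod>v\<in>W. 1 + \<sigma> v) * coupling_weight J b V \<sigma>) *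
           (\<Sum>\<sigma>\<in>configs V. \<sigma> i * coupling_weight J' b' V \<sigma>)
     \<le> (\<Sum>\<sigma>\<in>configs V. \<sigma> i * ((\<Prod>v\<in>W. 1 + \<sigma> v) * coupling_weight J b V \<sigma>)) *
           (\<Sum>\<sigma>\<in>configs V. coupling_weight J' b' V \<sigma>)"
proof -
  have "gks V (\<lambda>\<sigma>. (\<Prod>v\<in>W. 1 + \<sigma> v) * coupling_weight J b V \<sigma> * coupling_weight J' b' V (flip V \<sigma> \<rho>))"
    if \<rho>: "\<rho> \<in> configs V" for \<rho>
  proof -
    have sp: "\<rho> v \<in> spins" if "v \<in> V" for v using PiE_mem[OF \<rho>] that by auto
    have eq: "coupling_weight J b V \<sigma> * coupling_weight J' b' V (flip V \<sigma> \<rho>) =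
        coupling_weight (\<lambda>v w. J v w + J' v w * (\<rho> v * \<rho> w)) (\<lambda>v. b v + b' v * \<rho> v) V \<sigma>" for \<sigma>
    proof -
      have "(\<Sum>v\<in>V. \<Sum>w\<in>V. J' v w * (flip V \<sigma> \<rho> v * flip V \<sigma> \<rho> w)) = (\<Sum>v\<in>V. \<Sum>w\<in>V. J' v w * (\<rho> v * \<rho> w) * (\<sigma> v * \<sigma> w))"
        by (intro sum.cong) (auto simp: flip_def)
      moreover have "(\<Sum>v\<in>V. b' v * flip V \<sigma> \<rho> v) = (\<Sum>v\<in>V. b' v * \<rho> v * \<sigma> v)"
        by (intro sum.cong) (auto simp: flip_def)
      ultimately show ?thesis
        unfolding coupling_weight_def exp_add[symmetric] by (simp add: distrib_right sum.distrib)
    qed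
    have "gks V (\<lambda>\<sigma>. (\<Prod>v\<in>W. 1 + \<sigma> v) *
        coupling_weight (\<lambda>v w. J v w + J' v w * (\<rho> v * \<rho> w)) (\<lambda>v. b v + b' v * \<rho> v) V \<sigma>)"
    proof (intro gks_mult_coupling_weight gks_prod_one_plus V)
      fix v w assume vw: "v \<in> V" "w \<in> V"
      show "0 \<le> J v w + J' v w * (\<rho> v * \<rho> w)"
        using sp[OF vw(1)] sp[OF vw(2)] J[OF vw] by (auto simp: spins_def)
      show "0 \<le> b v + b' v * \<rho> v"
        using sp[OF vw(1)] b[OF vw(1)] by (auto simp: spins_def)
    qed
    thus ?thesis by (simp add: eq[symmetric] mult.assoc)
  qed
  from ginibre[OF V(1) this, where k = "\<lambda>u. if u = i then 1 else 0"]
  show ?thesis by (simp add: spin_char_single V)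
qed

lemma sum_PiE_insert:
  assumes "v \<notin> V"
  shows "(\<Sum>\<sigma>\<in>PiE (insert v V) S. f \<sigma>) = (\<Sum>s\<in>S v. \<Sum>\<tau>\<in>PiE V S. f (\<tau>(v := s)))"
  unfolding PiE_insert_eq
  by (subst sum.reindex[OF inj_combinator[OF assms]]) (simp add: sum.cartesian_product split_def)

lemma sum_PiE_restrict:
  assumes "finite V" "U \<subseteq> V"
  shows "(\<Sum>\<sigma>\<in>PiE V S. g (restrict \<sigma> U)) = real (\<Prod>v\<in>V - U. card (S v)) * (\<Sum>\<sigma>\<in>PiE U S. g \<sigma> :: real)"
proof -
  have "(\<Sum>\<sigma>\<in>PiE (X \<union> U) S. g (restrict \<sigma> U)) = real (\<Prod>v\<in>X. card (S v)) * (\<Sum>\<sigma>\<in>PiE U S. g \<sigma>)"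
    if "finite X" "X \<inter> U = {}" for X
    using that
  proof (induction X rule: finite_induct)
    case empty
    have "(\<Sum>\<sigma>\<in>PiE U S. g (restrict \<sigma> U)) = (\<Sum>\<sigma>\<in>PiE U S. g \<sigma>)"
      by (intro sum.cong refl) simp
    thus ?case by simp
  next
    case (insert x F)
    have "restrict (\<tau>(x := s)) U = restrict \<tau> U" for \<tau> :: "'a \<Rightarrow> 'b" and s
      using insert.prems by (auto simp: restrict_def fun_eq_iff)
    hence "(\<Sum>\<sigma>\<in>PiE (insert x (F \<union> U)) S. g (restrict \<sigma> U)) = (\<Sum>s\<in>S x. \<Sum>\<tau>\<in>PiE (F \<union> U) S. g (restrict \<tau> U))"
      using insert by (subst sum_PiE_insert) auto
    also have "(\<Sum>\<tau>\<in>PiE (F \<union> U) S. g (restrict \<tau> U)) = real (\<Prod>v\<in>F. card (S v)) * (\<Sum>\<sigma>\<in>PiE U S. g \<sigma>)"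
      by (rule insert.IH) (use insert.prems in auto)
    finally show ?case using insert.hyps by (simp add: mult.assoc)
  qed
  moreover have "(V - U) \<inter> U = {}" by auto
  ultimately show ?thesis using assms by (metis Un_Diff_cancel2 Un_absorb2 finite_Diff)
qed

section \<open>Monotonicity in the domain and plus boundary conditions\<close>

text \<open>The double sum over ordered pairs meets each edge of a symmetric \<open>R\<close> twice,
  hence \<beta> / 2.\<close>

definition ising_weight :: "real \<Rightarrow> real \<Rightarrow> ('a \<Rightarrow> 'a \<Rightarrow> bool) \<Rightarrow> 'a set \<Rightarrow> ('a \<Rightarrow> real) \<Rightarrow> real" where
  "ising_weight \<beta> B R V \<sigma> =
     exp (\<beta> / 2 * (\<Sum>v\<in>V. \<Sum>w\<in>V. if R v w then \<sigma> v * \<sigma> w else 0) + B * (\<Sum>v\<in>V. \<sigma> v))"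

definition magnetization ::
  "real \<Rightarrow> real \<Rightarrow> ('a \<Rightarrow> 'a \<Rightarrow> bool) \<Rightarrow> 'a set \<Rightarrow> ('a \<Rightarrow> real set) \<Rightarrow> 'a \<Rightarrow> real" where
  "magnetization \<beta> B R V S i =
     (\<Sum>\<sigma>\<in>PiE V S. \<sigma> i * ising_weight \<beta> B R V \<sigma>) / (\<Sum>\<sigma>\<in>PiE V S. ising_weight \<beta> B R V \<sigma>)"

lemma ising_weight_pos [simp]: "0 < ising_weight \<beta> B R V \<sigma>"
  by (simp add: ising_weight_def)

lemma ising_weight_eq_coupling_weight:
  "ising_weight \<beta> B R V \<sigma> = coupling_weight (\<lambda>v w. if R v w then \<beta> / 2 else 0) (\<lambda>_. B) V \<sigma>"
  unfolding ising_weight_def coupling_weight_def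
  by (auto simp: sum_distrib_left intro!: sum.cong arg_cong2[where f = "(+)"])

lemma ising_weight_restrict: "ising_weight \<beta> B R V (restrict \<sigma> V) = ising_weight \<beta> B R V \<sigma>"
  unfolding ising_weight_def by (simp cong: sum.cong if_cong)

lemma ising_weight_subset:
  assumes "finite V" "U \<subseteq> V"
  shows "ising_weight \<beta> B R U \<sigma> =
    coupling_weight (\<lambda>v w. if R v w \<and> v \<in> U \<and> w \<in> U then \<beta> / 2 else 0) (\<lambda>v. if v \<in> U then B else 0) V \<sigma>"
proof -
  have "(\<Sum>v\<in>V. \<Sum>w\<in>V. (if R v w \<and> v \<in> U \<and> w \<in> U then \<beta> / 2 else 0) * (\<sigma> v * \<sigma> w)) =
      (\<Sum>v\<in>U. \<Sum>w\<in>U. (if R v w then \<beta> / 2 else 0) * (\<sigma> v * \<sigma> w))"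
  proof (rule sum.mono_neutral_cong_right[OF assms])
    fix v assume "v \<in> U"
    thus "(\<Sum>w\<in>V. (if R v w \<and> v \<in> U \<and> w \<in> U then \<beta> / 2 else 0) * (\<sigma> v * \<sigma> w)) =
        (\<Sum>w\<in>U. (if R v w then \<beta> / 2 else 0) * (\<sigma> v * \<sigma> w))"
      by (intro sum.mono_neutral_cong_right[OF assms]) auto
  qed auto
  moreover have "(\<Sum>v\<in>V. (if v \<in> U then B else 0) * \<sigma> v) = (\<Sum>v\<in>U. B * \<sigma> v)"
    by (rule sum.mono_neutral_cong_right[OF assms]) auto
  ultimately show ?thesis
    by (simp add: ising_weight_eq_coupling_weight coupling_weight_def)
qed

lemma sum_configs_pos:
  assumes "finite V" "\<And>v. v \<in> V \<Longrightarrow> finite (S v) \<and> S v \<noteq> {}"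
  shows "0 < (\<Sum>\<sigma>\<in>PiE V S. ising_weight \<beta> B R U \<sigma>)"
  using assms by (intro sum_pos finite_PiE) (auto simp: PiE_eq_empty_iff)

text \<open>The model on \<open>U\<close> is the model on \<open>V\<close> with couplings and fields
  outside \<open>U\<close> switched off; the outer spins are then free and contribute only a common
  factor.\<close>

lemma magnetization_mono:
  assumes V: "finite V" "U \<subseteq> V" "i \<in> U" and "0 \<le> \<beta>" "0 \<le> B"
  shows "magnetization \<beta> B R U (\<lambda>_. spins) i \<le> magnetization \<beta> B R V (\<lambda>_. spins) i"
proof -
  let ?J = "\<lambda>v w. if R v w \<and> v \<in> U \<and> w \<in> U then \<beta> / 2 else 0"
  have restr: "(\<Sum>\<sigma>\<in>configs V. f \<sigma>) = real (\<Prod>v\<in>V - U. card spins) * (\<Sum>\<sigma>\<in>configs U. f \<sigma>)"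
    if "\<And>\<sigma>. f (restrict \<sigma> U) = f \<sigma>" for f
    using sum_PiE_restrict[OF V(1,2), of f "\<lambda>_. spins"] that by simp
  have pos: "real (\<Prod>v\<in>V - U. card spins) > 0" by (simp add: spins_def prod_pos)
  have sums: "(\<Sum>\<sigma>\<in>configs V. ising_weight \<beta> B R U \<sigma>) = real (\<Prod>v\<in>V - U. card spins) * (\<Sum>\<sigma>\<in>configs U. ising_weight \<beta> B R U \<sigma>)"
    "(\<Sum>\<sigma>\<in>configs V. \<sigma> i * ising_weight \<beta> B R U \<sigma>) = real (\<Prod>v\<in>V - U. card spins) * (\<Sum>\<sigma>\<in>configs U. \<sigma> i * ising_weight \<beta> B R U \<sigma>)"
    by (rule restr, use V(3) in \<open>simp add: ising_weight_restrict\<close>)+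
  have "(\<Sum>\<sigma>\<in>configs V. ising_weight \<beta> B R V \<sigma>) * (\<Sum>\<sigma>\<in>configs V. \<sigma> i * ising_weight \<beta> B R U \<sigma>)
      \<le> (\<Sum>\<sigma>\<in>configs V. \<sigma> i * ising_weight \<beta> B R V \<sigma>) * (\<Sum>\<sigma>\<in>configs V. ising_weight \<beta> B R U \<sigma>)"
    using coupling_comparison[OF V(1), of "{}" i ?J "\<lambda>v w. if R v w then \<beta> / 2 else 0" "\<lambda>v. if v \<in> U then B else 0" "\<lambda>_. B"] assms
    by (auto simp: ising_weight_subset[OF V(1,2)] ising_weight_eq_coupling_weight[of _ _ _ V])
  hence "(\<Sum>\<sigma>\<in>configs V. ising_weight \<beta> B R V \<sigma>) * (\<Sum>\<sigma>\<in>configs U. \<sigma> i * ising_weight \<beta> B R U \<sigma>)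
      \<le> (\<Sum>\<sigma>\<in>configs V. \<sigma> i * ising_weight \<beta> B R V \<sigma>) * (\<Sum>\<sigma>\<in>configs U. ising_weight \<beta> B R U \<sigma>)"
    unfolding sums mult.left_commute[of _ "real (\<Prod>v\<in>V - U. card spins)"]
    by (subst (asm) mult_le_cancel_left_pos[OF pos])
  moreover have "0 < (\<Sum>\<sigma>\<in>configs V. ising_weight \<beta> B R V \<sigma>)" "0 < (\<Sum>\<sigma>\<in>configs U. ising_weight \<beta> B R U \<sigma>)"
    using V finite_subset[OF V(2,1)] by (intro sum_configs_pos; simp add: spins_def)+
  ultimately show ?thesis unfolding magnetization_def by (simp add: divide_simps mult.commute)
qed

lemma sum_prod_one_plus:
  assumes "finite V" "W \<subseteq> V"
  shows "(\<Sum>\<sigma>\<in>configs V. (\<Prod>v\<in>W. 1 + \<sigma> v) * f \<sigma>) =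
     2 ^ card W * (\<Sum>\<sigma>\<in>PiE V (\<lambda>v. if v \<in> W then {1} else spins). f \<sigma> :: real)"
proof -
  have finW: "finite W" using assms by (rule finite_subset[rotated])
  have sub: "PiE V (\<lambda>v. if v \<in> W then {1} else spins) \<subseteq> configs V"
    by (intro PiE_mono) (auto simp: spins_def)
  have "(\<Sum>\<sigma>\<in>configs V. (\<Prod>v\<in>W. 1 + \<sigma> v) * f \<sigma>) =
      (\<Sum>\<sigma>\<in>PiE V (\<lambda>v. if v \<in> W then {1} else spins). 2 ^ card W * f \<sigma>)"
  proof (rule sum.mono_neutral_cong_right[OF finite_configs[OF assms(1)] sub])
    show "\<forall>\<sigma>\<in>configs V - PiE V (\<lambda>v. if v \<in> W then {1} else spins). (\<Prod>v\<in>W. 1 + \<sigma> v) * f \<sigma> = 0"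
    proof
      fix \<sigma> assume \<sigma>: "\<sigma> \<in> configs V - PiE V (\<lambda>v. if v \<in> W then {1} else spins)"
      then obtain v where "v \<in> V" "\<sigma> v \<notin> (if v \<in> W then {1} else spins)" "\<sigma> v \<in> spins"
        by (auto simp: PiE_iff)
      hence "v \<in> W" "1 + \<sigma> v = 0" by (auto simp: spins_def split: if_splits)
      thus "(\<Prod>v\<in>W. 1 + \<sigma> v) * f \<sigma> = 0" using finW by (auto intro!: prod_zero)
    qed
  next
    fix \<sigma> assume \<sigma>: "\<sigma> \<in> PiE V (\<lambda>v. if v \<in> W then {1} else spins)"
    have "\<sigma> v = 1" if "v \<in> W" for v using PiE_mem[OF \<sigma>, of v] that assms(2) by auto
    thus "(\<Prod>v\<in>W. 1 + \<sigma> v) * f \<sigma> = 2 ^ card W * f \<sigma>" by simp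
  qed
  thus ?thesis by (simp add: sum_distrib_left)
qed

lemma magnetization_le_plus:
  assumes V: "finite V" "U0 \<subseteq> U" "U \<subseteq> V" "i \<in> U" and "0 \<le> \<beta>" "0 \<le> B"
    and bd: "\<And>v w. v \<in> V \<Longrightarrow> w \<in> V \<Longrightarrow> R v w \<Longrightarrow> v \<notin> U \<or> w \<notin> U \<Longrightarrow> v \<notin> U0 \<and> w \<notin> U0"
  shows "magnetization \<beta> B R V (\<lambda>_. spins) i \<le> magnetization \<beta> B R U (\<lambda>v. if v \<in> U0 then spins else {1}) i"
proof -
  let ?S = "\<lambda>v. if v \<in> V - U0 then {1} else spins" and ?S' = "\<lambda>v. if v \<in> U0 then spins else {1}"
  have PiE_S: "PiE V ?S = PiE V ?S'" by (rule PiE_cong) auto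
  have finU: "finite U" using V finite_subset by blast
  \<comment> \<open>Log-weight of everything outside the model on \<open>U\<close> when the spins
    there are +1: edges not inside \<open>U\<close> and fields on \<open>V - U\<close>.\<close>
  define e where "e = \<beta> / 2 * ((\<Sum>v\<in>V. \<Sum>w\<in>V. if R v w then 1 else 0) - (\<Sum>v\<in>U. \<Sum>w\<in>U. if R v w then 1 else 0)) + B * card (V - U)"
  have factor: "ising_weight \<beta> B R V \<sigma> = exp e * ising_weight \<beta> B R U \<sigma>" if \<sigma>: "\<sigma> \<in> PiE V ?S'" for \<sigma>
  proof -
    have one: "\<sigma> v = 1" if "v \<in> V" "v \<notin> U0" for v using PiE_mem[OF \<sigma>, of v] that by auto
    have 1: "(\<Sum>v\<in>V. \<sigma> v) = (\<Sum>v\<in>U. \<sigma> v) + real (card (V - U))"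
    proof -
      have "(\<Sum>v\<in>V - U. \<sigma> v) = (\<Sum>v\<in>V - U. 1)" using one V(2) by (intro sum.cong) auto
      thus ?thesis using sum.subset_diff[OF V(3) V(1), of \<sigma>] by simp
    qed
    \<comment> \<open>Subtracting 1 from each edge product makes frozen edges vanish, so the two
      double sums differ by zero terms only.\<close>
    have "(\<Sum>v\<in>V. \<Sum>w\<in>V. if R v w then \<sigma> v * \<sigma> w - 1 else 0) = (\<Sum>v\<in>U. \<Sum>w\<in>U. if R v w then \<sigma> v * \<sigma> w - 1 else 0)"
    proof (rule sum.mono_neutral_cong_right[OF V(1,3)])
      show "\<forall>v\<in>V - U. (\<Sum>w\<in>V. if R v w then \<sigma> v * \<sigma> w - 1 else 0) = 0"
        using bd one by (intro ballI sum.neutral) auto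
      fix v assume "v \<in> U"
      thus "(\<Sum>w\<in>V. if R v w then \<sigma> v * \<sigma> w - 1 else 0) = (\<Sum>w\<in>U. if R v w then \<sigma> v * \<sigma> w - 1 else 0)"
        using bd one V by (intro sum.mono_neutral_cong_right) auto
    qed
    moreover have "(\<Sum>v\<in>A. \<Sum>w\<in>A. if R v w then \<sigma> v * \<sigma> w - 1 else 0) =
        (\<Sum>v\<in>A. \<Sum>w\<in>A. if R v w then \<sigma> v * \<sigma> w else 0) - (\<Sum>v\<in>A. \<Sum>w\<in>A. if R v w then 1 else 0)" for A
      unfolding sum_subtractf[symmetric] by (intro sum.cong refl) auto
    ultimately have 2: "(\<Sum>v\<in>V. \<Sum>w\<in>V. if R v w then \<sigma> v * \<sigma> w else 0) = (\<Sum>v\<in>U. \<Sum>w\<in>U. if R v w then \<sigma> v * \<sigma> w else 0)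
        + ((\<Sum>v\<in>V. \<Sum>w\<in>V. if R v w then 1 else 0) - (\<Sum>v\<in>U. \<Sum>w\<in>U. if R v w then 1 else 0))"
      by simp
    show ?thesis unfolding ising_weight_def exp_add[symmetric] 1 2 e_def by (simp add: algebra_simps)
  qed
  have restr: "(\<Sum>\<sigma>\<in>PiE V ?S'. f \<sigma>) = (\<Sum>\<sigma>\<in>PiE U ?S'. f \<sigma>)" if "\<And>\<sigma>. f (restrict \<sigma> U) = f \<sigma>" for f :: "_ \<Rightarrow> real"
  proof -
    have "(\<Prod>v\<in>V - U. card (?S' v)) = 1" using V(2) by (intro prod.neutral) auto
    thus ?thesis using sum_PiE_restrict[OF V(1,3), of f ?S'] that by simp
  qed
  have "(\<Sum>\<sigma>\<in>PiE V ?S'. ising_weight \<beta> B R V \<sigma>) = exp e * (\<Sum>\<sigma>\<in>PiE V ?S'. ising_weight \<beta> B R U \<sigma>)"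
    unfolding sum_distrib_left by (intro sum.cong refl factor)
  also have "\<dots> = exp e * (\<Sum>\<sigma>\<in>PiE U ?S'. ising_weight \<beta> B R U \<sigma>)"
    by (subst restr) (simp_all add: ising_weight_restrict)
  finally have Z: "(\<Sum>\<sigma>\<in>PiE V ?S'. ising_weight \<beta> B R V \<sigma>) = exp e * (\<Sum>\<sigma>\<in>PiE U ?S'. ising_weight \<beta> B R U \<sigma>)" .
  have "(\<Sum>\<sigma>\<in>PiE V ?S'. \<sigma> i * ising_weight \<beta> B R V \<sigma>) = exp e * (\<Sum>\<sigma>\<in>PiE V ?S'. \<sigma> i * ising_weight \<beta> B R U \<sigma>)"
    unfolding sum_distrib_left by (intro sum.cong refl) (simp add: factor)
  also have "\<dots> = exp e * (\<Sum>\<sigma>\<in>PiE U ?S'. \<sigma> i * ising_weight \<beta> B R U \<sigma>)"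
    using V(4) by (subst restr) (simp_all add: ising_weight_restrict)
  finally have M: "(\<Sum>\<sigma>\<in>PiE V ?S'. \<sigma> i * ising_weight \<beta> B R V \<sigma>) = exp e * (\<Sum>\<sigma>\<in>PiE U ?S'. \<sigma> i * ising_weight \<beta> B R U \<sigma>)" .
  have W: "V - U0 \<subseteq> V" by auto
  have "(\<Sum>\<sigma>\<in>PiE V ?S'. ising_weight \<beta> B R V \<sigma>) * (\<Sum>\<sigma>\<in>configs V. \<sigma> i * ising_weight \<beta> B R V \<sigma>)
      \<le> (\<Sum>\<sigma>\<in>PiE V ?S'. \<sigma> i * ising_weight \<beta> B R V \<sigma>) * (\<Sum>\<sigma>\<in>configs V. ising_weight \<beta> B R V \<sigma>)"
  proof -
    let ?p = "2 ^ card (V - U0) :: real"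
    let ?J = "\<lambda>v w. if R v w then \<beta> / 2 else 0"
    have "?p * (\<Sum>\<sigma>\<in>PiE V ?S. ising_weight \<beta> B R V \<sigma>) * (\<Sum>\<sigma>\<in>configs V. \<sigma> i * ising_weight \<beta> B R V \<sigma>)
        \<le> ?p * (\<Sum>\<sigma>\<in>PiE V ?S. \<sigma> i * ising_weight \<beta> B R V \<sigma>) * (\<Sum>\<sigma>\<in>configs V. ising_weight \<beta> B R V \<sigma>)"
      using coupling_comparison[OF V(1) W, of i ?J ?J "\<lambda>_. B" "\<lambda>_. B"] assms
      unfolding ising_weight_eq_coupling_weight[of _ _ _ V] sum_prod_one_plus[OF V(1) W, symmetric]
      by (auto simp: mult.left_commute)
    thus ?thesis unfolding PiE_S mult.assoc by simp
  qed
  hence "(\<Sum>\<sigma>\<in>PiE U ?S'. ising_weight \<beta> B R U \<sigma>) * (\<Sum>\<sigma>\<in>configs V. \<sigma> i * ising_weight \<beta> B R V \<sigma>)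
      \<le> (\<Sum>\<sigma>\<in>PiE U ?S'. \<sigma> i * ising_weight \<beta> B R U \<sigma>) * (\<Sum>\<sigma>\<in>configs V. ising_weight \<beta> B R V \<sigma>)"
    unfolding Z M by (simp add: mult.assoc)
  moreover have "0 < (\<Sum>\<sigma>\<in>configs V. ising_weight \<beta> B R V \<sigma>)" "0 < (\<Sum>\<sigma>\<in>PiE U ?S'. ising_weight \<beta> B R U \<sigma>)"
    using V finU by (intro sum_configs_pos; simp add: spins_def)+
  ultimately show ?thesis unfolding magnetization_def by (simp add: divide_simps mult.commute)
qed

lemma magnetization_iso:
  assumes f: "bij_betw f V V'" and i: "i \<in> V"
    and R: "\<And>x y. x \<in> V \<Longrightarrow> y \<in> V \<Longrightarrow> R' (f x) (f y) \<longleftrightarrow> R x y"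
    and S: "\<And>x. x \<in> V \<Longrightarrow> S' (f x) = S x"
  shows "magnetization \<beta> B R' V' S' (f i) = magnetization \<beta> B R V S i"
proof -
  let ?g = "inv_into V f"
  have bij: "bij_betw (\<lambda>\<sigma>. restrict (\<lambda>x. \<sigma> (f x)) V) (PiE V' S') (PiE V S)"
  proof (rule bij_betw_byWitness[where f' = "\<lambda>\<tau>. restrict (\<lambda>y. \<tau> (?g y)) V'"])
    show "\<forall>\<sigma>\<in>PiE V' S'. restrict (\<lambda>y. restrict (\<lambda>x. \<sigma> (f x)) V (?g y)) V' = \<sigma>"
    proof
      fix \<sigma> assume \<sigma>: "\<sigma> \<in> PiE V' S'"
      show "restrict (\<lambda>y. restrict (\<lambda>x. \<sigma> (f x)) V (?g y)) V' = \<sigma>"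
      proof
        fix y show "restrict (\<lambda>y. restrict (\<lambda>x. \<sigma> (f x)) V (?g y)) V' y = \<sigma> y"
          using \<sigma> f bij_betw_inv_into_right[OF f, of y] bij_betwE[OF bij_betw_inv_into[OF f]]
          by (cases "y \<in> V'") (auto simp: PiE_def extensional_def)
      qed
    qed
    show "\<forall>\<tau>\<in>PiE V S. restrict (\<lambda>x. restrict (\<lambda>y. \<tau> (?g y)) V' (f x)) V = \<tau>"
    proof
      fix \<tau> assume \<tau>: "\<tau> \<in> PiE V S"
      show "restrict (\<lambda>x. restrict (\<lambda>y. \<tau> (?g y)) V' (f x)) V = \<tau>"
      proof
        fix x show "restrict (\<lambda>x. restrict (\<lambda>y. \<tau> (?g y)) V' (f x)) V x = \<tau> x"
          using \<tau> bij_betw_inv_into_left[OF f, of x] bij_betwE[OF f]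
          by (cases "x \<in> V") (auto simp: PiE_def extensional_def)
      qed
    qed
    show "(\<lambda>\<sigma>. restrict (\<lambda>x. \<sigma> (f x)) V) ` PiE V' S' \<subseteq> PiE V S"
    proof (rule image_subsetI)
      fix \<sigma> assume \<sigma>: "\<sigma> \<in> PiE V' S'"
      show "restrict (\<lambda>x. \<sigma> (f x)) V \<in> PiE V S"
        using PiE_mem[OF \<sigma>] bij_betwE[OF f] S by auto
    qed
    show "(\<lambda>\<tau>. restrict (\<lambda>y. \<tau> (?g y)) V') ` PiE V S \<subseteq> PiE V' S'"
    proof (rule image_subsetI)
      fix \<tau> assume \<tau>: "\<tau> \<in> PiE V S"
      have "\<tau> (?g y) \<in> S' y" if "y \<in> V'" for y
      proof -
        have "?g y \<in> V" using that bij_betwE[OF bij_betw_inv_into[OF f]] by auto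
        thus ?thesis using PiE_mem[OF \<tau>] S[of "?g y"] bij_betw_inv_into_right[OF f that] by auto
      qed
      thus "restrict (\<lambda>y. \<tau> (?g y)) V' \<in> PiE V' S'" by auto
    qed
  qed
  have w: "ising_weight \<beta> B R V (restrict (\<lambda>x. \<sigma> (f x)) V) = ising_weight \<beta> B R' V' \<sigma>" for \<sigma>
  proof -
    have "(\<Sum>v\<in>V'. \<Sum>w\<in>V'. if R' v w then \<sigma> v * \<sigma> w else 0) = (\<Sum>v\<in>V. \<Sum>w\<in>V'. if R' (f v) w then \<sigma> (f v) * \<sigma> w else 0)"
      by (rule sum.reindex_bij_betw[OF f, symmetric])
    also have "\<dots> = (\<Sum>v\<in>V. \<Sum>w\<in>V. if R v w then \<sigma> (f v) * \<sigma> (f w) else 0)"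
    proof (rule sum.cong[OF refl])
      fix v assume v: "v \<in> V"
      have "(\<Sum>w\<in>V'. if R' (f v) w then \<sigma> (f v) * \<sigma> w else 0) = (\<Sum>w\<in>V. if R' (f v) (f w) then \<sigma> (f v) * \<sigma> (f w) else 0)"
        by (rule sum.reindex_bij_betw[OF f, symmetric])
      thus "(\<Sum>w\<in>V'. if R' (f v) w then \<sigma> (f v) * \<sigma> w else 0) = (\<Sum>w\<in>V. if R v w then \<sigma> (f v) * \<sigma> (f w) else 0)"
        using R[OF v] by (simp cong: sum.cong)
    qed
    finally show ?thesis
      using sum.reindex_bij_betw[OF f, of \<sigma>] by (simp add: ising_weight_restrict) (simp add: ising_weight_def)
  qed
  have "(\<Sum>\<sigma>\<in>PiE V S. ising_weight \<beta> B R V \<sigma>) = (\<Sum>\<sigma>\<in>PiE V' S'. ising_weight \<beta> B R' V' \<sigma>)"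
    unfolding sum.reindex_bij_betw[OF bij, symmetric] w ..
  moreover have "(\<Sum>\<sigma>\<in>PiE V S. \<sigma> i * ising_weight \<beta> B R V \<sigma>) = (\<Sum>\<sigma>\<in>PiE V' S'. \<sigma> (f i) * ising_weight \<beta> B R' V' \<sigma>)"
    unfolding sum.reindex_bij_betw[OF bij, symmetric] w using i by simp
  ultimately show ?thesis by (simp add: magnetization_def)
qed

lemma ising_tree_weight_eq:
  "ising_tree_weight \<beta> B V \<sigma> = ising_weight \<beta> B tree_adj V \<sigma>"
proof -
  let ?child = "\<lambda>v w. \<exists>i. w = v @ [i]"
  have "(\<Sum>v\<in>V. \<Sum>w\<in>V. if tree_adj v w then \<sigma> v * \<sigma> w else 0) =
      (\<Sum>v\<in>V. \<Sum>w\<in>V. (if ?child v w then \<sigma> v * \<sigma> w else 0) + (if ?child w v then \<sigma> w * \<sigma> v else 0))"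
    by (intro sum.cong refl) (auto simp: tree_adj_def)
  also have "\<dots> = 2 * (\<Sum>v\<in>V. \<Sum>w\<in>V. if ?child v w then \<sigma> v * \<sigma> w else 0)"
    by (simp add: sum.distrib sum.swap[of "\<lambda>v w. if ?child w v then \<sigma> w * \<sigma> v else 0"])
  finally show ?thesis by (simp add: ising_tree_weight_def ising_weight_def)
qed

lemma magnetization_tree:
  assumes A: "\<And>k. A k \<subseteq> spins" and h: "prop_gibbs (tree_Z \<beta> B A c t) h"
  shows "magnetization \<beta> B tree_adj (tree_ball c t) (\<lambda>v. A (t - length v)) [] = tanh h"
proof -
  let ?Z = "\<lambda>s. tree_Z \<beta> B A c t s"
  have fin: "finite (tree_configs A c t)"
    using A finite_subset[OF _ finite_spins] unfolding tree_configs_def by (intro finite_PiE) auto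
  have "(\<Sum>\<sigma>\<in>tree_configs A c t. \<sigma> [] * ising_tree_weight \<beta> B (tree_ball c t) \<sigma>) =
      (\<Sum>s\<in>spins. \<Sum>\<sigma>\<in>{\<sigma>\<in>tree_configs A c t. \<sigma> [] = s}. \<sigma> [] * ising_tree_weight \<beta> B (tree_ball c t) \<sigma>)"
    using A[of t] tree_configs_root by (intro sum.group[symmetric] fin) fastforce+
  also have "\<dots> = (\<Sum>s\<in>spins. s * ?Z s)"
    by (auto simp: tree_Z_def sum_distrib_left intro!: sum.cong)
  finally have "magnetization \<beta> B tree_adj (tree_ball c t) (\<lambda>v. A (t - length v)) [] =
      (\<Sum>s\<in>spins. s * ?Z s) / (\<Sum>s\<in>spins. ?Z s)"
    by (simp add: magnetization_def ising_tree_weight_eq[symmetric] tree_configs_def[symmetric] sum_tree_Z[OF A])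
  also have "\<dots> = (\<Sum>s\<in>spins. s * gibbs1 h s)"
    by (simp add: sum_divide_distrib prop_gibbs_normalize[OF h, symmetric])
  also have "\<dots> = tanh h"
    by (simp add: sum_spins gibbs1_def tanh_def sinh_def field_simps)
  finally show ?thesis .
qed

section \<open>Local isomorphisms and non-backtracking messages\<close>

text \<open>Balls of an arbitrary relation, so that finite graphs and encoded trees share one notion
  of local isomorphism.\<close>

primrec gball :: "('a \<Rightarrow> 'a \<Rightarrow> bool) \<Rightarrow> 'a \<Rightarrow> nat \<Rightarrow> 'a set" where
  "gball R a 0 = {a}"
| "gball R a (Suc k) = gball R a k \<union> {y. \<exists>x\<in>gball R a k. R x y}"

definition tadj :: "(nat list \<Rightarrow> nat) \<Rightarrow> nat list \<Rightarrow> nat list \<Rightarrow> bool" where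
  "tadj c x y \<longleftrightarrow> x \<in> tree_verts c \<and> y \<in> tree_verts c \<and> tree_adj x y"

definition local_iso ::
  "('a \<Rightarrow> 'a \<Rightarrow> bool) \<Rightarrow> 'a \<Rightarrow> ('b \<Rightarrow> 'b \<Rightarrow> bool) \<Rightarrow> 'b \<Rightarrow> nat \<Rightarrow> ('a \<Rightarrow> 'b) \<Rightarrow> bool" where
  "local_iso R a R' b T f \<longleftrightarrow> bij_betw f (gball R a T) (gball R' b T) \<and> f a = b \<and>
     (\<forall>x\<in>gball R a T. \<forall>y\<in>gball R a T. R' (f x) (f y) \<longleftrightarrow> R x y)"

lemma gball_mono: "k \<le> T \<Longrightarrow> gball R a k \<subseteq> gball R a T"
  by (rule lift_Suc_mono_le) auto

lemma gball_center [simp]: "a \<in> gball R a k"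
  by (induction k) auto

lemma ball_verts_eq_gball: "ball_verts E t v = gball E v t"
proof (induction t)
  case 0
  show ?case by (auto simp: ball_verts_def)
next
  case (Suc t)
  have "(\<exists>k\<le>Suc t. (v, u) \<in> {(x, y). E x y} ^^ k) \<longleftrightarrow>
      (\<exists>k\<le>t. (v, u) \<in> {(x, y). E x y} ^^ k) \<or> (\<exists>x. (\<exists>k\<le>t. (v, x) \<in> {(x, y). E x y} ^^ k) \<and> E x u)" (is "?L \<longleftrightarrow> ?R") for u
  proof
    assume ?L
    then obtain k where k: "k \<le> Suc t" "(v, u) \<in> {(x, y). E x y} ^^ k" by blast
    thus ?R by (cases k) (auto simp: relcomp_unfold)
  next
    assume ?R
    thus ?L
    proof
      assume "\<exists>x. (\<exists>k\<le>t. (v, x) \<in> {(x, y). E x y} ^^ k) \<and> E x u"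
      then obtain x k where "k \<le> t" "(v, x) \<in> {(x, y). E x y} ^^ k" "E x u" by blast
      hence "Suc k \<le> Suc t" "(v, u) \<in> {(x, y). E x y} ^^ Suc k" by auto
      thus ?L by blast
    qed (auto intro: le_SucI)
  qed
  thus ?case unfolding gball.simps Suc.IH[symmetric] by (auto simp: ball_verts_def)
qed

lemma snoc_in_tree_verts: "xs @ [i] \<in> tree_verts c \<longleftrightarrow> xs \<in> tree_verts c \<and> i < c xs"
proof -
  have "(xs @ [i]) ! k < c (take k (xs @ [i])) \<longleftrightarrow> xs ! k < c (take k xs)" if "k < length xs" for k
    using that by (simp add: nth_append)
  thus ?thesis by (auto simp: tree_verts_def nth_append less_Suc_eq)
qed

lemma tree_ball_eq_gball: "tree_ball c t = gball (tadj c) [] t"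
proof (induction t)
  case 0
  show ?case by (simp add: tree_ball_0)
next
  case (Suc t)
  have "y \<in> tree_ball c (Suc t) \<longleftrightarrow> y \<in> tree_ball c t \<or> (\<exists>x\<in>tree_ball c t. tadj c x y)" for y
  proof
    assume y: "y \<in> tree_ball c (Suc t)"
    show "y \<in> tree_ball c t \<or> (\<exists>x\<in>tree_ball c t. tadj c x y)"
    proof (cases y rule: rev_cases)
      case (snoc ys i)
      hence "ys \<in> tree_ball c t" "tadj c ys y"
        using y by (auto simp: tree_ball_def tadj_def snoc_in_tree_verts tree_adj_def)
      thus ?thesis by blast
    qed simp
  next
    assume "y \<in> tree_ball c t \<or> (\<exists>x\<in>tree_ball c t. tadj c x y)"
    thus "y \<in> tree_ball c (Suc t)"
      by (auto simp: tree_ball_def tadj_def tree_adj_def)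
  qed
  thus ?case unfolding gball.simps Suc.IH[symmetric] by blast
qed

lemma tadj_iff_tree_adj:
  "x \<in> gball (tadj c) [] t \<Longrightarrow> y \<in> gball (tadj c) [] t \<Longrightarrow> tadj c x y \<longleftrightarrow> tree_adj x y"
  unfolding tree_ball_eq_gball[symmetric] by (simp add: tadj_def tree_ball_def)

lemma ball_iso_tree_iff: "ball_iso_tree E v t c \<longleftrightarrow> (\<exists>f. local_iso (tadj c) [] E v t f)"
  unfolding ball_iso_tree_def local_iso_def ball_verts_eq_gball tree_ball_eq_gball
  by (simp add: tadj_iff_tree_adj cong: conj_cong)

lemma tree_ball_iso_iff: "tree_ball_iso t c c' \<longleftrightarrow> (\<exists>f. local_iso (tadj c) [] (tadj c') [] t f)"
proof -
  have "tadj c' (f x) (f y) \<longleftrightarrow> tree_adj (f x) (f y)"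
    if "bij_betw f (gball (tadj c) [] t) (gball (tadj c') [] t)" "x \<in> gball (tadj c) [] t" "y \<in> gball (tadj c) [] t" for f x y
    using that by (intro tadj_iff_tree_adj[of _ _ t]) (auto dest: bij_betwE)
  thus ?thesis
    unfolding tree_ball_iso_def local_iso_def tree_ball_eq_gball
    by (simp add: tadj_iff_tree_adj cong: conj_cong)
qed

text \<open>An isomorphism of balls that respects the centres preserves distances to them, by
  induction on the radius; this is what allows restriction to smaller radii.\<close>

lemma local_iso_image:
  assumes "local_iso R a R' b T f" "k \<le> T"
  shows "f ` gball R a k = gball R' b k"
  using assms(2)
proof (induction k)
  case 0
  thus ?case using assms(1) by (simp add: local_iso_def)
next
  case (Suc k)
  have IH: "f ` gball R a k = gball R' b k" and k: "k \<le> T" using Suc by auto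
  have R: "x \<in> gball R a T \<Longrightarrow> y \<in> gball R a T \<Longrightarrow> R' (f x) (f y) \<longleftrightarrow> R x y" for x y
    using assms(1) by (simp add: local_iso_def)
  have im: "f ` gball R a T = gball R' b T" using assms(1) by (simp add: local_iso_def bij_betw_def)
  show ?case
  proof
    show "f ` gball R a (Suc k) \<subseteq> gball R' b (Suc k)"
    proof
      fix y' assume "y' \<in> f ` gball R a (Suc k)"
      then obtain y where y: "y \<in> gball R a (Suc k)" "y' = f y" by blast
      show "y' \<in> gball R' b (Suc k)"
      proof (cases "y \<in> gball R a k")
        case False
        then obtain x where x: "x \<in> gball R a k" "R x y" using y by auto
        hence "R' (f x) (f y)" using R[of x y] gball_mono[OF k, of R a] gball_mono[OF Suc.prems, of R a] y by auto
        thus ?thesis using x IH y by auto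
      qed (use IH y in auto)
    qed
    show "gball R' b (Suc k) \<subseteq> f ` gball R a (Suc k)"
    proof
      fix y' assume y': "y' \<in> gball R' b (Suc k)"
      show "y' \<in> f ` gball R a (Suc k)"
      proof (cases "y' \<in> gball R' b k")
        case False
        then obtain x' where x': "x' \<in> gball R' b k" "R' x' y'" using y' by auto
        obtain x where x: "x \<in> gball R a k" "x' = f x" using x' IH by blast
        obtain y where y: "y \<in> gball R a T" "y' = f y"
          using y' gball_mono[OF Suc.prems, of R' b] im by blast
        have "R x y" using R[of x y] gball_mono[OF k, of R a] x y x' by auto
        thus ?thesis using x y by auto
      qed (use IH in auto)
    qed
  qed
qed

lemma local_iso_mono:
  assumes "local_iso R a R' b T f" "k \<le> T"
  shows "local_iso R a R' b k f"
proof -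
  have sub: "gball R a k \<subseteq> gball R a T" by (rule gball_mono[OF assms(2)])
  hence "\<forall>x\<in>gball R a k. \<forall>y\<in>gball R a k. R' (f x) (f y) \<longleftrightarrow> R x y"
    using assms(1) unfolding local_iso_def by blast
  thus ?thesis
    using assms(1) local_iso_image[OF assms] inj_on_subset[OF _ sub, of f]
    by (simp add: local_iso_def bij_betw_def)
qed

lemma local_iso_refl: "gball R a T = gball R' a T \<Longrightarrow>
    (\<And>x y. x \<in> gball R a T \<Longrightarrow> y \<in> gball R a T \<Longrightarrow> R x y \<longleftrightarrow> R' x y) \<Longrightarrow> local_iso R a R' a T id"
  by (auto simp: local_iso_def)

lemma local_iso_inv:
  assumes "local_iso R a R' b T f"
  shows "local_iso R' b R a T (inv_into (gball R a T) f)"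
proof -
  have f: "bij_betw f (gball R a T) (gball R' b T)" "f a = b"
    and R: "\<And>x y. x \<in> gball R a T \<Longrightarrow> y \<in> gball R a T \<Longrightarrow> R' (f x) (f y) \<longleftrightarrow> R x y"
    using assms by (auto simp: local_iso_def)
  let ?g = "inv_into (gball R a T) f"
  have g: "bij_betw ?g (gball R' b T) (gball R a T)" by (rule bij_betw_inv_into[OF f(1)])
  have "R (?g x) (?g y) \<longleftrightarrow> R' x y" if "x \<in> gball R' b T" "y \<in> gball R' b T" for x y
    using R[of "?g x" "?g y"] that bij_betwE[OF g] bij_betw_inv_into_right[OF f(1)] by simp
  moreover have "?g b = a" using bij_betw_inv_into_left[OF f(1), of a] f(2) by simp
  ultimately show ?thesis using g by (simp add: local_iso_def)
qed

lemma local_iso_comp: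
  assumes "local_iso R a R' b T f" "local_iso R' b R'' c T g"
  shows "local_iso R a R'' c T (g \<circ> f)"
  using assms bij_betw_trans[of f "gball R a T" "gball R' b T" g "gball R'' c T"]
  by (auto simp: local_iso_def dest: bij_betwE)

lemma tree_ball_iso_of_eq: "tree_ball c t = tree_ball c' t \<Longrightarrow> tree_ball_iso t c c'"
  unfolding tree_ball_iso_iff tree_ball_eq_gball
  using tadj_iff_tree_adj[of _ c t] tadj_iff_tree_adj[of _ c' t]
  by (intro exI[of _ id] local_iso_refl) auto

lemma tree_ball_iso_refl: "tree_ball_iso t c c"
  by (rule tree_ball_iso_of_eq) simp

lemma tree_ball_iso_sym: "tree_ball_iso t c c' \<Longrightarrow> tree_ball_iso t c' c"
  unfolding tree_ball_iso_iff using local_iso_inv by metis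

lemma tree_ball_iso_trans: "tree_ball_iso t c c' \<Longrightarrow> tree_ball_iso t c' c'' \<Longrightarrow> tree_ball_iso t c c''"
  unfolding tree_ball_iso_iff using local_iso_comp by metis

lemma tree_ball_iso_mono: "tree_ball_iso T c c' \<Longrightarrow> t \<le> T \<Longrightarrow> tree_ball_iso t c c'"
  unfolding tree_ball_iso_iff using local_iso_mono by metis

lemma ball_iso_tree_unique: "ball_iso_tree E v t c \<Longrightarrow> ball_iso_tree E v t c' \<Longrightarrow> tree_ball_iso t c c'"
  unfolding tree_ball_iso_iff ball_iso_tree_iff using local_iso_comp local_iso_inv by metis

text \<open>The ball of radius \<open>T\<close> is certain to contain every edge at a vertex only if
  that vertex has distance below \<open>T\<close>, whence \<open>Suc k \<le> T\<close>.\<close>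

lemma local_iso_nbrs:
  assumes "local_iso R a R' b T f" "x \<in> gball R a k" "Suc k \<le> T"
  shows "{y. R' (f x) y} = f ` {y. R x y}" "inj_on f {y. R x y}" "{y. R x y} \<subseteq> gball R a (Suc k)"
proof -
  have k: "k \<le> T" using assms(3) by simp
  have sub: "{y. R x y} \<subseteq> gball R a (Suc k)" using assms(2) by auto
  have sub': "{y. R' (f x) y} \<subseteq> gball R' b (Suc k)"
    using local_iso_image[OF assms(1) k] assms(2) by auto
  have x: "x \<in> gball R a T" using assms(2) gball_mono[OF k, of R a] by blast
  have R: "y \<in> gball R a T \<Longrightarrow> R' (f x) (f y) \<longleftrightarrow> R x y" for y
    using assms(1) x by (simp add: local_iso_def)
  have inj: "inj_on f (gball R a T)" using assms(1) by (simp add: local_iso_def bij_betw_def)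
  show "{y. R' (f x) y} = f ` {y. R x y}"
  proof
    show "{y. R' (f x) y} \<subseteq> f ` {y. R x y}"
    proof safe
      fix y' assume y': "R' (f x) y'"
      hence "y' \<in> f ` gball R a (Suc k)" using sub' local_iso_image[OF assms(1,3)] by auto
      then obtain y where "y \<in> gball R a (Suc k)" "y' = f y" by blast
      thus "y' \<in> f ` {y. R x y}" using R[of y] y' gball_mono[OF assms(3), of R a] by auto
    qed
    show "f ` {y. R x y} \<subseteq> {y. R' (f x) y}"
    proof safe
      fix y assume y: "R x y"
      hence "y \<in> gball R a T" using sub gball_mono[OF assms(3), of R a] by blast
      thus "R' (f x) (f y)" using R y by simp
    qed
  qed
  show "inj_on f {y. R x y}" using inj sub gball_mono[OF assms(3), of R a] by (blast intro: inj_on_subset)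
  show "{y. R x y} \<subseteq> gball R a (Suc k)" by (rule sub)
qed

lemma root_nbrs_tree: "{y. tadj c [] y} = (\<lambda>k. [k]) ` {..<c []}"
  using snoc_in_tree_verts[of "[]"] by (auto simp: tadj_def tree_adj_def tree_verts_def)

lemma deg_ball_iso_tree:
  assumes "ball_iso_tree E i t c" "1 \<le> t"
  shows "deg E i = c []"
proof -
  obtain f where f: "local_iso (tadj c) [] E i t f" using assms(1) by (auto simp: ball_iso_tree_iff)
  have i: "f [] = i" using f by (simp add: local_iso_def)
  have "card {j. E i j} = card (f ` {y. tadj c [] y})"
    using local_iso_nbrs(1)[OF f, of "[]" 0] assms(2) i by simp
  also have "\<dots> = card {y. tadj c [] y}"
    using local_iso_nbrs(2)[OF f, of "[]" 0] assms(2) by (intro card_image) simp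
  finally show ?thesis by (simp add: deg_def root_nbrs_tree card_image inj_on_def)
qed

lemma root_degree_tree_ball_iso:
  assumes "tree_ball_iso t c c'" "1 \<le> t"
  shows "c [] = c' []"
proof -
  obtain f where f: "local_iso (tadj c) [] (tadj c') [] t f" using assms(1) by (auto simp: tree_ball_iso_iff)
  have i: "f [] = []" using f by (simp add: local_iso_def)
  have "card {j. tadj c' [] j} = card (f ` {y. tadj c [] y})"
    using local_iso_nbrs(1)[OF f, of "[]" 0] assms(2) i by simp
  also have "\<dots> = card {y. tadj c [] y}"
    using local_iso_nbrs(2)[OF f, of "[]" 0] assms(2) by (intro card_image) simp
  finally show ?thesis by (simp add: root_nbrs_tree card_image inj_on_def)
qed

text \<open>Free recursion along directed edges of any graph. On a graph with cycles it need not be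
  a cavity field; all that is used is that it is local and agrees with \<open>free_field\<close> on
  trees. If \<open>y\<close> is not a neighbour of \<open>x\<close>, no summand is left out, so on a
  loopless graph \<open>y = x\<close> gives the full field at \<open>x\<close>.\<close>

primrec graph_msg :: "real \<Rightarrow> real \<Rightarrow> ('a \<Rightarrow> 'a \<Rightarrow> bool) \<Rightarrow> nat \<Rightarrow> 'a \<Rightarrow> 'a \<Rightarrow> real" where
  "graph_msg \<beta> B R 0 = (\<lambda>x y. B)"
| "graph_msg \<beta> B R (Suc t) = (\<lambda>x y. B + (\<Sum>k\<in>{k. R x k} - {y}. xi \<beta> (graph_msg \<beta> B R t k x)))"

text \<open>Each round looks one step further, so \<open>k + t \<le> T\<close> keeps the computation
  inside the ball; \<open>y\<close> must lie there too, because injectivity of \<open>f\<close> is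
  needed to exclude the same neighbour on both sides.\<close>

lemma local_iso_graph_msg:
  assumes "local_iso R a R' b T f" "x \<in> gball R a k" "y \<in> gball R a T" "k + t \<le> T"
  shows "graph_msg \<beta> B R' t (f x) (f y) = graph_msg \<beta> B R t x y"
  using assms(2-)
proof (induction t arbitrary: x y k)
  case (Suc t)
  have k: "Suc k \<le> T" using Suc.prems by simp
  note nb = local_iso_nbrs[OF assms(1) Suc.prems(1) k]
  have inj: "inj_on f (gball R a T)" using assms(1) by (simp add: local_iso_def bij_betw_def)
  have sub: "{z. R x z} \<subseteq> gball R a T" using nb(3) gball_mono[OF k, of R a] by blast
  have x: "x \<in> gball R a T" using Suc.prems gball_mono[of k T R a] by auto
  have "{z. R' (f x) z} - {f y} = f ` ({z. R x z} - {y})"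
    unfolding nb(1) using inj sub Suc.prems(2) by (auto dest: inj_onD)
  hence "(\<Sum>z\<in>{z. R' (f x) z} - {f y}. xi \<beta> (graph_msg \<beta> B R' t z (f x))) =
      (\<Sum>z\<in>{z. R x z} - {y}. xi \<beta> (graph_msg \<beta> B R' t (f z) (f x)))"
    using inj_on_subset[OF nb(2)] by (simp add: sum.reindex)
  also have "\<dots> = (\<Sum>z\<in>{z. R x z} - {y}. xi \<beta> (graph_msg \<beta> B R t z x))"
  proof (rule sum.cong[OF refl])
    fix z assume "z \<in> {z. R x z} - {y}"
    hence "z \<in> gball R a (Suc k)" using nb(3) by auto
    thus "xi \<beta> (graph_msg \<beta> B R' t (f z) (f x)) = xi \<beta> (graph_msg \<beta> B R t z x)"
      using Suc.IH[of z "Suc k" x] Suc.prems x by simp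
  qed
  finally show ?case by simp
qed simp

lemma tadj_nbrs:
  assumes "x \<in> tree_verts c"
  shows "{y. tadj c x y} = (\<lambda>k. x @ [k]) ` {..<c x} \<union> {p. \<exists>i. x = p @ [i]}"
  using assms by (auto simp: tadj_def tree_adj_def snoc_in_tree_verts)

text \<open>A message sent towards the root reads only descendants of its source, so it is the free
  field of the subtree there.\<close>

lemma graph_msg_tree_up:
  assumes "p @ [i] \<in> tree_verts c"
  shows "graph_msg \<beta> B (tadj c) t (p @ [i]) p = free_field \<beta> B t (\<lambda>xs. c (p @ [i] @ xs))"
  using assms
proof (induction t arbitrary: p i)
  case (Suc t)
  let ?x = "p @ [i]"
  have nb: "{y. tadj c ?x y} - {p} = (\<lambda>k. ?x @ [k]) ` {..<c ?x}"
    unfolding tadj_nbrs[OF Suc.prems] by (auto simp del: append_assoc dest: arg_cong[where f = length])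
  have "(\<Sum>y\<in>{y. tadj c ?x y} - {p}. xi \<beta> (graph_msg \<beta> B (tadj c) t y ?x)) =
      (\<Sum>k<c ?x. xi \<beta> (graph_msg \<beta> B (tadj c) t (?x @ [k]) ?x))"
    unfolding nb by (subst sum.reindex) (auto simp: inj_on_def)
  also have "\<dots> = (\<Sum>k<c ?x. xi \<beta> (free_field \<beta> B t (subtree (\<lambda>xs. c (p @ [i] @ xs)) k)))"
  proof (rule sum.cong[OF refl])
    fix k assume "k \<in> {..<c ?x}"
    hence "?x @ [k] \<in> tree_verts c" using Suc.prems by (subst snoc_in_tree_verts) auto
    from Suc.IH[OF this] show "xi \<beta> (graph_msg \<beta> B (tadj c) t (?x @ [k]) ?x) =
        xi \<beta> (free_field \<beta> B t (subtree (\<lambda>xs. c (p @ [i] @ xs)) k))"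
      by (simp add: subtree_def)
  qed
  finally show ?case by simp
qed simp

lemma graph_msg_child:
  assumes "i < c []"
  shows "graph_msg \<beta> B (tadj c) t [i] [] = free_field \<beta> B t (subtree c i)"
  using graph_msg_tree_up[of "[]" i c] assms snoc_in_tree_verts[of "[]" i c]
  by (simp add: subtree_def tree_verts_def)

lemma graph_msg_root: "graph_msg \<beta> B (tadj c) t [] [] = free_field \<beta> B t c"
proof (cases t)
  case (Suc s)
  have "(\<Sum>y\<in>{y. tadj c [] y} - {[]}. xi \<beta> (graph_msg \<beta> B (tadj c) s y [])) =
      (\<Sum>k<c []. xi \<beta> (graph_msg \<beta> B (tadj c) s [k] []))"
    unfolding root_nbrs_tree by (subst Diff_triv) (auto simp: sum.reindex inj_on_def)
  thus ?thesis using Suc by (simp add: graph_msg_child)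
qed simp

lemma sum_remove_child:
  assumes "i < c []"
  shows "(\<Sum>k<remove_child c i []. f (subtree (remove_child c i) k)) = (\<Sum>k\<in>{..<c []} - {i}. f (subtree c k))"
proof -
  let ?skip = "\<lambda>k. if k < i then k else Suc k"
  have "(\<Sum>k\<in>{..<c []} - {i}. f (subtree c k)) = (\<Sum>k<c [] - 1. f (subtree c (?skip k)))"
    using assms
    by (intro sum.reindex_bij_witness[where i = ?skip and j = "\<lambda>k. if k < i then k else k - 1"]) auto
  also have "\<dots> = (\<Sum>k<remove_child c i []. f (subtree (remove_child c i) k))"
    by (intro sum.cong) (auto simp: remove_child_def subtree_def)
  finally show ?thesis ..
qed

lemma graph_msg_parent:
  assumes "i < c []"
  shows "graph_msg \<beta> B (tadj c) t [] [i] = free_field \<beta> B t (remove_child c i)"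
proof (cases t)
  case (Suc s)
  have "{y. tadj c [] y} - {[i]} = (\<lambda>k. [k]) ` ({..<c []} - {i})"
    unfolding root_nbrs_tree by auto
  hence "(\<Sum>y\<in>{y. tadj c [] y} - {[i]}. xi \<beta> (graph_msg \<beta> B (tadj c) s y [])) =
      (\<Sum>k\<in>{..<c []} - {i}. xi \<beta> (graph_msg \<beta> B (tadj c) s [k] []))"
    by (simp add: sum.reindex inj_on_def)
  also have "\<dots> = (\<Sum>k\<in>{..<c []} - {i}. xi \<beta> (free_field \<beta> B s (subtree c k)))"
    by (intro sum.cong refl) (simp add: graph_msg_child)
  also have "\<dots> = (\<Sum>k<remove_child c i []. xi \<beta> (free_field \<beta> B s (subtree (remove_child c i) k)))"
    by (rule sum_remove_child[where c = c and i = i and f = "\<lambda>d. xi \<beta> (free_field \<beta> B s d)", OF assms, symmetric])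
  finally show ?thesis using Suc by simp
qed simp

type_synonym edge_fun = "real \<Rightarrow> real \<Rightarrow> real \<Rightarrow> real \<Rightarrow> real"

text \<open>The arguments of \<open>g\<close> are the incoming and outgoing messages at
  \<open>B\<close>, then those at \<open>B'\<close>. Two field values are needed because the first
  variation of the Bethe functional compares both.\<close>

definition edge_sum ::
  "real \<Rightarrow> real \<Rightarrow> real \<Rightarrow> edge_fun \<Rightarrow> nat \<Rightarrow> ('a \<Rightarrow> 'a \<Rightarrow> bool) \<Rightarrow> 'a \<Rightarrow> real" where
  "edge_sum \<beta> B B' g t R a = (\<Sum>j\<in>{j. R a j}.
     g (graph_msg \<beta> B R t j a) (graph_msg \<beta> B R t a j) (graph_msg \<beta> B' R t j a) (graph_msg \<beta> B' R t a j))"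

lemma edge_sum_local_iso:
  assumes "local_iso R a R' b (Suc t) f"
  shows "edge_sum \<beta> B B' g t R' b = edge_sum \<beta> B B' g t R a"
proof -
  have b: "f a = b" using assms by (simp add: local_iso_def)
  have a: "a \<in> gball R a 0" by simp
  note nb = local_iso_nbrs[OF assms a, unfolded b, simplified]
  have msg: "graph_msg \<beta> B R' t (f j) b = graph_msg \<beta> B R t j a" "graph_msg \<beta> B R' t b (f j) = graph_msg \<beta> B R t a j"
    if "R a j" for j B
  proof -
    have j: "j \<in> gball R a (Suc 0)" using that by auto
    have jT: "j \<in> gball R a (Suc t)" using j gball_mono[of "Suc 0" "Suc t" R a] by auto
    show "graph_msg \<beta> B R' t (f j) b = graph_msg \<beta> B R t j a"
      using local_iso_graph_msg[OF assms j, of a t] b by simp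
    show "graph_msg \<beta> B R' t b (f j) = graph_msg \<beta> B R t a j"
      using local_iso_graph_msg[OF assms a jT, of t] b by simp
  qed
  show ?thesis unfolding edge_sum_def nb(1) sum.reindex[OF nb(2)]
    by (intro sum.cong refl) (simp add: msg)
qed

lemma edge_sum_tree:
  "edge_sum \<beta> B B' g t (tadj c) [] = (\<Sum>i<c [].
     g (free_field \<beta> B t (subtree c i)) (free_field \<beta> B t (remove_child c i))
       (free_field \<beta> B' t (subtree c i)) (free_field \<beta> B' t (remove_child c i)))"
  unfolding edge_sum_def root_nbrs_tree
  by (subst sum.reindex) (auto simp: inj_on_def graph_msg_child graph_msg_parent intro!: sum.cong)

lemma free_field_tree_ball_iso:
  assumes "tree_ball_iso t c c'"
  shows "free_field \<beta> B t c = free_field \<beta> B t c'"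
proof -
  obtain f where f: "local_iso (tadj c) [] (tadj c') [] t f" using assms by (auto simp: tree_ball_iso_iff)
  thus ?thesis
    using local_iso_graph_msg[OF f, of "[]" 0 "[]" t] by (simp add: graph_msg_root local_iso_def)
qed

text \<open>The ball alone bounds the magnetization from below, the ball with its outer sphere
  frozen at +1 from above; on a tree-like ball both are given by field recursions. Cycles farther
  away do no harm.\<close>

lemma magnetization_bounds:
  assumes E: "simple_graph_on n E" "i < n" and iso: "ball_iso_tree E i (Suc t) c" and "0 \<le> \<beta>" "0 \<le> B"
  shows "tanh (free_field \<beta> B (Suc t) c) \<le> magnetization \<beta> B E {..<n} (\<lambda>_. spins) i"
    and "magnetization \<beta> B E {..<n} (\<lambda>_. spins) i \<le> tanh (plus_field \<beta> B t c)"
proof -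
  obtain f where f: "local_iso (tadj c) [] E i (Suc t) f" using iso by (auto simp: ball_iso_tree_iff)
  let ?U = "gball E i (Suc t)"
  have UV: "gball E i k \<subseteq> {..<n}" for k
    using E by (induction k) (auto simp: simple_graph_on_def)
  have bij: "bij_betw f (tree_ball c (Suc t)) ?U" and root: "f [] = i"
    using f by (auto simp: local_iso_def tree_ball_eq_gball)
  have adj: "E (f x) (f y) \<longleftrightarrow> tree_adj x y" if "x \<in> tree_ball c (Suc t)" "y \<in> tree_ball c (Suc t)" for x y
    using f that tadj_iff_tree_adj[of x c "Suc t" y] by (simp add: local_iso_def tree_ball_eq_gball)
  have "magnetization \<beta> B E ?U (\<lambda>_. spins) i = tanh (free_field \<beta> B (Suc t) c)"
    using magnetization_iso[where R = tree_adj and R' = E and S = "\<lambda>_. spins" and S' = "\<lambda>_. spins",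
        OF bij Nil_in_tree_ball adj refl]
      magnetization_tree[OF _ tree_Z_free] root by simp
  thus "tanh (free_field \<beta> B (Suc t) c) \<le> magnetization \<beta> B E {..<n} (\<lambda>_. spins) i"
    using magnetization_mono[OF _ UV, of i "Suc t" \<beta> B E] assms(4,5) by simp
  let ?S = "\<lambda>v. if v \<in> gball E i t then spins else {1}"
  have S: "?S (f x) = plus_spins (Suc t - length x)" if x: "x \<in> tree_ball c (Suc t)" for x
  proof -
    have "f x \<in> f ` tree_ball c t \<longleftrightarrow> x \<in> tree_ball c t"
      using bij x by (intro inj_on_image_mem_iff[of f "tree_ball c (Suc t)"]) (auto simp: bij_betw_def tree_ball_def)
    hence "f x \<in> gball E i t \<longleftrightarrow> length x \<le> t"
      using local_iso_image[OF f, of t] x by (simp add: tree_ball_eq_gball[symmetric]) (simp add: tree_ball_def)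
    thus ?thesis by (simp add: plus_spins_def)
  qed
  have "magnetization \<beta> B E ?U ?S i = tanh (plus_field \<beta> B t c)"
    using magnetization_iso[where R = tree_adj and R' = E and S = "\<lambda>x. plus_spins (Suc t - length x)" and S' = ?S,
        OF bij Nil_in_tree_ball adj S]
      magnetization_tree[OF _ tree_Z_plus, of \<beta> B c t] root by (simp add: plus_spins_def spins_def)
  moreover have "magnetization \<beta> B E {..<n} (\<lambda>_. spins) i \<le> magnetization \<beta> B E ?U ?S i"
  proof (rule magnetization_le_plus)
    \<comment> \<open>A neighbour of the inner ball lies in \<open>?U\<close>, so an edge leaving
      \<open>?U\<close> has no end in the inner ball.\<close>
    fix v w assume "E v w" "v \<notin> ?U \<or> w \<notin> ?U"
    thus "v \<notin> gball E i t \<and> w \<notin> gball E i t"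
      using E(1) by (auto simp: simple_graph_on_def)
  qed (use UV[of "Suc t"] assms in auto)
  ultimately show "magnetization \<beta> B E {..<n} (\<lambda>_. spins) i \<le> tanh (plus_field \<beta> B t c)" by simp
qed

section \<open>Expectations of local functionals\<close>

text \<open>Makes the support of \<open>G n\<close> finite, so expectations over graphs become
  finite sums with no integrability questions.\<close>

lemma finite_simple_graphs: "finite {E. simple_graph_on n E}"
proof (rule finite_imageD)
  show "inj_on (\<lambda>E. {(i, j). E i j}) {E. simple_graph_on n E}"
    by (auto simp: inj_on_def fun_eq_iff)
  have "(\<lambda>E. {(i, j). E i j}) ` {E. simple_graph_on n E} \<subseteq> Pow ({..<n} \<times> {..<n})"
    by (auto simp: simple_graph_on_def)
  thus "finite ((\<lambda>E. {(i, j). E i j}) ` {E. simple_graph_on n E})"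
    by (rule finite_subset) simp
qed

lemma space_tree_space [simp]: "space tree_space = UNIV"
  by (simp add: tree_space_def space_PiM)

lemma pred_mem_tree_ball: "Measurable.pred tree_space (\<lambda>c. xs \<in> tree_ball c t)"
proof -
  have [measurable]: "(\<lambda>c. c v) \<in> tree_space \<rightarrow>\<^sub>M count_space UNIV" for v
    unfolding tree_space_def by (rule measurable_component_singleton) simp
  have "Measurable.pred tree_space (\<lambda>c. length xs \<le> t \<and> (\<forall>i\<in>{..<length xs}. xs ! i < c (take i xs)))"
    by measurable
  thus ?thesis by (simp add: tree_ball_def tree_verts_def conj_commute Ball_def)
qed

lemma pred_tree_ball_eq: "Measurable.pred tree_space (\<lambda>c. tree_ball c t = X)"
proof -
  note [measurable] = pred_mem_tree_ball
  have "Measurable.pred tree_space (\<lambda>c. \<forall>xs. (xs \<in> tree_ball c t \<longleftrightarrow> xs \<in> X))"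
    by measurable
  thus ?thesis by (simp add: set_eq_iff)
qed

locale local_weak_limit =
  fixes G :: "nat \<Rightarrow> (nat \<Rightarrow> nat \<Rightarrow> bool) pmf" and \<mu> :: "(nat list \<Rightarrow> nat) measure"
  assumes lwc: "lwc G \<mu>"
begin

sublocale prob_space \<mu>
  using lwc by (simp add: lwc_def)

lemma sets_mu: "sets \<mu> = sets tree_space"
  using lwc by (simp add: lwc_def)

lemma space_mu [simp]: "space \<mu> = UNIV"
  using sets_eq_imp_space_eq[OF sets_mu] by simp

lemma prob_UNIV [simp]: "prob UNIV = 1"
  using prob_space by simp

lemma simple_graph: "E \<in> set_pmf (G n) \<Longrightarrow> simple_graph_on n E"
  using lwc by (auto simp: lwc_def)

lemma finite_support [simp]: "finite (set_pmf (G n))"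
  using finite_subset[OF _ finite_simple_graphs[of n]] simple_graph by auto

lemma expectation_pmf_eq: "measure_pmf.expectation (G n) f = (\<Sum>E\<in>set_pmf (G n). pmf (G n) E * f E)"
  by (subst integral_measure_pmf_real[of "set_pmf (G n)"]) (auto simp: mult.commute)

lemma En_eq: "En G n F = (\<Sum>E\<in>set_pmf (G n). pmf (G n) E * (\<Sum>i<n. F E i)) / real n"
  by (simp add: En_def expectation_pmf_eq)

lemma En_mono: "(\<And>E i. E \<in> set_pmf (G n) \<Longrightarrow> i < n \<Longrightarrow> F E i \<le> F' E i) \<Longrightarrow> En G n F \<le> En G n F'"
  unfolding En_eq by (intro divide_right_mono sum_mono mult_left_mono) auto

lemma En_cong: "(\<And>E i. E \<in> set_pmf (G n) \<Longrightarrow> i < n \<Longrightarrow> F E i = F' E i) \<Longrightarrow> En G n F = En G n F'"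
  by (intro antisym En_mono) auto

lemma En_add: "En G n (\<lambda>E i. F E i + F' E i) = En G n F + En G n F'"
  by (simp add: En_eq sum.distrib distrib_left add_divide_distrib)

lemma En_diff: "En G n (\<lambda>E i. F E i - F' E i) = En G n F - En G n F'"
  by (simp add: En_eq sum_subtractf right_diff_distrib diff_divide_distrib)

lemma En_cmult: "En G n (\<lambda>E i. k * F E i) = k * En G n F"
  by (simp add: En_eq sum_distrib_left[symmetric] mult.left_commute)

lemma En_sum: "En G n (\<lambda>E i. \<Sum>k\<in>A. F k E i) = (\<Sum>k\<in>A. En G n (F k))"
proof (induction A rule: infinite_finite_induct)
  case (insert x A)
  thus ?case by (simp add: En_add)
qed (simp_all add: En_eq)

lemma En_const: "0 < n \<Longrightarrow> En G n (\<lambda>E i. k) = k"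
  by (simp add: En_eq sum_distrib_right[symmetric] sum_pmf_eq_1)

lemma tendsto_En_const: "(\<lambda>n. En G n (\<lambda>E i. k)) \<longlonglongrightarrow> k"
  by (rule tendsto_eventually) (auto intro!: eventually_sequentiallyI[of 1] En_const)

text \<open>\<open>tree_ball c t\<close> ranges over the countable set of finite sets of lists and
  has measurable level sets, so every function of it is measurable.\<close>

lemma measurable_tree_ball_dependent:
  fixes F :: "(nat list \<Rightarrow> nat) \<Rightarrow> real"
  assumes "\<And>c c'. tree_ball c t = tree_ball c' t \<Longrightarrow> F c = F c'"
  shows "F \<in> borel_measurable \<mu>"
proof -
  have "(\<lambda>c. tree_ball c t) \<in> \<mu> \<rightarrow>\<^sub>M count_space {X. finite X}"
  proof (subst measurable_count_space_eq_countable)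
    show "countable {X :: nat list set. finite X}" by (rule countable_Collect_finite)
    have "(\<lambda>c. tree_ball c t) -` {X} \<inter> space \<mu> = {c \<in> space tree_space. tree_ball c t = X}" for X by auto
    thus "(\<lambda>c. tree_ball c t) \<in> space \<mu> \<rightarrow> {X. finite X} \<and>
        (\<forall>X\<in>{X. finite X}. (\<lambda>c. tree_ball c t) -` {X} \<inter> space \<mu> \<in> sets \<mu>)"
      using pred_tree_ball_eq[of t] by (auto simp: sets_mu pred_def)
  qed
  hence "(\<lambda>c. (\<lambda>X. F (SOME c'. tree_ball c' t = X)) (tree_ball c t)) \<in> borel_measurable \<mu>"
    by (rule measurable_compose) simp
  moreover have "F (SOME c'. tree_ball c' t = tree_ball c t) = F c" for c
    by (rule assms) (rule someI[of _ c], rule refl)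
  ultimately show ?thesis by simp
qed

lemma measurable_iso_invariant:
  fixes F :: "(nat list \<Rightarrow> nat) \<Rightarrow> real"
  assumes "\<And>c c'. tree_ball_iso t c c' \<Longrightarrow> F c = F c'"
  shows "F \<in> borel_measurable \<mu>"
  by (rule measurable_tree_ball_dependent[of t]) (blast intro: assms tree_ball_iso_of_eq)

lemma En_fatou:
  fixes F :: "(nat list \<Rightarrow> nat) \<Rightarrow> real"
  assumes nonneg: "\<And>c. 0 \<le> F c" and int: "integrable \<mu> F"
    and inv: "\<And>c c'. tree_ball_iso t c c' \<Longrightarrow> F c = F c'"
    and Fn_nonneg: "\<And>n E i. E \<in> set_pmf (G n) \<Longrightarrow> i < n \<Longrightarrow> 0 \<le> Fn n E i"
    and Fn: "\<And>n E i c. E \<in> set_pmf (G n) \<Longrightarrow> i < n \<Longrightarrow> ball_iso_tree E i t c \<Longrightarrow> F c \<le> Fn n E i"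
    and \<epsilon>: "0 < \<epsilon>"
  shows "\<forall>\<^sub>F n in sequentially. integral\<^sup>L \<mu> F - \<epsilon> < En G n (Fn n)"
proof -
  \<comment> \<open>Isomorphic trees define the same predicate, so \<open>SOME\<close> picks the
    same representative for a whole class.\<close>
  define rep where "rep c = (SOME c'. tree_ball_iso t c c')" for c
  have iso_rep: "tree_ball_iso t c (rep c)" for c
    unfolding rep_def by (rule someI[of _ c]) (rule tree_ball_iso_refl)
  have rep_eq: "rep c = rep d" if "tree_ball_iso t c d" for c d
  proof -
    have "tree_ball_iso t c = tree_ball_iso t d"
      using tree_ball_iso_trans[OF that] tree_ball_iso_trans[OF tree_ball_iso_sym[OF that]]
      by (intro ext iffI)
    thus ?thesis by (simp add: rep_def)
  qed
  define Q where "Q = range rep"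
  have rep_Q: "rep k = k" if "k \<in> Q" for k
    using that rep_eq[OF iso_rep] unfolding Q_def by force
  have rep_iff: "rep c = k \<longleftrightarrow> tree_ball_iso t c k" if "k \<in> Q" for c k
    using rep_eq[of c k] rep_Q[OF that] iso_rep[of c] by auto
  have "Q \<subseteq> (\<lambda>X. rep (SOME c. tree_ball c t = X)) ` {X. finite X}"
  proof
    fix k assume "k \<in> Q"
    then obtain c where c: "k = rep c" by (auto simp: Q_def)
    have "tree_ball (SOME c'. tree_ball c' t = tree_ball c t) t = tree_ball c t"
      by (rule someI[of _ c]) (rule refl)
    hence "rep (SOME c'. tree_ball c' t = tree_ball c t) = k"
      unfolding c by (intro rep_eq tree_ball_iso_of_eq)
    thus "k \<in> (\<lambda>X. rep (SOME c. tree_ball c t = X)) ` {X. finite X}"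
      by (intro image_eqI[of _ _ "tree_ball c t"]) auto
  qed
  hence countable_Q: "countable Q"
    using countable_Collect_finite countable_image countable_subset by blast
  have Q_ne: "Q \<noteq> {}" by (auto simp: Q_def)
  define A where "A m = from_nat_into Q ` {..<m}" for m :: nat
  have A_Q: "A m \<subseteq> Q" for m using from_nat_into[OF Q_ne] by (auto simp: A_def)
  have [measurable]: "(\<lambda>c. of_bool (rep c \<in> A m) :: real) \<in> borel_measurable \<mu>" for m
    by (rule measurable_iso_invariant[of t]) (auto dest: rep_eq)
  have [measurable]: "F \<in> borel_measurable \<mu>" using int by simp
  have "(\<lambda>m. \<integral>c. F c * of_bool (rep c \<in> A m) \<partial>\<mu>) \<longlonglongrightarrow> integral\<^sup>L \<mu> F"
  proof (rule integral_dominated_convergence[OF _ _ int])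
    show "AE c in \<mu>. (\<lambda>m. F c * of_bool (rep c \<in> A m)) \<longlonglongrightarrow> F c"
    proof (rule AE_I2)
      fix c
      have "rep c \<in> Q" by (simp add: Q_def)
      then obtain m where m: "rep c = from_nat_into Q m"
        using from_nat_into_surj[OF countable_Q] by metis
      hence "rep c \<in> A m'" if "Suc m \<le> m'" for m' using that by (auto simp: A_def)
      thus "(\<lambda>m. F c * of_bool (rep c \<in> A m)) \<longlonglongrightarrow> F c"
        by (intro tendsto_eventually eventually_sequentiallyI[of "Suc m"]) simp
    qed
  qed (use nonneg in auto)
  hence "\<forall>\<^sub>F m in sequentially. integral\<^sup>L \<mu> F - \<epsilon> / 2 < (\<integral>c. F c * of_bool (rep c \<in> A m) \<partial>\<mu>)"
    using \<epsilon> by (intro order_tendstoD) auto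
  then obtain m where m: "integral\<^sup>L \<mu> F - \<epsilon> / 2 < (\<integral>c. F c * of_bool (rep c \<in> A m) \<partial>\<mu>)"
    by (auto simp: eventually_sequentially)
  have finA: "finite (A m)" by (simp add: A_def)
  define p where "p k = measure \<mu> {c \<in> space \<mu>. tree_ball_iso t c k}" for k
  have "(\<integral>c. F c * of_bool (rep c \<in> A m) \<partial>\<mu>) = (\<integral>c. (\<Sum>k\<in>A m. F k * indicator {c. tree_ball_iso t c k} c) \<partial>\<mu>)"
  proof (rule Bochner_Integration.integral_cong[OF refl])
    fix c
    have "(\<Sum>k\<in>A m. F k * indicator {c. tree_ball_iso t c k} c) = (\<Sum>k\<in>A m. if k = rep c then F c else 0)"
    proof (rule sum.cong[OF refl])
      fix k assume "k \<in> A m"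
      hence "rep c = k \<longleftrightarrow> tree_ball_iso t c k" using A_Q rep_iff by blast
      thus "F k * indicator {c. tree_ball_iso t c k} c = (if k = rep c then F c else 0)"
        using inv[of c k] by auto
    qed
    thus "F c * of_bool (rep c \<in> A m) = (\<Sum>k\<in>A m. F k * indicator {c. tree_ball_iso t c k} c)"
      using finA by simp
  qed
  also have "\<dots> = (\<Sum>k\<in>A m. F k * p k)"
  proof -
    have [measurable]: "{c. tree_ball_iso t c k} \<in> sets \<mu>" for k
    proof -
      have "(\<lambda>c. of_bool (tree_ball_iso t c k) :: real) \<in> borel_measurable \<mu>"
        by (rule measurable_iso_invariant[of t]) (auto intro: tree_ball_iso_sym tree_ball_iso_trans)
      hence "{c \<in> space \<mu>. (of_bool (tree_ball_iso t c k) :: real) = 1} \<in> sets \<mu>" by measurable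
      thus ?thesis by simp
    qed
    show ?thesis by (subst Bochner_Integration.integral_sum) (auto simp: p_def emeasure_eq_measure intro!: integrable_mult_right)
  qed
  finally have lim: "integral\<^sup>L \<mu> F - \<epsilon> / 2 < (\<Sum>k\<in>A m. F k * p k)" using m by simp
  have "(\<lambda>n. \<Sum>k\<in>A m. F k * En G n (\<lambda>E i. of_bool (ball_iso_tree E i t k))) \<longlonglongrightarrow> (\<Sum>k\<in>A m. F k * p k)"
    using lwc by (intro tendsto_intros) (auto simp: lwc_def p_def)
  hence "\<forall>\<^sub>F n in sequentially. (\<Sum>k\<in>A m. F k * p k) - \<epsilon> / 2 < (\<Sum>k\<in>A m. F k * En G n (\<lambda>E i. of_bool (ball_iso_tree E i t k)))"
    using \<epsilon> by (intro order_tendstoD) auto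
  thus ?thesis
  proof eventually_elim
    case (elim n)
    have "(\<Sum>k\<in>A m. F k * En G n (\<lambda>E i. of_bool (ball_iso_tree E i t k))) =
        En G n (\<lambda>E i. \<Sum>k\<in>A m. F k * of_bool (ball_iso_tree E i t k))"
      by (simp add: En_sum En_cmult)
    also have "\<dots> \<le> En G n (Fn n)"
    proof (rule En_mono)
      fix E i assume Ei: "E \<in> set_pmf (G n)" "i < n"
      show "(\<Sum>k\<in>A m. F k * of_bool (ball_iso_tree E i t k)) \<le> Fn n E i"
      proof (cases "\<exists>k\<in>A m. ball_iso_tree E i t k")
        case True
        then obtain k where k: "k \<in> A m" "ball_iso_tree E i t k" by blast
        \<comment> \<open>At most one class of \<open>A m\<close> fits a given vertex, so the sum
          over classes reduces to a single term.\<close>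
        have uniq: "k' = k" if "k' \<in> A m" "ball_iso_tree E i t k'" for k'
        proof -
          have "k' \<in> Q" "k \<in> Q" using that(1) k(1) A_Q by blast+
          thus ?thesis using rep_eq[OF ball_iso_tree_unique[OF that(2) k(2)]] rep_Q by simp
        qed
        have "(\<Sum>k\<in>A m. F k * of_bool (ball_iso_tree E i t k)) = (\<Sum>k'\<in>A m. if k' = k then F k else 0)"
        proof (rule sum.cong[OF refl])
          fix k' assume "k' \<in> A m"
          thus "F k' * of_bool (ball_iso_tree E i t k') = (if k' = k then F k else 0)"
            using uniq[of k'] k(2) by (cases "k' = k") auto
        qed
        also have "\<dots> = F k" using k finA by simp
        finally show ?thesis using Fn[OF Ei k(2)] by simp
      next
        case False
        hence "(\<Sum>k\<in>A m. F k * of_bool (ball_iso_tree E i t k)) = 0" by (intro sum.neutral) auto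
        thus ?thesis using Fn_nonneg[OF Ei] by simp
      qed
    qed
    finally show ?case using elim lim by simp
  qed
qed

text \<open>The Fatou bound applied to Dn + Fn and to Dn - Fn, with convergence of the mean of Dn,
  bounds the mean of Fn from both sides. On vertices whose ball is not a tree only the domination is
  used.\<close>

lemma En_tendsto_dominated:
  fixes F D :: "(nat list \<Rightarrow> nat) \<Rightarrow> real"
  assumes D: "integrable \<mu> D" "(\<lambda>n. En G n (Dn n)) \<longlonglongrightarrow> integral\<^sup>L \<mu> D"
    and D_inv: "\<And>c c'. tree_ball_iso t c c' \<Longrightarrow> D c = D c'"
    and Dn: "\<And>n E i c. E \<in> set_pmf (G n) \<Longrightarrow> i < n \<Longrightarrow> ball_iso_tree E i t c \<Longrightarrow> Dn n E i = D c"
    and F_le: "\<And>c. \<bar>F c\<bar> \<le> D c"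
    and Fn_le: "\<And>n E i. E \<in> set_pmf (G n) \<Longrightarrow> i < n \<Longrightarrow> \<bar>Fn n E i\<bar> \<le> Dn n E i"
    and inv: "\<And>c c'. tree_ball_iso t c c' \<Longrightarrow> F c = F c'"
    and Fn: "\<And>n E i c. E \<in> set_pmf (G n) \<Longrightarrow> i < n \<Longrightarrow> ball_iso_tree E i t c \<Longrightarrow> Fn n E i = F c"
  shows "integrable \<mu> F" "(\<lambda>n. En G n (Fn n)) \<longlonglongrightarrow> integral\<^sup>L \<mu> F"
proof -
  have [measurable]: "F \<in> borel_measurable \<mu>" by (rule measurable_iso_invariant[OF inv])
  show int: "integrable \<mu> F"
  proof (rule Bochner_Integration.integrable_bound[OF D(1)])
    have "norm (F c) \<le> norm (D c)" for c using F_le[of c] by simp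
    thus "AE c in \<mu>. norm (F c) \<le> norm (D c)" by simp
  qed simp
  show "(\<lambda>n. En G n (Fn n)) \<longlonglongrightarrow> integral\<^sup>L \<mu> F"
  proof (rule tendstoI)
    fix \<epsilon> :: real assume \<epsilon>: "0 < \<epsilon>"
    have e2: "0 < \<epsilon> / 2" using \<epsilon> by simp
    have nn: "0 \<le> D c + F c" "0 \<le> D c - F c" for c using F_le[of c] by linarith+
    have nn': "0 \<le> Dn n E i + Fn n E i" "0 \<le> Dn n E i - Fn n E i" if "E \<in> set_pmf (G n)" "i < n" for n E i
      using Fn_le[OF that] by linarith+
    have inv': "D c + F c = D c' + F c'" "D c - F c = D c' - F c'" if "tree_ball_iso t c c'" for c c'
      using D_inv[OF that] inv[OF that] by auto
    have le: "D c + F c \<le> Dn n E i + Fn n E i" "D c - F c \<le> Dn n E i - Fn n E i"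
      if "E \<in> set_pmf (G n)" "i < n" "ball_iso_tree E i t c" for n E i c
      using Dn[OF that] Fn[OF that] by auto
    have "\<forall>\<^sub>F n in sequentially. (\<integral>c. D c + F c \<partial>\<mu>) - \<epsilon> / 2 < En G n (\<lambda>E i. Dn n E i + Fn n E i)"
      by (rule En_fatou[where t = t]) (use nn nn' inv' le e2 D(1) int in auto)
    moreover have "\<forall>\<^sub>F n in sequentially. (\<integral>c. D c - F c \<partial>\<mu>) - \<epsilon> / 2 < En G n (\<lambda>E i. Dn n E i - Fn n E i)"
      by (rule En_fatou[where t = t]) (use nn nn' inv' le e2 D(1) int in auto)
    moreover have "\<forall>\<^sub>F n in sequentially. dist (En G n (Dn n)) (integral\<^sup>L \<mu> D) < \<epsilon> / 2"
      using D(2) e2 by (rule tendstoD)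
    ultimately show "\<forall>\<^sub>F n in sequentially. dist (En G n (Fn n)) (integral\<^sup>L \<mu> F) < \<epsilon>"
    proof eventually_elim
      case (elim n)
      thus ?case
        unfolding En_add En_diff dist_real_def Bochner_Integration.integral_add[OF D(1) int]
          Bochner_Integration.integral_diff[OF D(1) int] by linarith
    qed
  qed
qed

lemma En_tendsto_bounded:
  fixes F :: "(nat list \<Rightarrow> nat) \<Rightarrow> real"
  assumes "\<And>c. \<bar>F c\<bar> \<le> K"
    and "\<And>n E i. E \<in> set_pmf (G n) \<Longrightarrow> i < n \<Longrightarrow> \<bar>Fn n E i\<bar> \<le> K"
    and "\<And>c c'. tree_ball_iso t c c' \<Longrightarrow> F c = F c'"
    and "\<And>n E i c. E \<in> set_pmf (G n) \<Longrightarrow> i < n \<Longrightarrow> ball_iso_tree E i t c \<Longrightarrow> Fn n E i = F c"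
  shows "integrable \<mu> F" "(\<lambda>n. En G n (Fn n)) \<longlonglongrightarrow> integral\<^sup>L \<mu> F"
  using En_tendsto_dominated[where D = "\<lambda>_. K" and Dn = "\<lambda>_ _ _. K" and F = F and Fn = Fn and t = t]
    tendsto_En_const[of K] assms by simp_all

section \<open>Degree moments and uniform sparsity\<close>

abbreviation root_deg :: "(nat list \<Rightarrow> nat) \<Rightarrow> real" where
  "root_deg c \<equiv> real (c [])"

lemma sparse_tail:
  assumes "0 < \<epsilon>"
  shows "\<forall>\<^sub>F L in sequentially. \<forall>\<^sub>F n in sequentially.
     En G n (\<lambda>E i. real (deg E i) * of_bool (deg E i \<ge> L)) < \<epsilon>"
proof -
  have "\<forall>\<^sub>F L in sequentially. limsup (\<lambda>n. ereal (En G n (\<lambda>E i. real (deg E i) * of_bool (deg E i \<ge> L)))) < ereal \<epsilon>"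
    using lwc assms unfolding lwc_def uniformly_sparse_def by (intro order_tendstoD) auto
  thus ?thesis
    by eventually_elim (auto dest!: Limsup_lessD elim: eventually_mono)
qed

lemma root_deg_truncated:
  "integrable \<mu> (\<lambda>c. root_deg c * of_bool (c [] < L))"
  "(\<lambda>n. En G n (\<lambda>E i. real (deg E i) * of_bool (deg E i < L))) \<longlonglongrightarrow> (\<integral>c. root_deg c * of_bool (c [] < L) \<partial>\<mu>)"
proof -
  have 1: "\<bar>real m * of_bool (m < L)\<bar> \<le> real L" for m :: nat by simp
  note * = En_tendsto_bounded[where F = "\<lambda>c. root_deg c * of_bool (c [] < L)" and K = "real L" and t = 1
      and Fn = "\<lambda>_ E i. real (deg E i) * of_bool (deg E i < L)"]
  show "integrable \<mu> (\<lambda>c. root_deg c * of_bool (c [] < L))"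
    by (rule *) (use 1 in \<open>auto dest: root_degree_tree_ball_iso deg_ball_iso_tree\<close>)
  show "(\<lambda>n. En G n (\<lambda>E i. real (deg E i) * of_bool (deg E i < L))) \<longlonglongrightarrow> (\<integral>c. root_deg c * of_bool (c [] < L) \<partial>\<mu>)"
    by (rule *) (use 1 in \<open>auto dest: root_degree_tree_ball_iso deg_ball_iso_tree\<close>)
qed

lemma En_deg_split:
  "En G n (\<lambda>E i. real (deg E i)) = En G n (\<lambda>E i. real (deg E i) * of_bool (deg E i < L)) +
     En G n (\<lambda>E i. real (deg E i) * of_bool (deg E i \<ge> L))"
  unfolding En_add[symmetric] by (rule En_cong) auto

text \<open>Sparsity with tolerance 1 bounds the mean degree of the graphs by \<open>L0 + 1\<close>
  for large \<open>n\<close>; the truncated means of the limit inherit the bound, and monotone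
  convergence removes the truncation.\<close>

lemma integrable_root_deg:
  "integrable \<mu> root_deg"
  "(\<lambda>L. \<integral>c. root_deg c * of_bool (c [] < L) \<partial>\<mu>) \<longlonglongrightarrow> integral\<^sup>L \<mu> root_deg"
proof -
  let ?I = "\<lambda>L. \<integral>c. root_deg c * of_bool (c [] < L) \<partial>\<mu>"
  obtain L0 where L0: "\<forall>\<^sub>F n in sequentially. En G n (\<lambda>E i. real (deg E i) * of_bool (deg E i \<ge> L0)) < 1"
    using eventually_happens'[OF sequentially_bot sparse_tail[of 1]] by auto
  have bound: "?I L \<le> real L0 + 1" for L
  proof (rule LIMSEQ_le_const2[OF root_deg_truncated(2)])
    have "\<forall>\<^sub>F n in sequentially. 0 < n" by (rule eventually_gt_at_top)
    with L0 have "\<forall>\<^sub>F n in sequentially. En G n (\<lambda>E i. real (deg E i) * of_bool (deg E i < L)) \<le> real L0 + 1"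
    proof eventually_elim
      case (elim n)
      have "En G n (\<lambda>E i. real (deg E i) * of_bool (deg E i < L)) \<le> En G n (\<lambda>E i. real (deg E i))"
        by (rule En_mono) simp
      moreover have "En G n (\<lambda>E i. real (deg E i) * of_bool (deg E i < L0)) \<le> En G n (\<lambda>E i. real L0)"
        by (rule En_mono) simp
      ultimately show ?case using elim En_const[of n "real L0"] En_deg_split[of n L0] by simp
    qed
    thus "\<exists>N. \<forall>n\<ge>N. En G n (\<lambda>E i. real (deg E i) * of_bool (deg E i < L)) \<le> real L0 + 1"
      by (simp add: eventually_sequentially)
  qed
  have "incseq ?I"
    by (rule incseq_SucI) (intro integral_mono root_deg_truncated, auto)
  then obtain l where l: "?I \<longlonglongrightarrow> l" by (rule incseq_convergent[of ?I]) (use bound in auto)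
  have mono: "AE c in \<mu>. mono (\<lambda>L. root_deg c * of_bool (c [] < L))" by (auto simp: mono_def)
  have lim: "AE c in \<mu>. (\<lambda>L. root_deg c * of_bool (c [] < L)) \<longlonglongrightarrow> root_deg c"
  proof (rule AE_I2)
    fix c :: "nat list \<Rightarrow> nat"
    show "(\<lambda>L. root_deg c * of_bool (c [] < L)) \<longlonglongrightarrow> root_deg c"
      by (intro tendsto_eventually eventually_sequentiallyI[of "Suc (c [])"]) simp
  qed
  have meas: "root_deg \<in> borel_measurable \<mu>"
    by (rule measurable_iso_invariant[of 1]) (auto dest: root_degree_tree_ball_iso)
  show "integrable \<mu> root_deg"
    by (rule integrable_monotone_convergence[OF root_deg_truncated(1) mono lim l meas])
  have "integral\<^sup>L \<mu> root_deg = l"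
    by (rule integral_monotone_convergence[OF root_deg_truncated(1) mono lim l meas])
  thus "?I \<longlonglongrightarrow> integral\<^sup>L \<mu> root_deg" using l by simp
qed

text \<open>The error splits into the truncation in the limit, the convergence of the truncated
  mean, and the tail on the graphs, which sparsity controls; hence \<epsilon> / 3.\<close>

lemma En_deg_tendsto: "(\<lambda>n. En G n (\<lambda>E i. real (deg E i))) \<longlonglongrightarrow> integral\<^sup>L \<mu> root_deg"
proof (rule tendstoI)
  let ?I = "\<lambda>L. \<integral>c. root_deg c * of_bool (c [] < L) \<partial>\<mu>"
  fix \<epsilon> :: real assume "0 < \<epsilon>"
  hence e: "0 < \<epsilon> / 3" by simp
  have "\<forall>\<^sub>F L in sequentially. dist (?I L) (integral\<^sup>L \<mu> root_deg) < \<epsilon> / 3"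
    by (rule tendstoD[OF integrable_root_deg(2) e])
  hence "\<forall>\<^sub>F L in sequentially. dist (?I L) (integral\<^sup>L \<mu> root_deg) < \<epsilon> / 3 \<and>
      (\<forall>\<^sub>F n in sequentially. En G n (\<lambda>E i. real (deg E i) * of_bool (deg E i \<ge> L)) < \<epsilon> / 3)"
    by (rule eventually_conj[OF _ sparse_tail[OF e]])
  then obtain L where L: "dist (?I L) (integral\<^sup>L \<mu> root_deg) < \<epsilon> / 3"
    "\<forall>\<^sub>F n in sequentially. En G n (\<lambda>E i. real (deg E i) * of_bool (deg E i \<ge> L)) < \<epsilon> / 3"
    using eventually_happens'[OF sequentially_bot] by blast
  have "\<forall>\<^sub>F n in sequentially. dist (En G n (\<lambda>E i. real (deg E i) * of_bool (deg E i < L))) (?I L) < \<epsilon> / 3"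
    by (rule tendstoD[OF root_deg_truncated(2) e])
  with L(2) show "\<forall>\<^sub>F n in sequentially. dist (En G n (\<lambda>E i. real (deg E i))) (integral\<^sup>L \<mu> root_deg) < \<epsilon>"
  proof eventually_elim
    case (elim n)
    have "En G n (\<lambda>E i. 0) \<le> En G n (\<lambda>E i. real (deg E i) * of_bool (deg E i \<ge> L))"
      by (rule En_mono) simp
    hence "0 \<le> En G n (\<lambda>E i. real (deg E i) * of_bool (deg E i \<ge> L))" by (simp add: En_eq)
    thus ?case using elim L(1) En_deg_split[of n L] unfolding dist_real_def by linarith
  qed
qed

text \<open>\<open>K\<close> times the degree serves as dominating function; it is read off from the
  ball of radius 1, hence \<open>1 \<le> t\<close>.\<close>

lemma En_tendsto_linear_growth:
  fixes F :: "(nat list \<Rightarrow> nat) \<Rightarrow> real"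
  assumes "\<And>c. \<bar>F c\<bar> \<le> K * root_deg c"
    and "\<And>n E i. E \<in> set_pmf (G n) \<Longrightarrow> i < n \<Longrightarrow> \<bar>Fn n E i\<bar> \<le> K * real (deg E i)"
    and "\<And>c c'. tree_ball_iso t c c' \<Longrightarrow> F c = F c'"
    and "\<And>n E i c. E \<in> set_pmf (G n) \<Longrightarrow> i < n \<Longrightarrow> ball_iso_tree E i t c \<Longrightarrow> Fn n E i = F c"
    and t: "1 \<le> t"
  shows "integrable \<mu> F" "(\<lambda>n. En G n (Fn n)) \<longlonglongrightarrow> integral\<^sup>L \<mu> F"
proof -
  have D: "integrable \<mu> (\<lambda>c. K * root_deg c)"
    "(\<lambda>n. En G n (\<lambda>E i. K * real (deg E i))) \<longlonglongrightarrow> (\<integral>c. K * root_deg c \<partial>\<mu>)"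
    using integrable_mult_right[OF integrable_root_deg(1), of K] tendsto_mult_left[OF En_deg_tendsto, of K]
    unfolding En_cmult by simp_all
  note * = En_tendsto_dominated[where D = "\<lambda>c. K * root_deg c" and Dn = "\<lambda>_ E i. K * real (deg E i)"
      and F = F and Fn = Fn and t = t, OF D]
  show "integrable \<mu> F"
    by (rule *) (use assms root_degree_tree_ball_iso[OF _ t] deg_ball_iso_tree[OF _ t] in auto)
  show "(\<lambda>n. En G n (Fn n)) \<longlonglongrightarrow> integral\<^sup>L \<mu> F"
    by (rule *) (use assms root_degree_tree_ball_iso[OF _ t] deg_ball_iso_tree[OF _ t] in auto)
qed

end

section \<open>Mass transport for the limiting messages\<close>

lemma abs_sum_le_card:
  fixes f :: "nat \<Rightarrow> real"
  assumes "\<And>j. \<bar>f j\<bar> \<le> K"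
  shows "\<bar>\<Sum>j\<in>A. f j\<bar> \<le> K * real (card A)"
proof -
  have "\<bar>\<Sum>j\<in>A. f j\<bar> \<le> (\<Sum>j\<in>A. \<bar>f j\<bar>)" by (rule sum_abs)
  also have "\<dots> \<le> real (card A) * K" by (rule sum_bounded_above) (rule assms)
  finally show ?thesis by (simp add: mult.commute)
qed

definition lim_edge_sum :: "real \<Rightarrow> real \<Rightarrow> real \<Rightarrow> edge_fun \<Rightarrow> (nat list \<Rightarrow> nat) \<Rightarrow> real" where
  "lim_edge_sum \<beta> B B' g c = (\<Sum>i<c [].
     g (lim_field \<beta> B (subtree c i)) (lim_field \<beta> B (remove_child c i))
       (lim_field \<beta> B' (subtree c i)) (lim_field \<beta> B' (remove_child c i)))"

definition bounded_cont_edge_fun :: "edge_fun \<Rightarrow> real \<Rightarrow> bool" where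
  "bounded_cont_edge_fun g K \<longleftrightarrow> (\<forall>x y x' y'. \<bar>g x y x' y'\<bar> \<le> K) \<and>
     (\<forall>X Y X' Y' x y x' y'. X \<longlonglongrightarrow> x \<longrightarrow> Y \<longlonglongrightarrow> y \<longrightarrow> X' \<longlonglongrightarrow> x' \<longrightarrow> Y' \<longlonglongrightarrow> y' \<longrightarrow>
        (\<lambda>n. g (X n) (Y n) (X' n) (Y' n)) \<longlonglongrightarrow> g x y x' y')"

lemma bounded_cont_edge_fun_tendsto:
  assumes "bounded_cont_edge_fun g K" "X \<longlonglongrightarrow> x" "Y \<longlonglongrightarrow> y" "X' \<longlonglongrightarrow> x'" "Y' \<longlonglongrightarrow> y'"
  shows "(\<lambda>n. g (X n) (Y n) (X' n) (Y' n)) \<longlonglongrightarrow> g x y x' y'"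
  using assms by (simp add: bounded_cont_edge_fun_def)

abbreviation (input) swap_edge_fun :: "edge_fun \<Rightarrow> edge_fun" where
  "swap_edge_fun g \<equiv> (\<lambda>x y x' y'. g y x y' x')"

lemma bounded_cont_swap: "bounded_cont_edge_fun g K \<Longrightarrow> bounded_cont_edge_fun (swap_edge_fun g) K"
  by (simp add: bounded_cont_edge_fun_def)

context local_weak_limit
begin

text \<open>Reversing every directed edge permutes the double sum and exchanges incoming with
  outgoing messages.\<close>

lemma En_edge_sum_swap:
  "En G n (\<lambda>E i. edge_sum \<beta> B B' g t E i) = En G n (\<lambda>E i. edge_sum \<beta> B B' (swap_edge_fun g) t E i)"
proof -
  have "(\<Sum>i<n. edge_sum \<beta> B B' g t E i) = (\<Sum>i<n. edge_sum \<beta> B B' (swap_edge_fun g) t E i)"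
    if E: "simple_graph_on n E" for E
  proof -
    let ?f = "\<lambda>i j. g (graph_msg \<beta> B E t j i) (graph_msg \<beta> B E t i j) (graph_msg \<beta> B' E t j i) (graph_msg \<beta> B' E t i j)"
    have *: "(\<Sum>j\<in>{j. E i j}. f j) = (\<Sum>j<n. if E i j then f j else 0)" for i and f :: "nat \<Rightarrow> real"
      using E by (intro sum.mono_neutral_cong_left) (auto simp: simple_graph_on_def)
    have "(\<Sum>i<n. edge_sum \<beta> B B' g t E i) = (\<Sum>i<n. \<Sum>j<n. if E i j then ?f i j else 0)"
      by (simp add: edge_sum_def *)
    also have "\<dots> = (\<Sum>i<n. \<Sum>j<n. if E j i then ?f j i else 0)" by (rule sum.swap)
    also have "\<dots> = (\<Sum>i<n. \<Sum>j<n. if E i j then ?f j i else 0)"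
      using E by (intro sum.cong refl) (auto simp: simple_graph_on_def)
    also have "\<dots> = (\<Sum>i<n. edge_sum \<beta> B B' (swap_edge_fun g) t E i)"
      by (simp add: edge_sum_def *)
    finally show ?thesis .
  qed
  thus ?thesis unfolding En_eq using simple_graph by (simp cong: sum.cong)
qed

lemma edge_sum_limit:
  assumes "\<And>x y x' y'. \<bar>g x y x' y'\<bar> \<le> K"
  shows "integrable \<mu> (\<lambda>c. edge_sum \<beta> B B' g t (tadj c) [])"
    "(\<lambda>n. En G n (\<lambda>E i. edge_sum \<beta> B B' g t E i)) \<longlonglongrightarrow> (\<integral>c. edge_sum \<beta> B B' g t (tadj c) [] \<partial>\<mu>)"
proof -
  have tree: "\<bar>edge_sum \<beta> B B' g t (tadj c) []\<bar> \<le> K * root_deg c" for c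
    unfolding edge_sum_tree using abs_sum_le_card[of _ K "{..<c []}"] assms by simp
  have graph: "\<bar>edge_sum \<beta> B B' g t E i\<bar> \<le> K * real (deg E i)" for E i
    unfolding edge_sum_def deg_def by (intro abs_sum_le_card assms)
  have inv: "edge_sum \<beta> B B' g t (tadj c) [] = edge_sum \<beta> B B' g t (tadj c') []" if "tree_ball_iso (Suc t) c c'" for c c'
    using that edge_sum_local_iso unfolding tree_ball_iso_iff by metis
  have loc: "edge_sum \<beta> B B' g t E i = edge_sum \<beta> B B' g t (tadj c) []" if "ball_iso_tree E i (Suc t) c" for E i c
    using that edge_sum_local_iso unfolding ball_iso_tree_iff by metis
  note * = En_tendsto_linear_growth[where F = "\<lambda>c. edge_sum \<beta> B B' g t (tadj c) []" and K = K and t = "Suc t"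
      and Fn = "\<lambda>_ E i. edge_sum \<beta> B B' g t E i"]
  show "integrable \<mu> (\<lambda>c. edge_sum \<beta> B B' g t (tadj c) [])"
    by (rule *) (use tree graph inv loc in auto)
  show "(\<lambda>n. En G n (\<lambda>E i. edge_sum \<beta> B B' g t E i)) \<longlonglongrightarrow> (\<integral>c. edge_sum \<beta> B B' g t (tadj c) [] \<partial>\<mu>)"
    by (rule *) (use tree graph inv loc in auto)
qed

text \<open>Here \<open>t\<close> tends to infinity under the limit law, dominated by
  \<open>K\<close> times the degree; the limit in \<open>n\<close> is taken at fixed
  \<open>t\<close> in \<open>edge_sum_limit\<close>.\<close>

lemma lim_edge_sum_limit:
  assumes "0 \<le> \<beta>" "0 \<le> B" "0 \<le> B'" and g: "bounded_cont_edge_fun g K"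
  shows "integrable \<mu> (lim_edge_sum \<beta> B B' g)"
    "(\<lambda>t. \<integral>c. edge_sum \<beta> B B' g t (tadj c) [] \<partial>\<mu>) \<longlonglongrightarrow> integral\<^sup>L \<mu> (lim_edge_sum \<beta> B B' g)"
proof -
  have gK: "\<bar>g x y x' y'\<bar> \<le> K" for x y x' y' using g by (simp add: bounded_cont_edge_fun_def)
  have lim: "(\<lambda>t. edge_sum \<beta> B B' g t (tadj c) []) \<longlonglongrightarrow> lim_edge_sum \<beta> B B' g c" for c
    unfolding edge_sum_tree lim_edge_sum_def
    by (intro tendsto_sum bounded_cont_edge_fun_tendsto[OF g] free_field_tendsto assms)
  have meas [measurable]: "(\<lambda>c. edge_sum \<beta> B B' g t (tadj c) []) \<in> borel_measurable \<mu>" for t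
    using edge_sum_limit(1)[OF gK] by simp
  have meas' [measurable]: "lim_edge_sum \<beta> B B' g \<in> borel_measurable \<mu>"
    by (rule borel_measurable_LIMSEQ_real[OF lim]) measurable
  have K: "integrable \<mu> (\<lambda>c. K * root_deg c)"
    by (intro integrable_mult_right integrable_root_deg)
  have bound: "\<bar>edge_sum \<beta> B B' g t (tadj c) []\<bar> \<le> K * root_deg c" for t c
    unfolding edge_sum_tree using abs_sum_le_card[of _ K "{..<c []}"] gK by simp
  have dom: "AE c in \<mu>. (\<lambda>t. edge_sum \<beta> B B' g t (tadj c) []) \<longlonglongrightarrow> lim_edge_sum \<beta> B B' g c"
    "\<And>t. AE c in \<mu>. norm (edge_sum \<beta> B B' g t (tadj c) []) \<le> K * root_deg c"
    using lim bound by auto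
  show "integrable \<mu> (lim_edge_sum \<beta> B B' g)"
    by (rule integrable_dominated_convergence[OF meas' meas K dom])
  show "(\<lambda>t. \<integral>c. edge_sum \<beta> B B' g t (tadj c) [] \<partial>\<mu>) \<longlonglongrightarrow> integral\<^sup>L \<mu> (lim_edge_sum \<beta> B B' g)"
    by (rule integral_dominated_convergence[OF meas' meas K dom])
qed

text \<open>The only consequence of unimodularity that is needed; it is inherited from the trivial
  double counting over directed edges of the finite graphs.\<close>

lemma mass_transport:
  assumes "0 \<le> \<beta>" "0 \<le> B" "0 \<le> B'" and g: "bounded_cont_edge_fun g K"
  shows "integral\<^sup>L \<mu> (lim_edge_sum \<beta> B B' g) = integral\<^sup>L \<mu> (lim_edge_sum \<beta> B B' (swap_edge_fun g))"
proof (rule LIMSEQ_unique[OF lim_edge_sum_limit(2)[OF assms]])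
  have gK: "\<bar>g x y x' y'\<bar> \<le> K" for x y x' y' using g by (simp add: bounded_cont_edge_fun_def)
  have "(\<integral>c. edge_sum \<beta> B B' g t (tadj c) [] \<partial>\<mu>) = (\<integral>c. edge_sum \<beta> B B' (swap_edge_fun g) t (tadj c) [] \<partial>\<mu>)" for t
  proof (rule LIMSEQ_unique[OF edge_sum_limit(2)[OF gK]])
    show "(\<lambda>n. En G n (\<lambda>E i. edge_sum \<beta> B B' g t E i)) \<longlonglongrightarrow>
        (\<integral>c. edge_sum \<beta> B B' (swap_edge_fun g) t (tadj c) [] \<partial>\<mu>)"
      unfolding En_edge_sum_swap[of _ \<beta> B B' g t] by (rule edge_sum_limit(2)) (rule gK)
  qed
  thus "(\<lambda>t. \<integral>c. edge_sum \<beta> B B' g t (tadj c) [] \<partial>\<mu>) \<longlonglongrightarrow>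
      integral\<^sup>L \<mu> (lim_edge_sum \<beta> B B' (swap_edge_fun g))"
    using lim_edge_sum_limit(2)[OF assms(1-3) bounded_cont_swap[OF g]] by simp
qed

lemma measurable_lim_field [measurable]:
  assumes "0 \<le> \<beta>" "0 \<le> B"
  shows "lim_field \<beta> B \<in> borel_measurable \<mu>"
proof (rule borel_measurable_LIMSEQ_real[OF free_field_tendsto[OF assms]])
  show "free_field \<beta> B t \<in> borel_measurable \<mu>" for t
    by (rule measurable_iso_invariant[of t]) (rule free_field_tree_ball_iso)
qed

end

section \<open>Expansion of the edge terms\<close>

text \<open>With messages written by their magnetizations, \<open>vlog\<close> of a product is the
  log of the edge term of the Bethe functional, and \<open>vlog\<close> at x and -x are the logs of
  the vertex factors for spins +1 and -1.\<close>

definition vlog :: "real \<Rightarrow> real \<Rightarrow> real" where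
  "vlog \<beta> x = ln (cosh \<beta> + sinh \<beta> * x)"

text \<open>Partial derivative of \<open>vlog \<beta> (x * y)\<close> in \<open>x\<close>.\<close>

definition wslope :: "real \<Rightarrow> real \<Rightarrow> real \<Rightarrow> real" where
  "wslope \<beta> x y = sinh \<beta> * y / (cosh \<beta> + sinh \<beta> * (x * y))"

lemma vlog_arg_bounds:
  fixes \<beta> x :: real
  assumes "0 \<le> \<beta>" "\<bar>x\<bar> \<le> 1"
  shows "exp (- \<beta>) \<le> cosh \<beta> + sinh \<beta> * x" "cosh \<beta> + sinh \<beta> * x \<le> exp \<beta>"
    "0 < cosh \<beta> + sinh \<beta> * x"
proof -
  have "\<bar>sinh \<beta> * x\<bar> \<le> sinh \<beta>" using assms by (simp add: abs_mult mult_left_le)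
  thus *: "exp (- \<beta>) \<le> cosh \<beta> + sinh \<beta> * x" "cosh \<beta> + sinh \<beta> * x \<le> exp \<beta>"
    using cosh_minus_sinh[of \<beta>] cosh_plus_sinh[of \<beta>] by linarith+
  show "0 < cosh \<beta> + sinh \<beta> * x" by (rule less_le_trans[OF _ *(1)]) simp
qed

lemma abs_vlog_le:
  assumes "0 \<le> \<beta>" "\<bar>x\<bar> \<le> 1"
  shows "\<bar>vlog \<beta> x\<bar> \<le> \<beta>"
proof -
  note b = vlog_arg_bounds[OF assms]
  have "ln (exp (- \<beta>)) \<le> vlog \<beta> x" "vlog \<beta> x \<le> ln (exp \<beta>)"
    unfolding vlog_def using b by (subst ln_le_cancel_iff; simp)+
  thus ?thesis by simp
qed

lemma vlog_1: "vlog \<beta> 1 = \<beta>"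
  by (simp add: vlog_def cosh_plus_sinh)

lemma ln_diff_bounds:
  fixes q q' :: real
  assumes "0 < q" "0 < q'"
  shows "(q' - q) / q' \<le> ln q' - ln q" "ln q' - ln q \<le> (q' - q) / q"
proof -
  show "ln q' - ln q \<le> (q' - q) / q"
    using ln_le_minus_one[of "q' / q"] assms by (simp add: ln_div diff_divide_distrib)
  show "(q' - q) / q' \<le> ln q' - ln q"
    using ln_le_minus_one[of "q / q'"] assms by (simp add: ln_div diff_divide_distrib)
qed

lemma inverse_vlog_arg_le:
  fixes \<beta> x :: real
  assumes "0 \<le> \<beta>" "\<bar>x\<bar> \<le> 1"
  shows "1 / (cosh \<beta> + sinh \<beta> * x) \<le> exp \<beta>"
proof -
  have "1 / (cosh \<beta> + sinh \<beta> * x) \<le> 1 / exp (- \<beta>)"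
    using vlog_arg_bounds[OF assms] by (intro divide_left_mono) auto
  thus ?thesis by (simp add: exp_minus field_simps)
qed

lemma vlog_lipschitz:
  assumes "0 \<le> \<beta>" "\<bar>x\<bar> \<le> 1" "\<bar>x'\<bar> \<le> 1"
  shows "\<bar>vlog \<beta> x' - vlog \<beta> x\<bar> \<le> sinh \<beta> * exp \<beta> * \<bar>x' - x\<bar>"
proof -
  let ?q = "cosh \<beta> + sinh \<beta> * x" and ?q' = "cosh \<beta> + sinh \<beta> * x'"
  have pos: "0 < ?q" "0 < ?q'" using vlog_arg_bounds assms by auto
  have d: "?q' - ?q = sinh \<beta> * (x' - x)" by (simp add: algebra_simps)
  have abs: "\<bar>?q' - ?q\<bar> = sinh \<beta> * \<bar>x' - x\<bar>" using assms(1) unfolding d abs_mult by simp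
  have "\<bar>(?q' - ?q) / r\<bar> \<le> sinh \<beta> * \<bar>x' - x\<bar> * exp \<beta>" if "0 < r" "1 / r \<le> exp \<beta>" for r
  proof -
    have "\<bar>(?q' - ?q) / r\<bar> = \<bar>?q' - ?q\<bar> * (1 / r)" using that(1) by (simp add: abs_divide)
    also have "\<dots> \<le> \<bar>?q' - ?q\<bar> * exp \<beta>" using that(2) by (rule mult_left_mono) simp
    finally show ?thesis unfolding abs .
  qed
  note this[OF pos(1) inverse_vlog_arg_le[OF assms(1,2)]] this[OF pos(2) inverse_vlog_arg_le[OF assms(1,3)]]
  hence "\<bar>ln ?q' - ln ?q\<bar> \<le> sinh \<beta> * \<bar>x' - x\<bar> * exp \<beta>"
    using ln_diff_bounds[OF pos] by linarith
  thus ?thesis unfolding vlog_def by (simp add: mult_ac)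
qed

text \<open>The increment of ln lies between (q' - q) / q' and (q' - q) / q, and these differ by (q'
  - q)^2 / (q q'), where q and q' are at least exp (- \<beta>).\<close>

lemma vlog_expansion:
  assumes "0 \<le> \<beta>" "\<bar>x\<bar> \<le> 1" "\<bar>x'\<bar> \<le> 1"
  shows "\<bar>vlog \<beta> x' - vlog \<beta> x - sinh \<beta> * (x' - x) / (cosh \<beta> + sinh \<beta> * x)\<bar> \<le> (sinh \<beta> * exp \<beta> * (x' - x))\<^sup>2"
proof -
  let ?q = "cosh \<beta> + sinh \<beta> * x" and ?q' = "cosh \<beta> + sinh \<beta> * x'"
  have pos: "0 < ?q" "0 < ?q'" using vlog_arg_bounds assms by auto
  have d: "?q' - ?q = sinh \<beta> * (x' - x)" by (simp add: algebra_simps)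
  have "(?q' - ?q) / ?q - (?q' - ?q) / ?q' = (?q' - ?q) * (1 / ?q - 1 / ?q')"
    by (simp add: diff_divide_distrib right_diff_distrib)
  also have "1 / ?q - 1 / ?q' = (?q' - ?q) * ((1 / ?q) * (1 / ?q'))"
    using pos by (simp add: field_simps)
  also have "(?q' - ?q) * ((?q' - ?q) * ((1 / ?q) * (1 / ?q'))) = (?q' - ?q)\<^sup>2 * ((1 / ?q) * (1 / ?q'))"
    by (simp add: power2_eq_square mult.assoc)
  also have "\<dots> \<le> (?q' - ?q)\<^sup>2 * (exp \<beta> * exp \<beta>)"
    using pos assms by (intro mult_left_mono mult_mono inverse_vlog_arg_le) auto
  also have "\<dots> = (sinh \<beta> * exp \<beta> * (x' - x))\<^sup>2"
    unfolding d by (simp add: power2_eq_square mult_ac)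
  finally show ?thesis using ln_diff_bounds[OF pos] unfolding vlog_def d by linarith
qed

lemma cosh_add_eq: "cosh (h + \<beta>) = cosh h * (cosh \<beta> + sinh \<beta> * tanh h)" for h \<beta> :: real
  by (simp add: cosh_add tanh_def field_simps)

lemma cosh_diff_eq: "cosh (h - \<beta>) = cosh h * (cosh \<beta> + sinh \<beta> * (- tanh h))" for h \<beta> :: real
  by (simp add: cosh_diff tanh_def field_simps)

lemma abs_tanh_le: "\<bar>tanh h\<bar> \<le> 1" for h :: real
  using tanh_real_lt_1[of h] tanh_real_gt_neg1[of h] by (simp add: abs_le_iff)

lemma xi_eq_vlog:
  assumes "0 \<le> \<beta>"
  shows "xi \<beta> h = (vlog \<beta> (tanh h) - vlog \<beta> (- tanh h)) / 2"
proof -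
  have "0 < cosh \<beta> + sinh \<beta> * tanh h" "0 < cosh \<beta> + sinh \<beta> * (- tanh h)"
    by (rule vlog_arg_bounds(3)[OF assms]; simp add: abs_tanh_le)+
  thus ?thesis unfolding xi_def vlog_def cosh_add_eq cosh_diff_eq by (simp add: ln_mult)
qed

text \<open>Identifies \<open>xi\<close> with the familiar artanh (tanh \<beta> tanh h).\<close>

lemma tanh_xi:
  assumes "0 \<le> \<beta>"
  shows "tanh (xi \<beta> h) = sinh \<beta> * tanh h / cosh \<beta>"
proof -
  let ?p = "cosh \<beta> + sinh \<beta> * tanh h" and ?q = "cosh \<beta> + sinh \<beta> * (- tanh h)"
  have pq: "0 < ?p" "0 < ?q"
    by (rule vlog_arg_bounds(3)[OF assms]; simp add: abs_tanh_le)+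
  have "exp (- 2 * xi \<beta> h) = ?q / ?p"
  proof -
    have "- 2 * xi \<beta> h = ln (?q / ?p)"
      using pq by (simp add: xi_eq_vlog[OF assms] vlog_def ln_div)
    thus ?thesis using pq by (simp del: ln_div)
  qed
  hence "tanh (xi \<beta> h) = (1 - ?q / ?p) / (1 + ?q / ?p)" by (simp add: tanh_real_altdef)
  also have "\<dots> = (?p - ?q) / (?p + ?q)" using pq by (simp add: divide_simps)
  also have "\<dots> = sinh \<beta> * tanh h / cosh \<beta>" by simp
  finally show ?thesis .
qed

text \<open>Stationarity of the Bethe functional at a fixed point of the message recursion:
  the derivative of the vertex term in an incoming message is that of the edge term.\<close>

lemma bethe_stationary:
  assumes "0 \<le> \<beta>" and x: "x = tanh h" and y: "y = tanh h'"
  shows "tanh (h' + xi \<beta> h) * (sinh \<beta> / (cosh \<beta> + sinh \<beta> * x) + sinh \<beta> / (cosh \<beta> + sinh \<beta> * (- x))) / 2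
     + (sinh \<beta> / (cosh \<beta> + sinh \<beta> * x) - sinh \<beta> / (cosh \<beta> + sinh \<beta> * (- x))) / 2 = wslope \<beta> x y"
proof -
  let ?C = "cosh \<beta>" and ?S = "sinh \<beta>"
  have x1: "\<bar>x\<bar> \<le> 1" "\<bar>-x\<bar> \<le> 1" "\<bar>x * y\<bar> \<le> 1"
    unfolding x y abs_mult by (simp_all add: abs_tanh_le mult_le_one)
  have p: "0 < ?C + ?S * x" "0 < ?C + ?S * (- x)" "0 < ?C + ?S * (x * y)"
    by (rule vlog_arg_bounds(3)[OF assms(1)], fact x1)+
  have C: "0 < ?C" by simp
  have "tanh (h' + xi \<beta> h) = (y + ?S * x / ?C) / (1 + y * (?S * x / ?C))"
    unfolding tanh_add[OF cosh_real_nonzero cosh_real_nonzero] tanh_xi[OF assms(1)] x y by (simp add: mult_ac)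
  also have "\<dots> = (?C * y + ?S * x) / (?C + ?S * (x * y))"
    using C p by (simp add: divide_simps) (simp add: algebra_simps)
  finally have T: "tanh (h' + xi \<beta> h) = (?C * y + ?S * x) / (?C + ?S * (x * y))" .
  define P Q R where "P = ?C + ?S * x" and "Q = ?C + ?S * (- x)" and "R = ?C + ?S * (x * y)"
  have pos: "P \<noteq> 0" "Q \<noteq> 0" "R \<noteq> 0" using p by (simp_all add: P_def Q_def R_def)
  have sum: "P + Q = 2 * ?C" "Q - P = - 2 * ?S * x" by (simp_all add: P_def Q_def)
  have PQ: "P * Q = ?C\<^sup>2 - ?S\<^sup>2 * x\<^sup>2" by (simp add: P_def Q_def power2_eq_square algebra_simps)
  have 1: "?S / P + ?S / Q = ?S * (P + Q) / (P * Q)" "?S / P - ?S / Q = ?S * (Q - P) / (P * Q)"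
    using pos by (simp_all add: field_simps)
  have "N * (?S * (2 * ?C) / (P * Q)) / 2 + (?S * (- 2 * ?S * x) / (P * Q)) / 2 = ?S / (P * Q) * (N * ?C - ?S * x)" for N
    by (simp add: algebra_simps diff_divide_distrib)
  hence "tanh (h' + xi \<beta> h) * (?S / P + ?S / Q) / 2 + (?S / P - ?S / Q) / 2 =
      ?S / (P * Q) * ((?C * y + ?S * x) / R * ?C - ?S * x)"
    unfolding 1 sum T R_def[symmetric] .
  also have "(?C * y + ?S * x) / R * ?C - ?S * x = (?C * (?C * y + ?S * x) - ?S * x * R) / R"
    using pos by (simp add: field_simps)
  also have "?C * (?C * y + ?S * x) - ?S * x * R = P * Q * y"
    unfolding PQ by (simp add: R_def power2_eq_square algebra_simps)
  also have "?S / (P * Q) * (P * Q * y / R) = ?S * y / R" using pos by simp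
  finally show ?thesis unfolding P_def Q_def R_def wslope_def .
qed

lemma abs_wslope_le:
  assumes "0 \<le> \<beta>" "\<bar>x\<bar> \<le> 1" "\<bar>y\<bar> \<le> 1"
  shows "\<bar>wslope \<beta> x y\<bar> \<le> sinh \<beta> * exp \<beta>"
proof -
  have xy: "\<bar>x * y\<bar> \<le> 1" using assms by (simp add: abs_mult mult_le_one)
  have "\<bar>wslope \<beta> x y\<bar> = (sinh \<beta> * \<bar>y\<bar>) * (1 / (cosh \<beta> + sinh \<beta> * (x * y)))"
    using vlog_arg_bounds(3)[OF assms(1) xy] assms(1) by (simp add: wslope_def abs_mult abs_divide)
  also have "\<dots> \<le> (sinh \<beta> * 1) * exp \<beta>"
    using assms vlog_arg_bounds(3)[OF assms(1) xy]
    by (intro mult_mono mult_left_mono inverse_vlog_arg_le[OF assms(1) xy]) auto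
  finally show ?thesis by simp
qed

text \<open>Bethe contribution of one edge at the root: log of the spin-independent part of the
  vertex factor, minus half of the edge term.\<close>

definition edge_bethe :: "real \<Rightarrow> real \<Rightarrow> real \<Rightarrow> real" where
  "edge_bethe \<beta> x y = (vlog \<beta> x + vlog \<beta> (- x) - vlog \<beta> (x * y)) / 2"

text \<open>By the second assumption on \<open>T\<close>, the linear part of the vertex contribution
  is \<open>wslope \<beta> x y\<close> times x' - x. The edge term subtracts half of both partial
  derivatives, so what is left is half the difference of the two directions, antisymmetric under
  exchanging them.\<close>

lemma edge_expansion:
  assumes \<beta>: "0 \<le> \<beta>" and x: "\<bar>x\<bar> \<le> 1" "\<bar>x'\<bar> \<le> 1" "\<bar>x' - x\<bar> \<le> \<rho>" and y: "\<bar>y\<bar> \<le> 1" "\<bar>y'\<bar> \<le> 1" "\<bar>y' - y\<bar> \<le> \<rho>"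
    and T: "\<bar>T\<bar> \<le> 1"
      "T * (sinh \<beta> / (cosh \<beta> + sinh \<beta> * x) + sinh \<beta> / (cosh \<beta> + sinh \<beta> * (- x))) / 2
     + (sinh \<beta> / (cosh \<beta> + sinh \<beta> * x) - sinh \<beta> / (cosh \<beta> + sinh \<beta> * (- x))) / 2 = wslope \<beta> x y"
  shows "\<bar>T * ((vlog \<beta> x' - vlog \<beta> (- x')) / 2 - (vlog \<beta> x - vlog \<beta> (- x)) / 2)
      + edge_bethe \<beta> x' y' - edge_bethe \<beta> x y
      - (wslope \<beta> x y * (x' - x) - wslope \<beta> y x * (y' - y)) / 2\<bar>
     \<le> (4 * (sinh \<beta> * exp \<beta>)\<^sup>2 + sinh \<beta> * exp \<beta>) * \<rho>\<^sup>2"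
proof -
  let ?K = "sinh \<beta> * exp \<beta>"
  have K: "0 \<le> ?K" using \<beta> by simp
  have \<rho>: "0 \<le> \<rho>" using x(3) by linarith
  define a b where "a = sinh \<beta> / (cosh \<beta> + sinh \<beta> * x)" and "b = sinh \<beta> / (cosh \<beta> + sinh \<beta> * (- x))"
  \<comment> \<open>Remainders: \<open>r1\<close>, \<open>r2\<close>, \<open>r3\<close> are the
    second-order errors of the three \<open>vlog\<close> terms, \<open>r4\<close> is the cross term
    of the product. With K = sinh \<beta> exp \<beta>, the first two cost K^2 each, half of
    \<open>r3\<close> costs 2 K^2 because its argument moves by up to 2 \<rho>, and
    \<open>r4\<close> costs K.\<close>
  define r1 where "r1 = vlog \<beta> x' - vlog \<beta> x - a * (x' - x)"
  define r2 where "r2 = vlog \<beta> (- x') - vlog \<beta> (- x) + b * (x' - x)"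
  define r3 where "r3 = vlog \<beta> (x' * y') - vlog \<beta> (x * y) - sinh \<beta> * (x' * y' - x * y) / (cosh \<beta> + sinh \<beta> * (x * y))"
  define r4 where "r4 = sinh \<beta> * ((x' - x) * (y' - y)) / (cosh \<beta> + sinh \<beta> * (x * y))"
  have xy: "\<bar>x * y\<bar> \<le> 1" "\<bar>x' * y'\<bar> \<le> 1" using x y by (simp_all add: abs_mult mult_le_one)
  have sq: "(?K * d)\<^sup>2 \<le> ?K\<^sup>2 * M\<^sup>2" if "\<bar>d\<bar> \<le> M" for d M
    using that by (simp add: power_mult_distrib abs_le_square_iff[symmetric] mult_left_mono)
  have r1: "\<bar>r1\<bar> \<le> ?K\<^sup>2 * \<rho>\<^sup>2"
    using vlog_expansion[OF \<beta> x(1,2)] sq[OF x(3)] unfolding r1_def a_def by simp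
  have r2: "\<bar>r2\<bar> \<le> ?K\<^sup>2 * \<rho>\<^sup>2"
    using vlog_expansion[OF \<beta>, of "- x" "- x'"] sq[of "x - x'" \<rho>] x unfolding r2_def b_def
    by (simp add: abs_minus_commute right_diff_distrib diff_divide_distrib)
  have "\<bar>x' * y' - x * y\<bar> \<le> 2 * \<rho>"
  proof -
    have "x' * y' - x * y = x' * (y' - y) + (x' - x) * y" by (simp add: algebra_simps)
    hence "\<bar>x' * y' - x * y\<bar> \<le> \<bar>x'\<bar> * \<bar>y' - y\<bar> + \<bar>x' - x\<bar> * \<bar>y\<bar>"
      by (metis abs_mult abs_triangle_ineq)
    also have "\<dots> \<le> 1 * \<rho> + \<rho> * 1" using x y \<rho> by (intro add_mono mult_mono) auto
    finally show ?thesis by simp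
  qed
  hence r3: "\<bar>r3\<bar> \<le> ?K\<^sup>2 * (2 * \<rho>)\<^sup>2"
    using vlog_expansion[OF \<beta> xy] sq unfolding r3_def by (meson order_trans)
  have r4: "\<bar>r4\<bar> \<le> ?K * \<rho>\<^sup>2"
  proof -
    have "\<bar>r4\<bar> = sinh \<beta> * (\<bar>x' - x\<bar> * \<bar>y' - y\<bar>) * (1 / (cosh \<beta> + sinh \<beta> * (x * y)))"
      using vlog_arg_bounds(3)[OF \<beta> xy(1)] \<beta> by (simp add: r4_def abs_mult abs_divide)
    also have "\<dots> \<le> sinh \<beta> * (\<rho> * \<rho>) * exp \<beta>"
      using \<beta> x y \<rho> vlog_arg_bounds(3)[OF \<beta> xy(1)]
      by (intro mult_mono mult_left_mono inverse_vlog_arg_le[OF \<beta> xy(1)]) auto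
    finally show ?thesis by (simp add: power2_eq_square mult_ac)
  qed
  have prod: "sinh \<beta> * (x' * y' - x * y) / (cosh \<beta> + sinh \<beta> * (x * y)) =
      wslope \<beta> x y * (x' - x) + wslope \<beta> y x * (y' - y) + r4"
    unfolding wslope_def r4_def mult.commute[of y x]
    by (simp add: add_divide_distrib[symmetric] algebra_simps)
  have T2: "(T * (a + b) / 2 + (a - b) / 2) * (x' - x) = wslope \<beta> x y * (x' - x)"
    using T(2) unfolding a_def b_def by simp
  have "T * ((vlog \<beta> x' - vlog \<beta> (- x')) / 2 - (vlog \<beta> x - vlog \<beta> (- x)) / 2)
      + edge_bethe \<beta> x' y' - edge_bethe \<beta> x y - (wslope \<beta> x y * (x' - x) - wslope \<beta> y x * (y' - y)) / 2
    = T * (r1 - r2) / 2 + (r1 + r2) / 2 - r3 / 2 - r4 / 2 + ((T * (a + b) / 2 + (a - b) / 2) * (x' - x) - wslope \<beta> x y * (x' - x))"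
  proof -
    have e: "vlog \<beta> x' = vlog \<beta> x + r1 + a * (x' - x)" "vlog \<beta> (- x') = vlog \<beta> (- x) + r2 - b * (x' - x)"
      "vlog \<beta> (x' * y') = vlog \<beta> (x * y) + r3 + (wslope \<beta> x y * (x' - x) + wslope \<beta> y x * (y' - y) + r4)"
      unfolding r1_def r2_def r3_def prod by simp_all
    show ?thesis unfolding edge_bethe_def e by (simp add: field_simps)
  qed
  also have "\<dots> = T * (r1 - r2) / 2 + (r1 + r2) / 2 - r3 / 2 - r4 / 2" using T2 by simp
  also have "\<bar>\<dots>\<bar> \<le> (\<bar>r1\<bar> + \<bar>r2\<bar>) + \<bar>r3\<bar> / 2 + \<bar>r4\<bar>"
  proof -
    have "\<bar>T * (r1 - r2)\<bar> \<le> 1 * \<bar>r1 - r2\<bar>" unfolding abs_mult using T(1) by (intro mult_right_mono) auto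
    hence "\<bar>T * (r1 - r2)\<bar> \<le> \<bar>r1\<bar> + \<bar>r2\<bar>" using abs_triangle_ineq4[of r1 r2] by simp
    moreover have "\<bar>q / 2 + (r1 + r2) / 2 - r3 / 2 - r4 / 2\<bar> \<le> (s1 + s2) + s3 / 2 + s4"
      if "\<bar>q\<bar> \<le> s1 + s2" "\<bar>r1\<bar> \<le> s1" "\<bar>r2\<bar> \<le> s2" "\<bar>r3\<bar> \<le> s3" "\<bar>r4\<bar> \<le> s4" for q s1 s2 s3 s4
      using that by (simp add: abs_le_iff field_simps)
    ultimately show ?thesis by blast
  qed
  also have "\<dots> \<le> (4 * ?K\<^sup>2 + ?K) * \<rho>\<^sup>2"
    using r1 r2 r3 r4 by (simp add: power_mult_distrib distrib_right)
  finally show ?thesis .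
qed

section \<open>Second-order expansion of the vertex term\<close>

lemma ln_2_cosh_has_derivative: "((\<lambda>h. ln (2 * cosh h)) has_real_derivative tanh h) (at h)" for h :: real
  by (auto intro!: derivative_eq_intros simp: tanh_def field_simps)

lemma tanh_lipschitz: "\<bar>tanh b - tanh a\<bar> \<le> \<bar>b - a\<bar>" for a b :: real
proof -
  have *: "\<bar>tanh b - tanh a\<bar> \<le> \<bar>b - a\<bar>" if ab: "a < b" for a b :: real
  proof -
    have "(tanh has_real_derivative 1 - tanh z ^ 2) (at z)" for z :: real
      by (auto intro!: derivative_eq_intros)
    then obtain z where z: "tanh b - tanh a = (b - a) * (1 - tanh z ^ 2)"
      using MVT2[OF ab, of tanh "\<lambda>z. 1 - tanh z ^ 2"] by blast
    have "\<bar>1 - tanh z ^ 2\<bar> \<le> 1" using abs_tanh_le[of z] by (simp add: abs_square_le_1)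
    hence "\<bar>b - a\<bar> * \<bar>1 - tanh z ^ 2\<bar> \<le> \<bar>b - a\<bar> * 1" by (intro mult_left_mono) auto
    thus ?thesis unfolding z abs_mult by simp
  qed
  show ?thesis using *[of a b] *[of b a] by (cases a b rule: linorder_cases) (auto simp: abs_minus_commute)
qed

text \<open>The slope error tanh z - tanh a is bounded by the distance and also by 2. The second
  bound keeps the estimate integrable when the increment is of the order of a degree that may lack a
  second moment.\<close>

lemma ln_2_cosh_expansion:
  "\<bar>ln (2 * cosh b) - ln (2 * cosh a) - tanh a * (b - a)\<bar> \<le> \<bar>b - a\<bar> * min 2 \<bar>b - a\<bar>" for a b :: real
proof (cases "a = b")
  case False
  have "\<exists>z. \<bar>z - a\<bar> \<le> \<bar>b - a\<bar> \<and> ln (2 * cosh b) - ln (2 * cosh a) = (b - a) * tanh z"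
  proof (cases "a < b")
    case True
    then obtain z where "a < z" "z < b" "ln (2 * cosh b) - ln (2 * cosh a) = (b - a) * tanh z"
      using MVT2[of a b "\<lambda>h. ln (2 * cosh h)" tanh] ln_2_cosh_has_derivative by blast
    thus ?thesis by (intro exI[of _ z]) auto
  next
    case ba: False
    then obtain z where "b < z" "z < a" "ln (2 * cosh a) - ln (2 * cosh b) = (a - b) * tanh z"
      using MVT2[of b a "\<lambda>h. ln (2 * cosh h)" tanh] ln_2_cosh_has_derivative False by force
    thus ?thesis by (intro exI[of _ z]) (auto simp: algebra_simps)
  qed
  then obtain z where z: "\<bar>z - a\<bar> \<le> \<bar>b - a\<bar>" "ln (2 * cosh b) - ln (2 * cosh a) = (b - a) * tanh z" by blast
  have "\<bar>tanh z - tanh a\<bar> \<le> min 2 \<bar>b - a\<bar>"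
    using tanh_lipschitz[of z a] z(1) abs_tanh_le[of z] abs_tanh_le[of a] by linarith
  hence "\<bar>b - a\<bar> * \<bar>tanh z - tanh a\<bar> \<le> \<bar>b - a\<bar> * min 2 \<bar>b - a\<bar>" by (rule mult_left_mono) simp
  moreover have "ln (2 * cosh b) - ln (2 * cosh a) - tanh a * (b - a) = (b - a) * (tanh z - tanh a)"
    unfolding z(2) by (simp add: algebra_simps)
  ultimately show ?thesis by (simp add: abs_mult)
qed simp

section \<open>The Bethe functional of the Ising model\<close>

lemma ising_vertex_factor:
  assumes "0 \<le> \<beta>" "s \<in> spins"
  shows "(\<Sum>s'\<in>spins. ising_psi \<beta> s s' * gibbs1 h s') =
    exp ((vlog \<beta> (tanh h) + vlog \<beta> (- tanh h)) / 2) * exp (xi \<beta> h * s)"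
proof -
  have pos: "0 < cosh \<beta> + sinh \<beta> * tanh h" "0 < cosh \<beta> + sinh \<beta> * (- tanh h)"
    by (rule vlog_arg_bounds(3)[OF assms(1)]; simp add: abs_tanh_le)+
  have "(\<Sum>s'\<in>spins. ising_psi \<beta> s s' * gibbs1 h s') = cosh (h + \<beta> * s) / cosh h"
    by (simp add: sum_spins ising_psi_def gibbs1_def cosh_def[of "h + \<beta> * s"] field_simps exp_add[symmetric])
  also have "\<dots> = cosh \<beta> + sinh \<beta> * (tanh h * s)"
    using assms(2) cosh_add_eq[of h \<beta>] cosh_diff_eq[of h \<beta>] by (auto simp: spins_def)
  also have "\<dots> = exp (vlog \<beta> (tanh h * s))"
    using assms(2) pos by (auto simp: spins_def vlog_def)
  also have "vlog \<beta> (tanh h * s) = (vlog \<beta> (tanh h) + vlog \<beta> (- tanh h)) / 2 + xi \<beta> h * s"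
    using assms(2) unfolding xi_eq_vlog[OF assms(1)] by (auto simp: spins_def field_simps)
  finally show ?thesis by (simp add: exp_add)
qed

lemma ising_edge_factor:
  "(\<Sum>s\<in>spins. \<Sum>s'\<in>spins. ising_psi \<beta> s s' * gibbs1 h s' * gibbs1 h' s) =
     cosh \<beta> + sinh \<beta> * (tanh h * tanh h')"
proof -
  have e: "exp x + exp (- x) = 2 * cosh x" "exp x - exp (- x) = 2 * sinh x" for x :: real
    by (simp_all add: cosh_def sinh_def)
  have "(\<Sum>s\<in>spins. \<Sum>s'\<in>spins. ising_psi \<beta> s s' * gibbs1 h s' * gibbs1 h' s) =
      ((exp \<beta> + exp (- \<beta>)) * ((exp h + exp (- h)) * (exp h' + exp (- h'))) +
       (exp \<beta> - exp (- \<beta>)) * ((exp h - exp (- h)) * (exp h' - exp (- h')))) / (2 * (2 * cosh h) * (2 * cosh h'))"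
    by (simp add: sum_spins ising_psi_def gibbs1_def add_divide_distrib[symmetric] exp_minus)
      (simp add: field_simps)
  also have "\<dots> = ((2 * cosh \<beta>) * ((2 * cosh h) * (2 * cosh h')) + (2 * sinh \<beta>) * ((2 * sinh h) * (2 * sinh h'))) /
      (2 * (2 * cosh h) * (2 * cosh h'))"
    by (simp only: e)
  also have "\<dots> = cosh \<beta> + sinh \<beta> * (tanh h * tanh h')"
    by (simp add: tanh_def add_divide_distrib)
  finally show ?thesis .
qed

definition edge_bethe_fun :: "real \<Rightarrow> edge_fun" where
  "edge_bethe_fun \<beta> = (\<lambda>h h' _ _. edge_bethe \<beta> (tanh h) (tanh h'))"

definition bethe_fun :: "real \<Rightarrow> real \<Rightarrow> (nat list \<Rightarrow> nat) \<Rightarrow> real" where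
  "bethe_fun \<beta> B c = ln (2 * cosh (lim_field \<beta> B c)) + lim_edge_sum \<beta> B B (edge_bethe_fun \<beta>) c"

lemma bethe_T_cong:
  assumes "\<And>c s. s \<in> X \<Longrightarrow> m c s = m' c s"
  shows "bethe_T X psi psibar m = bethe_T X psi psibar m'"
  unfolding bethe_T_def using assms by (simp cong: sum.cong)

text \<open>In the vertex term, the \<open>xi\<close> parts of the incoming factors add up with
  \<open>B\<close> to \<open>lim_field\<close> by the fixed-point equation, giving 2 cosh; their
  spin-independent parts are booked on the edges.\<close>

lemma bethe_T_eq_bethe_fun:
  assumes \<beta>: "0 \<le> \<beta>" and B: "0 < B" and m: "\<And>c s. s \<in> spins \<Longrightarrow> m c s = gibbs1 (lim_field \<beta> B c) s"
  shows "bethe_T spins (ising_psi \<beta>) (ising_psibar B) m = bethe_fun \<beta> B"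
proof
  fix c
  let ?h = "\<lambda>i. lim_field \<beta> B (subtree c i)" and ?h' = "\<lambda>i. lim_field \<beta> B (remove_child c i)"
  let ?e = "\<lambda>i. (vlog \<beta> (tanh (?h i)) + vlog \<beta> (- tanh (?h i))) / 2"
  have "(\<Sum>s\<in>spins. ising_psibar B s * (\<Prod>i<c []. \<Sum>s'\<in>spins. ising_psi \<beta> s s' * gibbs1 (?h i) s')) =
      (\<Sum>s\<in>spins. exp (\<Sum>i<c []. ?e i) * exp (lim_field \<beta> B c * s))"
  proof (rule sum.cong[OF refl])
    fix s assume s: "s \<in> spins"
    have "(\<Prod>i<c []. \<Sum>s'\<in>spins. ising_psi \<beta> s s' * gibbs1 (?h i) s') = exp (\<Sum>i<c []. ?e i) * exp ((\<Sum>i<c []. xi \<beta> (?h i)) * s)"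
      by (simp add: ising_vertex_factor[OF \<beta> s] prod.distrib exp_sum sum_distrib_right)
    thus "ising_psibar B s * (\<Prod>i<c []. \<Sum>s'\<in>spins. ising_psi \<beta> s s' * gibbs1 (?h i) s') =
        exp (\<Sum>i<c []. ?e i) * exp (lim_field \<beta> B c * s)"
      using lim_field_rec[OF \<beta>, of B c] B by (simp add: ising_psibar_def distrib_right exp_add)
  qed
  also have "\<dots> = exp (\<Sum>i<c []. ?e i) * (2 * cosh (lim_field \<beta> B c))"
    by (simp add: sum_spins cosh_def algebra_simps)
  finally have vertex: "ln (\<Sum>s\<in>spins. ising_psibar B s * (\<Prod>i<c []. \<Sum>s'\<in>spins. ising_psi \<beta> s s' * gibbs1 (?h i) s')) =
      ln (2 * cosh (lim_field \<beta> B c)) + (\<Sum>i<c []. ?e i)"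
    by (simp add: ln_mult)
  have "bethe_T spins (ising_psi \<beta>) (ising_psibar B) m c =
      bethe_T spins (ising_psi \<beta>) (ising_psibar B) (\<lambda>c. gibbs1 (lim_field \<beta> B c)) c"
    by (subst bethe_T_cong[OF m]) auto
  also have "\<dots> = ln (2 * cosh (lim_field \<beta> B c)) + (\<Sum>i<c []. ?e i) - 1 / 2 * (\<Sum>i<c []. vlog \<beta> (tanh (?h i) * tanh (?h' i)))"
    unfolding bethe_T_def vertex ising_edge_factor vlog_def ..
  also have "\<dots> = bethe_fun \<beta> B c"
    unfolding bethe_fun_def lim_edge_sum_def edge_bethe_fun_def edge_bethe_def
    by (simp add: sum_distrib_left sum_subtractf[symmetric] diff_divide_distrib)
  finally show "bethe_T spins (ising_psi \<beta>) (ising_psibar B) m c = bethe_fun \<beta> B c" .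
qed

lemma bethe_T_free:
  "0 \<le> \<beta> \<Longrightarrow> 0 < B \<Longrightarrow> bethe_T spins (ising_psi \<beta>) (ising_psibar B) (h_free \<beta> B) = bethe_fun \<beta> B"
  by (rule bethe_T_eq_bethe_fun) (auto intro: h_free_eq)

lemma bethe_T_plus:
  "0 \<le> \<beta> \<Longrightarrow> 0 < B \<Longrightarrow> bethe_T spins (ising_psi \<beta>) (ising_psibar B) (h_plus \<beta> B) = bethe_fun \<beta> B"
  by (rule bethe_T_eq_bethe_fun) (auto intro: h_plus_eq)

text \<open>Deleting a child deletes one summand of the recursion. The total field thus has the form
  h' + xi(h) required by \<open>bethe_stationary\<close>, whichever child is singled out.\<close>

lemma lim_field_remove_child:
  assumes "0 \<le> \<beta>" "0 \<le> B" "i < c []"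
  shows "lim_field \<beta> B c = lim_field \<beta> B (remove_child c i) + xi \<beta> (lim_field \<beta> B (subtree c i))"
proof -
  have "lim_field \<beta> B (remove_child c i) = B + (\<Sum>k\<in>{..<c []} - {i}. xi \<beta> (lim_field \<beta> B (subtree c k)))"
    unfolding lim_field_rec[OF assms(1,2), of "remove_child c i"]
      sum_remove_child[where c = c and i = i and f = "\<lambda>d. xi \<beta> (lim_field \<beta> B d)", OF assms(3)] ..
  thus ?thesis
    unfolding lim_field_rec[OF assms(1,2), of c]
    by (subst sum.remove[of _ i]) (use assms(3) in auto)
qed

text \<open>The linear part left over by \<open>edge_expansion\<close>; its antisymmetry is what
  mass transport exploits.\<close>

definition edge_flow :: "real \<Rightarrow> edge_fun" where
  "edge_flow \<beta> = (\<lambda>h h' k k'.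
     (wslope \<beta> (tanh h) (tanh h') * (tanh k - tanh h) - wslope \<beta> (tanh h') (tanh h) * (tanh k' - tanh h')) / 2)"

lemma edge_flow_swap: "edge_flow \<beta> h' h k' k = - edge_flow \<beta> h h' k k'"
  by (simp add: edge_flow_def field_simps)

lemma bounded_cont_edge_flow:
  assumes "0 \<le> \<beta>"
  shows "bounded_cont_edge_fun (edge_flow \<beta>) (2 * (sinh \<beta> * exp \<beta>))"
  unfolding bounded_cont_edge_fun_def
proof (intro conjI allI impI)
  let ?K = "sinh \<beta> * exp \<beta>"
  have K: "0 \<le> ?K" using assms by simp
  fix x y x' y' :: real
  have *: "\<bar>wslope \<beta> (tanh x) (tanh y) * (tanh x' - tanh x)\<bar> \<le> ?K * 2" for x y x' :: real
    unfolding abs_mult using abs_tanh_le[of x] abs_tanh_le[of x'] K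
    by (intro mult_mono abs_wslope_le assms abs_tanh_le) auto
  show "\<bar>edge_flow \<beta> x y x' y'\<bar> \<le> 2 * ?K"
    using *[of x y x'] *[of y x y'] unfolding edge_flow_def by (simp add: abs_le_iff)
next
  fix X Y X' Y' and x y x' y' :: real
  assume "X \<longlonglongrightarrow> x" "Y \<longlonglongrightarrow> y" "X' \<longlonglongrightarrow> x'" "Y' \<longlonglongrightarrow> y'"
  moreover have "cosh \<beta> + sinh \<beta> * (tanh u * tanh v) \<noteq> 0" for u v :: real
    using vlog_arg_bounds(3)[OF assms, of "tanh u * tanh v"] abs_tanh_le[of u] abs_tanh_le[of v]
    by (simp add: abs_mult mult_le_one)
  ultimately show "(\<lambda>n. edge_flow \<beta> (X n) (Y n) (X' n) (Y' n)) \<longlonglongrightarrow> edge_flow \<beta> x y x' y'"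
    unfolding edge_flow_def wslope_def by (intro tendsto_intros) auto
qed

lemma bounded_cont_edge_bethe_fun:
  assumes "0 \<le> \<beta>"
  shows "bounded_cont_edge_fun (edge_bethe_fun \<beta>) (2 * \<beta>)"
  unfolding bounded_cont_edge_fun_def
proof (intro conjI allI impI)
  fix x y x' y' :: real
  have "\<bar>tanh x * tanh y\<bar> \<le> 1" using abs_tanh_le[of x] abs_tanh_le[of y] by (simp add: abs_mult mult_le_one)
  from abs_vlog_le[OF assms abs_tanh_le[of x]] abs_vlog_le[OF assms, of "- tanh x"] abs_vlog_le[OF assms this] abs_tanh_le[of x]
  show "\<bar>edge_bethe_fun \<beta> x y x' y'\<bar> \<le> 2 * \<beta>"
    unfolding edge_bethe_fun_def edge_bethe_def using assms by (simp add: abs_le_iff)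
next
  fix X Y X' Y' and x y x' y' :: real
  assume "X \<longlonglongrightarrow> x" "Y \<longlonglongrightarrow> y"
  moreover have "cosh \<beta> + sinh \<beta> * (tanh u * tanh v) \<noteq> 0" "cosh \<beta> + sinh \<beta> * tanh u \<noteq> 0"
      "cosh \<beta> + sinh \<beta> * (- tanh u) \<noteq> 0" for u v :: real
    using vlog_arg_bounds(3)[OF assms, of "tanh u * tanh v"] vlog_arg_bounds(3)[OF assms, of "tanh u"]
      vlog_arg_bounds(3)[OF assms, of "- tanh u"] abs_tanh_le[of u] abs_tanh_le[of v]
    by (simp_all add: abs_mult mult_le_one)
  ultimately show "(\<lambda>n. edge_bethe_fun \<beta> (X n) (Y n) (X' n) (Y' n)) \<longlonglongrightarrow> edge_bethe_fun \<beta> x y x' y'"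
    unfolding edge_bethe_fun_def edge_bethe_def vlog_def by (intro tendsto_intros) auto
qed

definition flow_const :: "real \<Rightarrow> real" where
  "flow_const \<beta> = 4 * (sinh \<beta> * exp \<beta>)\<^sup>2 + sinh \<beta> * exp \<beta>"

text \<open>\<open>xi\<close> depends on a field only through its tanh, so each summand moves by at
  most a fixed multiple of |B' - B|, and only the number of summands brings in the degree.\<close>

lemma lim_field_diff_bound:
  assumes \<beta>: "0 \<le> \<beta>" and b: "0 < b" "b \<le> B" "b \<le> B'"
  shows "\<bar>lim_field \<beta> B' c - lim_field \<beta> B c\<bar> \<le> \<bar>B' - B\<bar> * (1 + sinh \<beta> * exp \<beta> / b * real (c []))"
proof -
  let ?K = "sinh \<beta> * exp \<beta>"
  have K: "0 \<le> ?K" using \<beta> by simp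
  have xi: "\<bar>xi \<beta> (lim_field \<beta> B' d) - xi \<beta> (lim_field \<beta> B d)\<bar> \<le> ?K / b * \<bar>B' - B\<bar>" for d
  proof -
    let ?x = "tanh (lim_field \<beta> B d)" and ?x' = "tanh (lim_field \<beta> B' d)"
    have "\<bar>vlog \<beta> ?x' - vlog \<beta> ?x\<bar> \<le> ?K * \<bar>?x' - ?x\<bar>" "\<bar>vlog \<beta> (- ?x') - vlog \<beta> (- ?x)\<bar> \<le> ?K * \<bar>?x' - ?x\<bar>"
      using vlog_lipschitz[OF \<beta>, of ?x ?x'] vlog_lipschitz[OF \<beta>, of "- ?x" "- ?x'"]
      by (simp_all add: abs_tanh_le abs_minus_commute)
    moreover have "\<bar>(p' - q') / 2 - (p - q) / 2\<bar> \<le> M" if "\<bar>p' - p\<bar> \<le> M" "\<bar>q' - q\<bar> \<le> M" for p p' q q' M :: real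
      using that by (simp add: abs_le_iff field_simps)
    ultimately have "\<bar>xi \<beta> (lim_field \<beta> B' d) - xi \<beta> (lim_field \<beta> B d)\<bar> \<le> ?K * \<bar>?x' - ?x\<bar>"
      unfolding xi_eq_vlog[OF \<beta>] by blast
    also have "\<dots> \<le> ?K * (\<bar>B' - B\<bar> / b)"
      using tanh_lim_field_lipschitz[OF \<beta> b(1,3,2)] K by (intro mult_left_mono)
    finally show ?thesis by simp
  qed
  have "lim_field \<beta> B' c - lim_field \<beta> B c = (B' - B) +
      (\<Sum>i<c []. xi \<beta> (lim_field \<beta> B' (subtree c i)) - xi \<beta> (lim_field \<beta> B (subtree c i)))"
    using b lim_field_rec[OF \<beta>, of B c] lim_field_rec[OF \<beta>, of B' c] by (simp add: sum_subtractf)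
  also have "\<bar>\<dots>\<bar> \<le> \<bar>B' - B\<bar> + ?K / b * \<bar>B' - B\<bar> * real (card {..<c []})"
    by (intro order_trans[OF abs_triangle_ineq] add_left_mono abs_sum_le_card xi)
  finally show ?thesis by (simp add: algebra_simps)
qed

text \<open>The vertex term moves by tanh H times the change of H, which is B' - B plus the
  increments of \<open>xi\<close>. The first piece is the derivative; the second combines with the
  edge terms, child by child, into \<open>edge_flow\<close> and a quadratic error.\<close>

lemma bethe_fun_expansion:
  assumes \<beta>: "0 \<le> \<beta>" and b: "0 < b" "b \<le> B" "b \<le> B'"
  shows "\<bar>bethe_fun \<beta> B' c - bethe_fun \<beta> B c - (B' - B) * tanh (lim_field \<beta> B c) - lim_edge_sum \<beta> B B' (edge_flow \<beta>) c\<bar>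
    \<le> \<bar>lim_field \<beta> B' c - lim_field \<beta> B c\<bar> * min 2 \<bar>lim_field \<beta> B' c - lim_field \<beta> B c\<bar>
      + flow_const \<beta> * (\<bar>B' - B\<bar> / b)\<^sup>2 * real (c [])"
proof -
  let ?H = "lim_field \<beta> B c" and ?H' = "lim_field \<beta> B' c"
  let ?h = "\<lambda>i. lim_field \<beta> B (subtree c i)" and ?k = "\<lambda>i. lim_field \<beta> B (remove_child c i)"
  let ?h' = "\<lambda>i. lim_field \<beta> B' (subtree c i)" and ?k' = "\<lambda>i. lim_field \<beta> B' (remove_child c i)"
  let ?r = "\<lambda>i. tanh ?H * (xi \<beta> (?h' i) - xi \<beta> (?h i)) + edge_bethe_fun \<beta> (?h' i) (?k' i) 0 0 - edge_bethe_fun \<beta> (?h i) (?k i) 0 0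
      - edge_flow \<beta> (?h i) (?k i) (?h' i) (?k' i)"
  define R where "R i = ?r i" for i
  have r: "\<bar>R i\<bar> \<le> flow_const \<beta> * (\<bar>B' - B\<bar> / b)\<^sup>2" if i: "i < c []" for i
  proof -
    have H: "?H = ?k i + xi \<beta> (?h i)" using lim_field_remove_child[where c = c and i = i, OF \<beta> _ i] b by simp
    note stat = bethe_stationary[OF \<beta> refl refl, of "?k i" "?h i", folded H]
    note lip = tanh_lim_field_lipschitz[OF \<beta> b(1,3,2)]
    show ?thesis
      using edge_expansion[OF \<beta> abs_tanh_le abs_tanh_le lip abs_tanh_le abs_tanh_le lip abs_tanh_le stat]
      unfolding xi_eq_vlog[OF \<beta>] edge_bethe_fun_def edge_flow_def flow_const_def R_def .
  qed
  have "(\<Sum>i<c []. R i) = tanh ?H * (\<Sum>i<c []. xi \<beta> (?h' i) - xi \<beta> (?h i))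
      + lim_edge_sum \<beta> B' B' (edge_bethe_fun \<beta>) c - lim_edge_sum \<beta> B B (edge_bethe_fun \<beta>) c - lim_edge_sum \<beta> B B' (edge_flow \<beta>) c"
    unfolding lim_edge_sum_def R_def by (simp add: sum.distrib sum_subtractf sum_distrib_left[symmetric] edge_bethe_fun_def)
  moreover have "(\<Sum>i<c []. xi \<beta> (?h' i) - xi \<beta> (?h i)) = ?H' - ?H - (B' - B)"
    using b lim_field_rec[OF \<beta>, of B c] lim_field_rec[OF \<beta>, of B' c] by (simp add: sum_subtractf)
  ultimately have eq: "bethe_fun \<beta> B' c - bethe_fun \<beta> B c - (B' - B) * tanh ?H - lim_edge_sum \<beta> B B' (edge_flow \<beta>) c =
      (ln (2 * cosh ?H') - ln (2 * cosh ?H) - tanh ?H * (?H' - ?H)) + (\<Sum>i<c []. R i)"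
    unfolding bethe_fun_def by (simp add: algebra_simps)
  have "\<bar>\<Sum>i<c []. R i\<bar> \<le> (\<Sum>i<c []. \<bar>R i\<bar>)" by (rule sum_abs)
  also have "\<dots> \<le> real (card {..<c []}) * (flow_const \<beta> * (\<bar>B' - B\<bar> / b)\<^sup>2)"
    by (rule sum_bounded_above) (simp add: r)
  finally have "\<bar>\<Sum>i<c []. R i\<bar> \<le> flow_const \<beta> * (\<bar>B' - B\<bar> / b)\<^sup>2 * real (c [])"
    by (simp add: mult.commute)
  with ln_2_cosh_expansion[of ?H' ?H] show ?thesis
    unfolding eq by (intro order_trans[OF abs_triangle_ineq] add_mono)
qed

section \<open>Dependence of the Bethe functional on the field\<close>

lemma ln_2_cosh_bounds:
  fixes h :: real
  shows "h \<le> ln (2 * cosh h)" "ln (2 * cosh h) \<le> h + exp (- 2 * h)"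
proof -
  have p: "0 < 1 + exp (- 2 * h)" by (rule add_pos_pos) simp_all
  have "2 * cosh h = exp h * (1 + exp (- 2 * h))"
    by (simp add: cosh_def distrib_left exp_add[symmetric])
  hence "ln (2 * cosh h) = ln (exp h * (1 + exp (- 2 * h)))" by simp
  also have "\<dots> = h + ln (1 + exp (- 2 * h))"
    by (subst ln_mult_pos) (use p in simp_all)
  finally have eq: "ln (2 * cosh h) = h + ln (1 + exp (- 2 * h))" .
  show "h \<le> ln (2 * cosh h)" unfolding eq by simp
  show "ln (2 * cosh h) \<le> h + exp (- 2 * h)"
    unfolding eq using ln_add_one_self_le_self[of "exp (- 2 * h)"] by simp
qed

text \<open>All messages have tanh between tanh B and 1. At the value 1 each edge contributes
  exactly \<beta> / 2, and ln (2 cosh H) differs from H by at most exp (- 2 H).\<close>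

lemma bethe_fun_large_field:
  assumes \<beta>: "0 \<le> \<beta>" and B: "0 < B"
  shows "\<bar>bethe_fun \<beta> B c - (B + \<beta> / 2 * real (c []))\<bar>
    \<le> exp (- 2 * B) + 2 * (sinh \<beta> * exp \<beta>) * (1 - tanh B) * real (c [])"
proof -
  let ?K = "sinh \<beta> * exp \<beta>" and ?H = "lim_field \<beta> B c"
  let ?h = "\<lambda>i. lim_field \<beta> B (subtree c i)" and ?k = "\<lambda>i. lim_field \<beta> B (remove_child c i)"
  have K: "0 \<le> ?K" using \<beta> by simp
  \<comment> \<open>The term \<open>xi\<close> comes from H = B + sum of \<open>xi\<close>; together
    with \<open>edge_bethe\<close> it collapses to vlog(x) - vlog(x y) / 2.\<close>
  define R where "R i = xi \<beta> (?h i) + edge_bethe_fun \<beta> (?h i) (?k i) 0 0 - \<beta> / 2" for i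
  have R: "\<bar>R i\<bar> \<le> 2 * ?K * (1 - tanh B)" for i
  proof -
    define x y where "x = tanh (?h i)" and "y = tanh (?k i)"
    have T: "0 \<le> tanh B" "tanh B \<le> 1" using B tanh_real_lt_1[of B] by auto
    have x: "tanh B \<le> x" "x \<le> 1" "\<bar>x\<bar> \<le> 1" and y: "tanh B \<le> y" "y \<le> 1" "\<bar>y\<bar> \<le> 1"
      using lim_field_ge[OF \<beta>, of B] B abs_tanh_le unfolding x_def y_def by (auto simp: less_imp_le tanh_real_lt_1)
    have xy: "\<bar>x * y\<bar> \<le> 1" "\<bar>x * y - 1\<bar> \<le> 2 * (1 - tanh B)"
    proof -
      show "\<bar>x * y\<bar> \<le> 1" using x y by (simp add: abs_mult mult_le_one)
      have "(1 - x) * (1 - y) \<ge> 0" using x y by simp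
      hence "1 - x * y \<le> (1 - x) + (1 - y)" by (simp add: algebra_simps)
      moreover have "x * y \<le> 1" using \<open>\<bar>x * y\<bar> \<le> 1\<close> by simp
      ultimately show "\<bar>x * y - 1\<bar> \<le> 2 * (1 - tanh B)" using x y by simp
    qed
    have "R i = (vlog \<beta> x - vlog \<beta> 1) - (vlog \<beta> (x * y) - vlog \<beta> 1) / 2"
      unfolding R_def xi_eq_vlog[OF \<beta>] edge_bethe_fun_def edge_bethe_def x_def y_def vlog_1 by (simp add: field_simps)
    also have "\<bar>\<dots>\<bar> \<le> ?K * \<bar>x - 1\<bar> + ?K * \<bar>x * y - 1\<bar> / 2"
    proof -
      have "\<bar>vlog \<beta> x - vlog \<beta> 1\<bar> \<le> ?K * \<bar>x - 1\<bar>" "\<bar>vlog \<beta> (x * y) - vlog \<beta> 1\<bar> \<le> ?K * \<bar>x * y - 1\<bar>"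
        using x xy by (intro vlog_lipschitz[OF \<beta>]; simp)+
      moreover have "\<bar>p - q / 2\<bar> \<le> s + t / 2" if "\<bar>p\<bar> \<le> s" "\<bar>q\<bar> \<le> t" for p q s t :: real
        using that by (simp add: abs_le_iff field_simps)
      ultimately show ?thesis by blast
    qed
    also have "\<dots> \<le> ?K * (1 - tanh B) + ?K * (2 * (1 - tanh B)) / 2"
      using x xy K by (intro add_mono divide_right_mono mult_left_mono) auto
    also have "\<dots> = 2 * ?K * (1 - tanh B)" by (simp add: field_simps)
    finally show ?thesis .
  qed
  have "bethe_fun \<beta> B c - (B + \<beta> / 2 * real (c [])) = (ln (2 * cosh ?H) - ?H) + (\<Sum>i<c []. R i)"
    using lim_field_rec[OF \<beta>, of B c] B
    unfolding bethe_fun_def lim_edge_sum_def R_def by (simp add: sum.distrib sum_subtractf edge_bethe_fun_def)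
  also have "\<bar>\<dots>\<bar> \<le> exp (- 2 * B) + 2 * ?K * (1 - tanh B) * real (card {..<c []})"
  proof (intro order_trans[OF abs_triangle_ineq] add_mono abs_sum_le_card R)
    have "exp (- 2 * ?H) \<le> exp (- 2 * B)" using lim_field_ge[OF \<beta>, of B c] B by simp
    thus "\<bar>ln (2 * cosh ?H) - ?H\<bar> \<le> exp (- 2 * B)" using ln_2_cosh_bounds[of ?H] by linarith
  qed
  finally show ?thesis by simp
qed

context local_weak_limit
begin

lemma measurable_bethe_fun:
  assumes "0 \<le> \<beta>" "0 < B"
  shows "bethe_fun \<beta> B \<in> borel_measurable \<mu>"
proof -
  have [measurable]: "lim_field \<beta> B \<in> borel_measurable \<mu>" "lim_edge_sum \<beta> B B (edge_bethe_fun \<beta>) \<in> borel_measurable \<mu>"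
    using assms by (auto intro!: measurable_lim_field borel_measurable_integrable lim_edge_sum_limit bounded_cont_edge_bethe_fun)
  have "(\<lambda>x :: real. ln (2 * cosh x)) \<in> borel_measurable borel"
    unfolding cosh_def by measurable
  hence [measurable]: "(\<lambda>c. ln (2 * cosh (lim_field \<beta> B c))) \<in> borel_measurable \<mu>"
    by (rule measurable_compose[rotated]) measurable
  show ?thesis unfolding bethe_fun_def[abs_def] by measurable
qed

lemma integrable_bethe_fun:
  assumes "0 \<le> \<beta>" "0 < B"
  shows "integrable \<mu> (bethe_fun \<beta> B)"
proof (rule Bochner_Integration.integrable_bound)
  let ?K = "2 * (sinh \<beta> * exp \<beta>) * (1 - tanh B)"
  show "integrable \<mu> (\<lambda>c. (exp (- 2 * B) + ?K * root_deg c) + (B + \<beta> / 2 * root_deg c))"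
    by (intro Bochner_Integration.integrable_add integrable_mult_right integrable_root_deg) auto
  show "bethe_fun \<beta> B \<in> borel_measurable \<mu>" by (rule measurable_bethe_fun[OF assms])
  show "AE c in \<mu>. norm (bethe_fun \<beta> B c) \<le> norm ((exp (- 2 * B) + ?K * root_deg c) + (B + \<beta> / 2 * root_deg c))"
  proof (rule AE_I2)
    fix c :: "nat list \<Rightarrow> nat"
    have "0 \<le> B + \<beta> / 2 * root_deg c" using assms by simp
    thus "norm (bethe_fun \<beta> B c) \<le> norm ((exp (- 2 * B) + ?K * root_deg c) + (B + \<beta> / 2 * root_deg c))"
      using bethe_fun_large_field[OF assms, of c] unfolding real_norm_def by linarith
  qed
qed

lemma integral_bethe_large_field:
  assumes "0 \<le> \<beta>" "0 < B"
  shows "\<bar>integral\<^sup>L \<mu> (bethe_fun \<beta> B) - (B + \<beta> / 2 * integral\<^sup>L \<mu> root_deg)\<bar>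
    \<le> exp (- 2 * B) + 2 * (sinh \<beta> * exp \<beta>) * (1 - tanh B) * integral\<^sup>L \<mu> root_deg"
proof -
  let ?K = "2 * (sinh \<beta> * exp \<beta>) * (1 - tanh B)"
  note D = integrable_root_deg(1)
  have lin: "integrable \<mu> (\<lambda>c. p + q * root_deg c)" "(\<integral>c. p + q * root_deg c \<partial>\<mu>) = p + q * integral\<^sup>L \<mu> root_deg" for p q
    using D by simp_all
  have "integral\<^sup>L \<mu> (bethe_fun \<beta> B) - (B + \<beta> / 2 * integral\<^sup>L \<mu> root_deg) = (\<integral>c. bethe_fun \<beta> B c - (B + \<beta> / 2 * root_deg c) \<partial>\<mu>)"
    unfolding lin(2)[symmetric] by (rule Bochner_Integration.integral_diff[symmetric]) (intro integrable_bethe_fun assms lin)+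
  also have "\<bar>\<dots>\<bar> \<le> (\<integral>c. \<bar>bethe_fun \<beta> B c - (B + \<beta> / 2 * root_deg c)\<bar> \<partial>\<mu>)"
    by (rule integral_abs_bound)
  also have "\<dots> \<le> (\<integral>c. exp (- 2 * B) + ?K * root_deg c \<partial>\<mu>)"
    using bethe_fun_large_field[OF assms]
    by (intro integral_mono integrable_abs Bochner_Integration.integrable_diff integrable_bethe_fun assms lin)
  finally show ?thesis unfolding lin(2) .
qed

lemma integrable_tanh_lim_field:
  assumes "0 \<le> \<beta>" "0 \<le> B"
  shows "integrable \<mu> (\<lambda>c. tanh (lim_field \<beta> B c))"
proof (rule integrable_const_bound[where B = 1])
  show "AE c in \<mu>. norm (tanh (lim_field \<beta> B c)) \<le> 1" by (simp add: abs_tanh_le)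
  have [measurable]: "lim_field \<beta> B \<in> borel_measurable \<mu>" by (rule measurable_lim_field[OF assms])
  have "(tanh :: real \<Rightarrow> real) \<in> borel_measurable borel"
    by (intro borel_measurable_continuous_onI continuous_intros) auto
  thus "(\<lambda>c. tanh (lim_field \<beta> B c)) \<in> borel_measurable \<mu>" by (rule measurable_compose[rotated]) measurable
qed

text \<open>Edge reversal negates the functional and, by mass transport, keeps its mean.\<close>

lemma integral_edge_flow:
  assumes "0 \<le> \<beta>" "0 \<le> B" "0 \<le> B'"
  shows "integral\<^sup>L \<mu> (lim_edge_sum \<beta> B B' (edge_flow \<beta>)) = 0"
proof -
  have swap: "lim_edge_sum \<beta> B B' (swap_edge_fun (edge_flow \<beta>)) = (\<lambda>c. - lim_edge_sum \<beta> B B' (edge_flow \<beta>) c)"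
    unfolding lim_edge_sum_def sum_negf[symmetric] by (intro ext sum.cong refl edge_flow_swap)
  have "integral\<^sup>L \<mu> (lim_edge_sum \<beta> B B' (edge_flow \<beta>)) = - integral\<^sup>L \<mu> (lim_edge_sum \<beta> B B' (edge_flow \<beta>))"
    using mass_transport[OF assms bounded_cont_edge_flow[OF assms(1)]] unfolding swap by simp
  thus ?thesis by simp
qed

text \<open>Dominated convergence with bound 2 M. In the application \<open>M\<close> is linear in
  the degree and its square need not be integrable.\<close>

lemma integral_min_tendsto_0:
  fixes M :: "(nat list \<Rightarrow> nat) \<Rightarrow> real"
  assumes M: "integrable \<mu> M" "\<And>c. 0 \<le> M c"
  shows "((\<lambda>d. \<integral>c. M c * min 2 (\<bar>d\<bar> * M c) \<partial>\<mu>) \<longlongrightarrow> 0) (at 0)"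
proof -
  have [measurable]: "M \<in> borel_measurable \<mu>" using M(1) by simp
  have "(\<lambda>n. \<integral>c. M c * min 2 (\<bar>X n\<bar> * M c) \<partial>\<mu>) \<longlonglongrightarrow> (\<integral>c. 0 \<partial>\<mu>)" if X: "X \<longlonglongrightarrow> 0" for X :: "nat \<Rightarrow> real"
  proof (rule integral_dominated_convergence[where w = "\<lambda>c. M c * 2"])
    show "AE c in \<mu>. (\<lambda>n. M c * min 2 (\<bar>X n\<bar> * M c)) \<longlonglongrightarrow> 0"
    proof (rule AE_I2)
      fix c
      have "(\<lambda>n. M c * min 2 (\<bar>X n\<bar> * M c)) \<longlonglongrightarrow> M c * min 2 (\<bar>0\<bar> * M c)"
        by (intro tendsto_intros X)
      thus "(\<lambda>n. M c * min 2 (\<bar>X n\<bar> * M c)) \<longlonglongrightarrow> 0" by simp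
    qed
    show "AE c in \<mu>. norm (M c * min 2 (\<bar>X n\<bar> * M c)) \<le> M c * 2" for n
      using M(2) by (auto simp: abs_mult intro!: mult_left_mono)
  qed (use M in auto)
  thus ?thesis unfolding tendsto_at_iff_sequentially comp_def by simp
qed

text \<open>The difference quotient is estimated directly over a finite increment: the flow term has
  mean exactly 0 for each positive B', and the remaining error divided by the increment tends to
  0.\<close>

lemma bethe_has_derivative:
  assumes \<beta>: "0 \<le> \<beta>" and B: "0 < B"
  shows "((\<lambda>B. integral\<^sup>L \<mu> (bethe_fun \<beta> B)) has_real_derivative (\<integral>c. tanh (lim_field \<beta> B c) \<partial>\<mu>)) (at B)"
proof -
  let ?\<Phi> = "\<lambda>B. integral\<^sup>L \<mu> (bethe_fun \<beta> B)" and ?m = "\<integral>c. tanh (lim_field \<beta> B c) \<partial>\<mu>"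
  \<comment> \<open>A common lower bound for all B' near \<open>B\<close>, which fixes the Lipschitz
    constants.\<close>
  define b where "b = B / 2"
  have b: "0 < b" "b \<le> B" using B by (simp_all add: b_def)
  define M where "M c = 1 + sinh \<beta> * exp \<beta> / b * root_deg c" for c
  define C where "C = flow_const \<beta> / b\<^sup>2"
  have M0: "0 \<le> M c" for c using \<beta> b by (simp add: M_def)
  note D = integrable_root_deg(1)
  have M: "integrable \<mu> M" unfolding M_def using D by simp
  have [measurable]: "M \<in> borel_measurable \<mu>" using M by simp
  have minM: "integrable \<mu> (\<lambda>c. M c * min 2 (\<bar>d\<bar> * M c))" for d
    by (rule Bochner_Integration.integrable_bound[OF integrable_mult_left[OF M, of 2]])
      (use M0 in \<open>auto simp: abs_mult intro!: mult_left_mono\<close>)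
  let ?R = "\<lambda>d. (\<integral>c. M c * min 2 (\<bar>d\<bar> * M c) \<partial>\<mu>) + C * \<bar>d\<bar> * integral\<^sup>L \<mu> root_deg"
  have main: "\<bar>(?\<Phi> B' - ?\<Phi> B) / (B' - B) - ?m\<bar> \<le> ?R (B' - B)" if B': "b \<le> B'" "B' \<noteq> B" for B'
  proof -
    let ?d = "B' - B"
    have B'0: "0 < B'" using b B' by simp
    define err where "err c = bethe_fun \<beta> B' c - bethe_fun \<beta> B c - ?d * tanh (lim_field \<beta> B c) - lim_edge_sum \<beta> B B' (edge_flow \<beta>) c" for c
    note ints = integrable_bethe_fun[OF \<beta> B] integrable_bethe_fun[OF \<beta> B'0] integrable_tanh_lim_field[OF \<beta> less_imp_le[OF B]]
      lim_edge_sum_limit(1)[OF \<beta> less_imp_le[OF B] less_imp_le[OF B'0] bounded_cont_edge_flow[OF \<beta>]]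
    have err_int: "integrable \<mu> err" unfolding err_def using ints by (intro Bochner_Integration.integrable_diff integrable_mult_right)
    have "integral\<^sup>L \<mu> err = ?\<Phi> B' - ?\<Phi> B - ?d * ?m"
      unfolding err_def using ints integral_edge_flow[OF \<beta> less_imp_le[OF B] less_imp_le[OF B'0]] by simp
    hence "\<bar>?\<Phi> B' - ?\<Phi> B - ?d * ?m\<bar> \<le> (\<integral>c. \<bar>err c\<bar> \<partial>\<mu>)"
      using integral_abs_bound[of \<mu> err] by simp
    also have "\<dots> \<le> (\<integral>c. \<bar>?d\<bar> * (M c * min 2 (\<bar>?d\<bar> * M c) + C * \<bar>?d\<bar> * root_deg c) \<partial>\<mu>)"
    proof (rule integral_mono)
      show "integrable \<mu> (\<lambda>c. \<bar>err c\<bar>)" using err_int by simp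
      show "integrable \<mu> (\<lambda>c. \<bar>?d\<bar> * (M c * min 2 (\<bar>?d\<bar> * M c) + C * \<bar>?d\<bar> * root_deg c))"
        using D minM by simp
      fix c :: "nat list \<Rightarrow> nat"
      let ?\<Delta> = "\<bar>lim_field \<beta> B' c - lim_field \<beta> B c\<bar>"
      have \<Delta>: "?\<Delta> \<le> \<bar>?d\<bar> * M c" using lim_field_diff_bound[OF \<beta> b B'(1)] unfolding M_def .
      hence "?\<Delta> * min 2 ?\<Delta> \<le> (\<bar>?d\<bar> * M c) * min 2 (\<bar>?d\<bar> * M c)" by (intro mult_mono) auto
      moreover have "flow_const \<beta> * (\<bar>?d\<bar> / b)\<^sup>2 * root_deg c = \<bar>?d\<bar> * (C * \<bar>?d\<bar> * root_deg c)"
        by (simp add: C_def power_divide power2_eq_square)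
      ultimately show "\<bar>err c\<bar> \<le> \<bar>?d\<bar> * (M c * min 2 (\<bar>?d\<bar> * M c) + C * \<bar>?d\<bar> * root_deg c)"
        using bethe_fun_expansion[OF \<beta> b B'(1), of c] unfolding err_def distrib_left mult.assoc by linarith
    qed
    also have "\<dots> = \<bar>?d\<bar> * ?R ?d" using D minM by simp
    finally have "\<bar>?\<Phi> B' - ?\<Phi> B - ?d * ?m\<bar> \<le> \<bar>?d\<bar> * ?R ?d" .
    moreover have "(?\<Phi> B' - ?\<Phi> B) / ?d - ?m = (?\<Phi> B' - ?\<Phi> B - ?d * ?m) / ?d"
      using B'(2) by (simp add: diff_divide_distrib)
    ultimately show ?thesis using B'(2) by (simp add: abs_divide divide_le_eq mult.commute)
  qed
  have "(?R \<longlongrightarrow> 0 + C * \<bar>0\<bar> * integral\<^sup>L \<mu> root_deg) (at 0)"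
    by (intro tendsto_intros integral_min_tendsto_0 M M0)
  hence R: "((\<lambda>B'. ?R (B' - B)) \<longlongrightarrow> 0) (at B)"
    by (simp add: LIM_offset_zero_iff[of B])
  have "((\<lambda>B'. (?\<Phi> B' - ?\<Phi> B) / (B' - B) - ?m) \<longlongrightarrow> 0) (at B)"
  proof (rule Lim_null_comparison[OF _ R])
    have "\<forall>\<^sub>F B' in at B. b < B'"
      using B by (intro order_tendstoD[OF tendsto_ident_at]) (simp add: b_def)
    moreover have "\<forall>\<^sub>F B' in at B. B' \<noteq> B" by (rule eventually_neq_at_within)
    ultimately show "\<forall>\<^sub>F B' in at B. norm ((?\<Phi> B' - ?\<Phi> B) / (B' - B) - ?m) \<le> ?R (B' - B)"
      by eventually_elim (simp add: main)
  qed
  thus ?thesis unfolding has_field_derivative_iff by (rule Lim_null[THEN iffD2])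
qed

end

section \<open>Free energy of the finite graphs\<close>

lemma abs_magnetization_le:
  assumes "finite V" "i \<in> V"
  shows "\<bar>magnetization \<beta> B R V (\<lambda>_. spins) i\<bar> \<le> 1"
proof -
  let ?w = "ising_weight \<beta> B R V"
  have Z: "0 < (\<Sum>\<sigma>\<in>configs V. ?w \<sigma>)"
    using assms by (intro sum_configs_pos) (auto simp: spins_def)
  have "\<bar>\<Sum>\<sigma>\<in>configs V. \<sigma> i * ?w \<sigma>\<bar> \<le> (\<Sum>\<sigma>\<in>configs V. \<bar>\<sigma> i * ?w \<sigma>\<bar>)" by (rule sum_abs)
  also have "\<dots> = (\<Sum>\<sigma>\<in>configs V. ?w \<sigma>)"
  proof (rule sum.cong[OF refl])
    fix \<sigma> assume "\<sigma> \<in> configs V"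
    hence "\<bar>\<sigma> i\<bar> = 1" using PiE_mem[of \<sigma> V "\<lambda>_. spins" i] assms(2) by (auto simp: spins_def)
    thus "\<bar>\<sigma> i * ?w \<sigma>\<bar> = ?w \<sigma>" by (simp add: abs_mult less_imp_le)
  qed
  finally show ?thesis using Z by (simp add: magnetization_def)
qed

definition ising_Z :: "real \<Rightarrow> nat \<Rightarrow> (nat \<Rightarrow> nat \<Rightarrow> bool) \<Rightarrow> real \<Rightarrow> real" where
  "ising_Z \<beta> n E B = (\<Sum>\<sigma>\<in>configs {..<n}. ising_weight \<beta> B E {..<n} \<sigma>)"

lemma factor_Z_ising:
  assumes E: "simple_graph_on n E"
  shows "factor_Z spins (ising_psi \<beta>) (ising_psibar B) n E = ising_Z \<beta> n E B"
proof -
  let ?S = "{(i, j). i < j \<and> j < n \<and> E i j}"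
  have "?S \<subseteq> {..<n} \<times> {..<n}" by auto
  hence fin: "finite ?S" by (rule finite_subset) simp
  have pairs: "(\<Sum>v<n. \<Sum>w<n. if E v w then \<sigma> v * \<sigma> w else 0) = 2 * (\<Sum>(i, j)\<in>?S. \<sigma> i * \<sigma> j)" for \<sigma> :: "nat \<Rightarrow> real"
  proof -
    have "(\<Sum>v<n. \<Sum>w<n. if E v w then \<sigma> v * \<sigma> w else 0) =
        (\<Sum>v<n. \<Sum>w<n. (if v < w \<and> E v w then \<sigma> v * \<sigma> w else 0) + (if w < v \<and> E w v then \<sigma> w * \<sigma> v else 0))"
      using E by (intro sum.cong refl) (auto simp: simple_graph_on_def)
    also have "\<dots> = 2 * (\<Sum>v<n. \<Sum>w<n. if v < w \<and> E v w then \<sigma> v * \<sigma> w else 0)"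
      by (simp add: sum.distrib sum.swap[of "\<lambda>v w. if w < v \<and> E w v then \<sigma> w * \<sigma> v else 0"])
    also have "(\<Sum>v<n. \<Sum>w<n. if v < w \<and> E v w then \<sigma> v * \<sigma> w else 0) =
        (\<Sum>p\<in>{..<n} \<times> {..<n}. if fst p < snd p \<and> E (fst p) (snd p) then \<sigma> (fst p) * \<sigma> (snd p) else 0)"
      by (simp add: sum.cartesian_product split_def)
    also have "\<dots> = (\<Sum>(i, j)\<in>?S. \<sigma> i * \<sigma> j)"
      by (rule sum.mono_neutral_cong_right) auto
    finally show ?thesis .
  qed
  have "(\<Prod>(i, j)\<in>?S. ising_psi \<beta> (\<sigma> i) (\<sigma> j)) * (\<Prod>i\<in>{0..<n}. ising_psibar B (\<sigma> i)) = ising_weight \<beta> B E {..<n} \<sigma>" for \<sigma>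
  proof -
    have "(\<Prod>(i, j)\<in>?S. ising_psi \<beta> (\<sigma> i) (\<sigma> j)) = exp (\<beta> * (\<Sum>(i, j)\<in>?S. \<sigma> i * \<sigma> j))"
      unfolding sum_distrib_left exp_sum[OF fin] ising_psi_def by (intro prod.cong refl) (auto simp: mult.assoc)
    moreover have "(\<Prod>i\<in>{0..<n}. ising_psibar B (\<sigma> i)) = exp (B * (\<Sum>i<n. \<sigma> i))"
      by (simp add: ising_psibar_def exp_sum sum_distrib_left atLeast0LessThan)
    ultimately show ?thesis unfolding ising_weight_def pairs by (simp add: exp_add)
  qed
  thus ?thesis by (simp add: factor_Z_def ising_Z_def atLeast0LessThan)
qed

lemma ising_Z_pos: "0 < ising_Z \<beta> n E B"
  unfolding ising_Z_def by (intro sum_configs_pos) (auto simp: spins_def)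

lemma ln_ising_Z_has_derivative:
  "((\<lambda>B. ln (ising_Z \<beta> n E B)) has_real_derivative (\<Sum>i<n. magnetization \<beta> B E {..<n} (\<lambda>_. spins) i)) (at B)"
proof -
  have "((\<lambda>B. ising_weight \<beta> B E {..<n} \<sigma>) has_real_derivative (\<Sum>i<n. \<sigma> i) * ising_weight \<beta> B E {..<n} \<sigma>) (at B)" for \<sigma>
    unfolding ising_weight_def by (auto intro!: derivative_eq_intros)
  hence "((\<lambda>B. ising_Z \<beta> n E B) has_real_derivative (\<Sum>\<sigma>\<in>configs {..<n}. (\<Sum>i<n. \<sigma> i) * ising_weight \<beta> B E {..<n} \<sigma>)) (at B)"
    unfolding ising_Z_def by (intro DERIV_sum)
  hence "((\<lambda>B. ln (ising_Z \<beta> n E B)) has_real_derivative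
      (\<Sum>\<sigma>\<in>configs {..<n}. (\<Sum>i<n. \<sigma> i) * ising_weight \<beta> B E {..<n} \<sigma>) / ising_Z \<beta> n E B) (at B)"
    using ising_Z_pos by (auto intro!: derivative_eq_intros)
  also have "(\<Sum>\<sigma>\<in>configs {..<n}. (\<Sum>i<n. \<sigma> i) * ising_weight \<beta> B E {..<n} \<sigma>) =
      (\<Sum>i<n. \<Sum>\<sigma>\<in>configs {..<n}. \<sigma> i * ising_weight \<beta> B E {..<n} \<sigma>)"
    unfolding sum_distrib_right by (rule sum.swap)
  finally show ?thesis by (simp add: magnetization_def ising_Z_def sum_divide_distrib)
qed

lemma ising_Z_uminus: "ising_Z \<beta> n E (- B) = ising_Z \<beta> n E B"
proof -
  let ?V = "{..<n}"
  define \<rho> where "\<rho> = (\<lambda>v\<in>?V. - 1 :: real)"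
  have \<rho>: "\<rho> \<in> configs ?V" by (auto simp: \<rho>_def spins_def)
  have inv: "flip ?V \<rho> (flip ?V \<rho> \<sigma>) = \<sigma>" "flip ?V \<rho> \<sigma> \<in> configs ?V" if "\<sigma> \<in> configs ?V" for \<sigma>
    using flip_flip[OF \<rho> that] flip_in_configs[OF \<rho> that] by auto
  have w: "ising_weight \<beta> (- B) E ?V (flip ?V \<rho> \<sigma>) = ising_weight \<beta> B E ?V \<sigma>" for \<sigma>
  proof -
    have "flip ?V \<rho> \<sigma> = restrict (\<lambda>v. - \<sigma> v) ?V" by (auto simp: flip_def \<rho>_def)
    thus ?thesis
      by (simp only: ising_weight_restrict) (simp add: ising_weight_def sum_negf cong: if_cong)
  qed
  have w': "ising_weight \<beta> B E ?V (flip ?V \<rho> \<sigma>) = ising_weight \<beta> (- B) E ?V \<sigma>" if "\<sigma> \<in> configs ?V" for \<sigma>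
    using w[of "flip ?V \<rho> \<sigma>"] inv(1)[OF that] by simp
  show ?thesis unfolding ising_Z_def
    by (rule sum.reindex_bij_witness[where i = "flip ?V \<rho>" and j = "flip ?V \<rho>"]) (simp_all add: inv w')
qed

text \<open>All spins +1 give the lower bound. For the upper one, each edge factor is replaced by
  its maximum exp \<beta>, which leaves independent spins. The degree sum counts edges twice, hence
  \<beta> / 2.\<close>

lemma ln_ising_Z_bounds:
  assumes \<beta>: "0 \<le> \<beta>" and E: "simple_graph_on n E"
  shows "\<beta> / 2 * (\<Sum>i<n. real (deg E i)) + real n * B \<le> ln (ising_Z \<beta> n E B)"
    and "ln (ising_Z \<beta> n E B) \<le> \<beta> / 2 * (\<Sum>i<n. real (deg E i)) + real n * ln (2 * cosh B)"
proof -
  let ?V = "{..<n}"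
  have deg: "(\<Sum>v<n. \<Sum>w<n. if E v w then 1 else 0) = (\<Sum>i<n. real (deg E i))"
  proof (rule sum.cong[OF refl])
    fix v
    have "(\<Sum>w<n. if E v w then 1 else 0) = real (card {w \<in> {..<n}. E v w})"
      by (simp add: sum.If_cases Int_def)
    also have "{w \<in> {..<n}. E v w} = {w. E v w}" using E by (auto simp: simple_graph_on_def)
    finally show "(\<Sum>w<n. if E v w then 1 else 0) = real (deg E v)" by (simp add: deg_def)
  qed
  have fin: "finite (configs ?V)" by simp
  let ?one = "\<lambda>v\<in>?V. 1 :: real"
  have one: "?one \<in> configs ?V" by (auto simp: spins_def)
  have "exp (\<beta> / 2 * (\<Sum>i<n. real (deg E i)) + real n * B) = ising_weight \<beta> B E ?V ?one"
    unfolding ising_weight_restrict unfolding ising_weight_def by (simp add: deg[symmetric])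
  also have "\<dots> \<le> ising_Z \<beta> n E B"
    unfolding ising_Z_def by (rule member_le_sum[OF one]) (auto simp: less_imp_le)
  finally have "exp (\<beta> / 2 * (\<Sum>i<n. real (deg E i)) + real n * B) \<le> ising_Z \<beta> n E B" .
  thus "\<beta> / 2 * (\<Sum>i<n. real (deg E i)) + real n * B \<le> ln (ising_Z \<beta> n E B)"
    using ising_Z_pos[of \<beta> n E B] by (simp add: ln_ge_iff)
  have "ising_weight \<beta> B E ?V \<sigma> \<le> exp (\<beta> / 2 * (\<Sum>i<n. real (deg E i))) * (\<Prod>i<n. exp (B * \<sigma> i))" if \<sigma>: "\<sigma> \<in> configs ?V" for \<sigma>
  proof -
    have s: "\<sigma> v \<in> spins" if "v < n" for v using PiE_mem[OF \<sigma>, of v] that by simp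
    have "(\<Sum>v<n. \<Sum>w<n. if E v w then \<sigma> v * \<sigma> w else 0) \<le> (\<Sum>v<n. \<Sum>w<n. if E v w then 1 else 0)"
    proof (intro sum_mono)
      fix v w assume "v \<in> ?V" "w \<in> ?V"
      thus "(if E v w then \<sigma> v * \<sigma> w else 0) \<le> (if E v w then 1 else 0)"
        using s[of v] s[of w] by (auto simp: spins_def)
    qed
    hence "\<beta> / 2 * (\<Sum>v<n. \<Sum>w<n. if E v w then \<sigma> v * \<sigma> w else 0) \<le> \<beta> / 2 * (\<Sum>i<n. real (deg E i))"
      unfolding deg using \<beta> by (intro mult_left_mono) auto
    thus ?thesis
      unfolding ising_weight_def exp_add by (simp add: exp_sum[symmetric] sum_distrib_left mult_right_mono)
  qed
  hence "ising_Z \<beta> n E B \<le> (\<Sum>\<sigma>\<in>configs ?V. exp (\<beta> / 2 * (\<Sum>i<n. real (deg E i))) * (\<Prod>i<n. exp (B * \<sigma> i)))"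
    unfolding ising_Z_def by (rule sum_mono)
  also have "\<dots> = exp (\<beta> / 2 * (\<Sum>i<n. real (deg E i))) * (\<Prod>i<n. \<Sum>s\<in>spins. exp (B * s))"
    by (subst prod_sum_PiE) (simp_all add: sum_distrib_left)
  also have "(\<Sum>s\<in>spins. exp (B * s)) = 2 * cosh B" by (simp add: sum_spins cosh_def)
  finally have "ln (ising_Z \<beta> n E B) \<le> ln (exp (\<beta> / 2 * (\<Sum>i<n. real (deg E i))) * (2 * cosh B) ^ n)"
    using ising_Z_pos by (subst ln_le_cancel_iff) simp_all
  also have "\<dots> = \<beta> / 2 * (\<Sum>i<n. real (deg E i)) + real n * ln (2 * cosh B)"
    using ln_realpow[of "2 * cosh B" n] by (subst ln_mult_pos) (simp_all del: power_mult_distrib)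
  finally show "ln (ising_Z \<beta> n E B) \<le> \<beta> / 2 * (\<Sum>i<n. real (deg E i)) + real n * ln (2 * cosh B)" .
qed

context local_weak_limit
begin

section \<open>Free energy and mean magnetization of the random graphs\<close>

lemma ising_phi_n_eq:
  "ising_phi_n G \<beta> B n = (\<Sum>E\<in>set_pmf (G n). pmf (G n) E * ln (ising_Z \<beta> n E B)) / real n"
  unfolding ising_phi_n_def factor_phi_n_def expectation_pmf_eq
  using factor_Z_ising[OF simple_graph] by (simp cong: sum.cong)

definition mean_magnetization :: "real \<Rightarrow> nat \<Rightarrow> real \<Rightarrow> real" where
  "mean_magnetization \<beta> n B = En G n (\<lambda>E i. magnetization \<beta> B E {..<n} (\<lambda>_. spins) i)"

lemma ising_phi_n_has_derivative:
  "((\<lambda>B. ising_phi_n G \<beta> B n) has_real_derivative mean_magnetization \<beta> n B) (at B)"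
  unfolding ising_phi_n_eq mean_magnetization_def En_eq
  by (intro DERIV_cdivide DERIV_sum DERIV_cmult ln_ising_Z_has_derivative)

lemma ising_phi_n_uminus: "ising_phi_n G \<beta> (- B) n = ising_phi_n G \<beta> B n"
  unfolding ising_phi_n_eq ising_Z_uminus ..

lemma abs_mean_magnetization_le: "\<bar>mean_magnetization \<beta> n B\<bar> \<le> 1"
proof (cases "n = 0")
  case False
  have mag: "\<bar>magnetization \<beta> B E {..<n} (\<lambda>_. spins) i\<bar> \<le> 1" if "i < n" for E i
    using that by (intro abs_magnetization_le) auto
  have "mean_magnetization \<beta> n B \<le> En G n (\<lambda>E i. 1)" "En G n (\<lambda>E i. - 1) \<le> mean_magnetization \<beta> n B"
    unfolding mean_magnetization_def using mag by (intro En_mono; simp add: abs_le_iff)+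
  thus ?thesis using False by (simp add: En_const)
qed (simp add: mean_magnetization_def En_eq)

lemma ising_phi_n_lipschitz: "\<bar>ising_phi_n G \<beta> B' n - ising_phi_n G \<beta> B n\<bar> \<le> \<bar>B' - B\<bar>"
proof -
  have *: "\<bar>ising_phi_n G \<beta> B' n - ising_phi_n G \<beta> B n\<bar> \<le> \<bar>B' - B\<bar>" if less: "B < B'" for B B'
  proof -
    obtain z where z: "ising_phi_n G \<beta> B' n - ising_phi_n G \<beta> B n = (B' - B) * mean_magnetization \<beta> n z"
      using MVT2[OF less, of "\<lambda>B. ising_phi_n G \<beta> B n" "mean_magnetization \<beta> n"] ising_phi_n_has_derivative by blast
    have "\<bar>B' - B\<bar> * \<bar>mean_magnetization \<beta> n z\<bar> \<le> \<bar>B' - B\<bar> * 1"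
      by (intro mult_left_mono abs_mean_magnetization_le) simp
    thus ?thesis unfolding z abs_mult by simp
  qed
  show ?thesis using *[of B B'] *[of B' B] by (cases B B' rule: linorder_cases) (auto simp: abs_minus_commute)
qed

text \<open>The error is the same for all \<open>n\<close>, so a large field can be fixed before
  \<open>n\<close> tends to infinity.\<close>

lemma ising_phi_n_large_field:
  assumes "0 \<le> \<beta>" "0 < n"
  shows "\<bar>ising_phi_n G \<beta> B n - (B + \<beta> / 2 * En G n (\<lambda>E i. real (deg E i)))\<bar> \<le> exp (- 2 * B)"
proof -
  let ?D = "En G n (\<lambda>E i. real (deg E i))"
  have avg: "(\<Sum>E\<in>set_pmf (G n). pmf (G n) E * (\<beta> / 2 * (\<Sum>i<n. real (deg E i)) + real n * b)) / real n = \<beta> / 2 * ?D + b" for b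
  proof -
    have "(\<Sum>E\<in>set_pmf (G n). pmf (G n) E * (\<beta> / 2 * (\<Sum>i<n. real (deg E i)) + real n * b)) =
        \<beta> / 2 * (\<Sum>E\<in>set_pmf (G n). pmf (G n) E * (\<Sum>i<n. real (deg E i))) + (\<Sum>E\<in>set_pmf (G n). pmf (G n) E) * (real n * b)"
      by (simp add: distrib_left sum.distrib sum_distrib_left sum_distrib_right mult_ac)
    also have "(\<Sum>E\<in>set_pmf (G n). pmf (G n) E) = 1" by (rule sum_pmf_eq_1) auto
    finally show ?thesis using assms(2) by (simp add: En_eq add_divide_distrib)
  qed
  have "\<beta> / 2 * ?D + B \<le> ising_phi_n G \<beta> B n"
    unfolding avg[symmetric] ising_phi_n_eq
    by (intro divide_right_mono sum_mono mult_left_mono ln_ising_Z_bounds assms simple_graph) auto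
  moreover have "ising_phi_n G \<beta> B n \<le> \<beta> / 2 * ?D + ln (2 * cosh B)"
    unfolding avg[symmetric] ising_phi_n_eq
    by (intro divide_right_mono sum_mono mult_left_mono ln_ising_Z_bounds assms simple_graph) auto
  ultimately show ?thesis using ln_2_cosh_bounds(2)[of B] by (simp add: abs_le_iff)
qed

lemma integrable_bounded_measurable:
  fixes F :: "(nat list \<Rightarrow> nat) \<Rightarrow> real"
  assumes "\<And>c. \<bar>F c\<bar> \<le> K" "\<And>c c'. tree_ball_iso t c c' \<Longrightarrow> F c = F c'"
  shows "integrable \<mu> F"
  by (rule integrable_const_bound[where B = K]) (use assms measurable_iso_invariant[OF assms(2)] in auto)

lemma integral_tanh_tendsto:
  fixes F :: "nat \<Rightarrow> (nat list \<Rightarrow> nat) \<Rightarrow> real"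
  assumes "0 \<le> \<beta>" "0 \<le> B" "\<And>k. F k \<in> borel_measurable \<mu>" "\<And>c. (\<lambda>k. F k c) \<longlonglongrightarrow> lim_field \<beta> B c"
  shows "(\<lambda>k. \<integral>c. tanh (F k c) \<partial>\<mu>) \<longlonglongrightarrow> (\<integral>c. tanh (lim_field \<beta> B c) \<partial>\<mu>)"
proof (rule integral_dominated_convergence[where w = "\<lambda>_. 1"])
  have "(tanh :: real \<Rightarrow> real) \<in> borel_measurable borel"
    by (intro borel_measurable_continuous_onI continuous_intros) auto
  thus "(\<lambda>c. tanh (F k c)) \<in> borel_measurable \<mu>" for k
    by (rule measurable_compose[OF assms(3)])
  show "AE c in \<mu>. (\<lambda>k. tanh (F k c)) \<longlonglongrightarrow> tanh (lim_field \<beta> B c)"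
    by (intro AE_I2 tendsto_intros assms) simp
qed (use integrable_tanh_lim_field[OF assms(1,2)] in \<open>auto simp: abs_tanh_le\<close>)

text \<open>At fixed depth the magnetization is squeezed between two local functions on tree-like
  balls; the Fatou bound passes these to the limit law, and the two functions merge as the depth
  grows.\<close>

lemma mean_magnetization_tendsto:
  assumes \<beta>: "0 \<le> \<beta>" and B: "0 < B"
  shows "(\<lambda>n. mean_magnetization \<beta> n B) \<longlonglongrightarrow> (\<integral>c. tanh (lim_field \<beta> B c) \<partial>\<mu>)"
proof (rule tendstoI)
  fix \<epsilon> :: real assume "0 < \<epsilon>"
  hence e: "0 < \<epsilon> / 2" by simp
  let ?m = "\<integral>c. tanh (lim_field \<beta> B c) \<partial>\<mu>"
  let ?mag = "\<lambda>(n :: nat) E i. magnetization \<beta> B E {..<n} (\<lambda>_. spins) i"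
  obtain \<kappa> K where \<kappa>: "0 \<le> \<kappa>" "\<kappa> < 1"
    "\<And>t c. plus_field \<beta> B (Suc t) c \<le> (1 + K * \<kappa> ^ t) * free_field \<beta> B (Suc t) c"
    using plus_field_le_scale[OF \<beta> B] by metis
  \<comment> \<open>On a tree-like ball of radius t + 2 the lower bound is the free field of depth t
    + 2 and the upper bound the plus field of depth t + 1.\<close>
  define lo where "lo t c = free_field \<beta> B (Suc (Suc t)) c" for t c
  \<comment> \<open>A multiple of the free field stands in for the plus field, since locality and
    the limit are already available for free fields.\<close>
  define up where "up t c = (1 + K * \<kappa> ^ t) * free_field \<beta> B (Suc t) c" for t c
  have lo_inv: "lo t c = lo t c'" if "tree_ball_iso (Suc (Suc t)) c c'" for t c c'
    unfolding lo_def by (rule free_field_tree_ball_iso[OF that])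
  have up_inv: "up t c = up t c'" if "tree_ball_iso (Suc (Suc t)) c c'" for t c c'
    using free_field_tree_ball_iso[OF tree_ball_iso_mono[OF that, of "Suc t"]] unfolding up_def
    by (simp del: tree_field.simps)
  have free: "(\<lambda>t. free_field \<beta> B t c) \<longlonglongrightarrow> lim_field \<beta> B c" for c
    using B by (intro free_field_tendsto \<beta>) simp
  have free_Suc: "(\<lambda>t. free_field \<beta> B (Suc t) c) \<longlonglongrightarrow> lim_field \<beta> B c" for c
    by (rule LIMSEQ_Suc[OF free])
  have "(\<lambda>t. up t c) \<longlonglongrightarrow> (1 + K * 0) * lim_field \<beta> B c" for c
    unfolding up_def by (intro tendsto_intros LIMSEQ_power_zero free_Suc) (use \<kappa>(1,2) in simp)
  hence up_lim: "(\<lambda>t. up t c) \<longlonglongrightarrow> lim_field \<beta> B c" for c by simp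
  have lo_lim: "(\<lambda>t. lo t c) \<longlonglongrightarrow> lim_field \<beta> B c" for c
    unfolding lo_def by (rule LIMSEQ_Suc[OF free_Suc])
  have lo_meas: "lo t \<in> borel_measurable \<mu>" and up_meas: "up t \<in> borel_measurable \<mu>" for t
    by (rule measurable_iso_invariant[OF lo_inv], assumption) (rule measurable_iso_invariant[OF up_inv], assumption)
  have "\<forall>\<^sub>F t in sequentially. ?m - \<epsilon> / 2 < (\<integral>c. tanh (lo t c) \<partial>\<mu>)"
    using e by (intro order_tendstoD(1)[OF integral_tanh_tendsto[OF \<beta> less_imp_le[OF B] lo_meas lo_lim]]) simp
  moreover have "\<forall>\<^sub>F t in sequentially. (\<integral>c. tanh (up t c) \<partial>\<mu>) < ?m + \<epsilon> / 2"
    using e by (intro order_tendstoD(2)[OF integral_tanh_tendsto[OF \<beta> less_imp_le[OF B] up_meas up_lim]]) simp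
  ultimately have "\<exists>t. ?m - \<epsilon> / 2 < (\<integral>c. tanh (lo t c) \<partial>\<mu>) \<and> (\<integral>c. tanh (up t c) \<partial>\<mu>) < ?m + \<epsilon> / 2"
    by (intro eventually_happens'[OF sequentially_bot] eventually_conj)
  then obtain t where t: "?m - \<epsilon> / 2 < (\<integral>c. tanh (lo t c) \<partial>\<mu>)" "(\<integral>c. tanh (up t c) \<partial>\<mu>) < ?m + \<epsilon> / 2"
    by (elim exE conjE)
  have mag: "\<bar>?mag n E i\<bar> \<le> 1" if "i < n" for n E i
    using that by (intro abs_magnetization_le) auto
  have bounds: "tanh (lo t c) \<le> ?mag n E i" "?mag n E i \<le> tanh (up t c)"
    if "E \<in> set_pmf (G n)" "i < n" "ball_iso_tree E i (Suc (Suc t)) c" for n E i c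
  proof -
    note * = magnetization_bounds[OF simple_graph[OF that(1)] that(2,3) \<beta> less_imp_le[OF B]]
    show "tanh (lo t c) \<le> ?mag n E i" using *(1) unfolding lo_def .
    have "tanh (plus_field \<beta> B (Suc t) c) \<le> tanh (up t c)"
      unfolding up_def tanh_real_le_iff by (rule \<kappa>(3))
    thus "?mag n E i \<le> tanh (up t c)" using *(2) by linarith
  qed
  have int_lo: "integrable \<mu> (\<lambda>c. tanh (lo t c))"
    by (rule integrable_bounded_measurable[where K = 1 and t = "Suc (Suc t)"]) (auto simp: abs_tanh_le dest: lo_inv)
  have int_up: "integrable \<mu> (\<lambda>c. tanh (up t c))"
    by (rule integrable_bounded_measurable[where K = 1 and t = "Suc (Suc t)"]) (auto simp: abs_tanh_le dest: up_inv)
  \<comment> \<open>The Fatou bound takes nonnegative functions and works from below only, so it is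
    used once with 1 + tanh and once with 1 - tanh.\<close>
  have tanh1: "0 \<le> 1 + tanh x" "0 \<le> 1 - tanh x" for x :: real
    using abs_tanh_le[of x] by (auto simp: abs_le_iff)
  have "\<forall>\<^sub>F n in sequentially. (\<integral>c. 1 + tanh (lo t c) \<partial>\<mu>) - \<epsilon> / 2 < En G n (\<lambda>E i. 1 + ?mag n E i)"
  proof (rule En_fatou[where t = "Suc (Suc t)", OF tanh1(1) _ _ _ _ e])
    show "integrable \<mu> (\<lambda>c. 1 + tanh (lo t c))" using int_lo by simp
    show "0 \<le> 1 + ?mag n E i" if "i < n" for n E i using mag[OF that, of E] by (simp add: abs_le_iff)
  qed (use bounds(1) in \<open>auto dest: lo_inv\<close>)
  moreover have "\<forall>\<^sub>F n in sequentially. (\<integral>c. 1 - tanh (up t c) \<partial>\<mu>) - \<epsilon> / 2 < En G n (\<lambda>E i. 1 - ?mag n E i)"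
  proof (rule En_fatou[where t = "Suc (Suc t)", OF tanh1(2) _ _ _ _ e])
    show "integrable \<mu> (\<lambda>c. 1 - tanh (up t c))" using int_up by simp
    show "0 \<le> 1 - ?mag n E i" if "i < n" for n E i using mag[OF that, of E] by (simp add: abs_le_iff)
  qed (use bounds(2) in \<open>auto dest: up_inv\<close>)
  moreover have "\<forall>\<^sub>F n in sequentially. 0 < n" by (rule eventually_gt_at_top)
  ultimately show "\<forall>\<^sub>F n in sequentially. dist (mean_magnetization \<beta> n B) ?m < \<epsilon>"
  proof eventually_elim
    case (elim n)
    have "- \<epsilon> / 2 + (\<integral>c. tanh (lo t c) \<partial>\<mu>) < mean_magnetization \<beta> n B"
      "mean_magnetization \<beta> n B < (\<integral>c. tanh (up t c) \<partial>\<mu>) + \<epsilon> / 2"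
      using elim int_lo int_up by (simp_all add: mean_magnetization_def En_add En_diff En_const)
    thus ?case using t by (simp add: dist_real_def abs_less_iff)
  qed
qed

text \<open>Both sides are integrals of their derivatives over \<open>{B..B'}\<close>; the
  integrands converge pointwise and are bounded by 1.\<close>

lemma ising_phi_n_increment:
  assumes \<beta>: "0 \<le> \<beta>" and B: "0 < B" "B \<le> B'"
  shows "(\<lambda>n. ising_phi_n G \<beta> B' n - ising_phi_n G \<beta> B n) \<longlonglongrightarrow>
     integral\<^sup>L \<mu> (bethe_fun \<beta> B') - integral\<^sup>L \<mu> (bethe_fun \<beta> B)"
proof -
  let ?m = "\<lambda>b. \<integral>c. tanh (lim_field \<beta> b c) \<partial>\<mu>"
  have phi: "(mean_magnetization \<beta> n has_integral ising_phi_n G \<beta> B' n - ising_phi_n G \<beta> B n) {B..B'}" for n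
    by (rule fundamental_theorem_of_calculus[OF B(2)])
      (auto simp: has_real_derivative_iff_has_vector_derivative[symmetric]
        intro: has_field_derivative_at_within ising_phi_n_has_derivative)
  have Phi: "(?m has_integral integral\<^sup>L \<mu> (bethe_fun \<beta> B') - integral\<^sup>L \<mu> (bethe_fun \<beta> B)) {B..B'}"
    by (rule fundamental_theorem_of_calculus[OF B(2)])
      (use B in \<open>auto simp: has_real_derivative_iff_has_vector_derivative[symmetric]
        intro!: has_field_derivative_at_within[OF bethe_has_derivative[OF \<beta>]]\<close>)
  have "(\<lambda>n. integral {B..B'} (mean_magnetization \<beta> n)) \<longlonglongrightarrow> integral {B..B'} ?m"
  proof (rule dominated_convergence(2)[where h = "\<lambda>_. 1"])
    show "mean_magnetization \<beta> n integrable_on {B..B'}" for n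
      using phi by (rule has_integral_integrable)
    show "(\<lambda>_. 1 :: real) integrable_on {B..B'}"
      by (intro integrable_continuous_real continuous_intros)
    show "norm (mean_magnetization \<beta> n b) \<le> 1" for n b using abs_mean_magnetization_le by simp
    show "(\<lambda>n. mean_magnetization \<beta> n b) \<longlonglongrightarrow> ?m b" if "b \<in> {B..B'}" for b
      using that B by (intro mean_magnetization_tendsto \<beta>) auto
  qed
  thus ?thesis unfolding integral_unique[OF phi] integral_unique[OF Phi] .
qed

text \<open>The increments fix the limit up to a constant, which is determined at a large field
  \<open>b\<close>, where both sides are close to b + \<beta> / 2 times the mean degree.\<close>

lemma ising_phi_n_tendsto:
  assumes \<beta>: "0 \<le> \<beta>" and B: "0 < B"
  shows "(\<lambda>n. ising_phi_n G \<beta> B n) \<longlonglongrightarrow> integral\<^sup>L \<mu> (bethe_fun \<beta> B)"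
proof (rule tendstoI)
  fix \<epsilon> :: real assume "0 < \<epsilon>"
  hence e: "0 < \<epsilon> / 4" by simp
  let ?\<Phi> = "\<lambda>b. integral\<^sup>L \<mu> (bethe_fun \<beta> b)" and ?D = "integral\<^sup>L \<mu> root_deg"
  let ?Dn = "\<lambda>n. En G n (\<lambda>E i. real (deg E i))"
  let ?r = "\<lambda>b. exp (- 2 * b) + 2 * (sinh \<beta> * exp \<beta>) * (1 - tanh b) * ?D"
  have exp0: "((\<lambda>b :: real. exp (- 2 * b)) \<longlongrightarrow> 0) at_top"
    by (intro filterlim_compose[OF exp_at_bot] filterlim_tendsto_neg_mult_at_bot[OF tendsto_const _ filterlim_ident]) simp
  have "(?r \<longlongrightarrow> 0 + 2 * (sinh \<beta> * exp \<beta>) * (1 - 1) * ?D) at_top"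
    by (intro tendsto_intros exp0 tanh_real_at_top)
  hence "(?r \<longlongrightarrow> 0) at_top" by simp
  hence "\<forall>\<^sub>F b in at_top. exp (- 2 * b) < \<epsilon> / 4 \<and> ?r b < \<epsilon> / 4 \<and> B \<le> b"
    using e exp0 by (intro eventually_conj order_tendstoD(2)[of _ 0 at_top] eventually_ge_at_top) auto
  \<comment> \<open>One \<epsilon> / 4 each for the large-field error on the graphs, that of the
    Bethe functional, the increment from \<open>B\<close> to \<open>b\<close>, and the mean
    degree.\<close>
  then obtain b where b: "exp (- 2 * b) < \<epsilon> / 4" "?r b < \<epsilon> / 4" "B \<le> b"
    using eventually_happens'[OF trivial_limit_at_top_linorder] by blast
  have b0: "0 < b" using b(3) B by simp
  have Phi: "\<bar>?\<Phi> b - (b + \<beta> / 2 * ?D)\<bar> < \<epsilon> / 4"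
    using integral_bethe_large_field[OF \<beta> b0] b(2) by linarith
  have "\<forall>\<^sub>F n in sequentially. dist (ising_phi_n G \<beta> b n - ising_phi_n G \<beta> B n) (?\<Phi> b - ?\<Phi> B) < \<epsilon> / 4"
    by (rule tendstoD[OF ising_phi_n_increment[OF \<beta> B b(3)] e])
  moreover have "\<forall>\<^sub>F n in sequentially. dist (\<beta> / 2 * ?Dn n) (\<beta> / 2 * ?D) < \<epsilon> / 4"
    by (rule tendstoD[OF tendsto_mult_left[OF En_deg_tendsto] e])
  moreover have "\<forall>\<^sub>F n in sequentially. 0 < n" by (rule eventually_gt_at_top)
  ultimately show "\<forall>\<^sub>F n in sequentially. dist (ising_phi_n G \<beta> B n) (?\<Phi> B) < \<epsilon>"
  proof eventually_elim
    case (elim n)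
    have "\<bar>ising_phi_n G \<beta> b n - (b + \<beta> / 2 * ?Dn n)\<bar> < \<epsilon> / 4"
      using ising_phi_n_large_field[OF \<beta> elim(3), of b] b(1) by linarith
    thus ?case using elim(1,2) Phi unfolding dist_real_def by linarith
  qed
qed

end

text \<open>The Lipschitz constant is the same for all \<open>n\<close>: the sequence at
  \<open>a\<close> stays within e / 4 of a Cauchy sequence at a nearby point, and the limits inherit
  the Lipschitz bound.\<close>

lemma convergent_extend_lipschitz:
  fixes f :: "real \<Rightarrow> nat \<Rightarrow> real"
  assumes lip: "\<And>x y n. \<bar>f x n - f y n\<bar> \<le> \<bar>x - y\<bar>"
    and conv: "\<And>x. x \<noteq> a \<Longrightarrow> convergent (f x)"
  shows "convergent (f a)" "((\<lambda>x. lim (f x)) \<longlongrightarrow> lim (f a)) (at a)"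
proof -
  show conv_a: "convergent (f a)"
    unfolding Cauchy_convergent_iff[symmetric]
  proof (rule CauchyI)
    fix e :: real assume e: "0 < e"
    let ?x = "a + e / 4"
    have "Cauchy (f ?x)" using conv[of ?x] e by (simp add: Cauchy_convergent_iff)
    then obtain M where M: "\<And>m n. M \<le> m \<Longrightarrow> M \<le> n \<Longrightarrow> \<bar>f ?x m - f ?x n\<bar> < e / 4"
      using e unfolding Cauchy_iff by (metis real_norm_def zero_less_divide_iff zero_less_numeral)
    have "\<bar>f a m - f a n\<bar> < e" if "M \<le> m" "M \<le> n" for m n
      using M[OF that] lip[where x = a and y = ?x and n = m] lip[where x = ?x and y = a and n = n] e by linarith
    thus "\<exists>M. \<forall>m\<ge>M. \<forall>n\<ge>M. norm (f a m - f a n) < e" by auto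
  qed
  have bound: "norm (lim (f x) - lim (f a)) \<le> \<bar>x - a\<bar>" for x
  proof -
    have x: "f x \<longlonglongrightarrow> lim (f x)" using conv[of x] conv_a by (cases "x = a") (simp_all add: convergent_LIMSEQ_iff)
    have a: "f a \<longlonglongrightarrow> lim (f a)" using conv_a by (simp add: convergent_LIMSEQ_iff)
    have "(\<lambda>n. norm (f x n - f a n)) \<longlonglongrightarrow> norm (lim (f x) - lim (f a))"
      by (intro tendsto_norm tendsto_diff x a)
    moreover have "\<exists>N. \<forall>n\<ge>N. norm (f x n - f a n) \<le> \<bar>x - a\<bar>"
      unfolding real_norm_def using lip by blast
    ultimately show ?thesis by (rule LIMSEQ_le_const2)
  qed
  have "((\<lambda>x. \<bar>x - a\<bar>) \<longlongrightarrow> \<bar>a - a\<bar>) (at a)"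
    by (intro tendsto_rabs tendsto_diff tendsto_ident_at tendsto_const)
  hence "((\<lambda>x. \<bar>x - a\<bar>) \<longlongrightarrow> 0) (at a)" by simp
  hence "((\<lambda>x. lim (f x) - lim (f a)) \<longlongrightarrow> 0) (at a)"
    by (rule Lim_null_comparison[OF always_eventually[OF allI[OF bound]]])
  thus "((\<lambda>x. lim (f x)) \<longlongrightarrow> lim (f a)) (at a)" by (rule Lim_null[THEN iffD2])
qed

theorem mainTheorem1:
  fixes G :: "nat \<Rightarrow> (nat \<Rightarrow> nat \<Rightarrow> bool) pmf"
    and \<mu> :: "(nat list \<Rightarrow> nat) measure"
    and \<beta> :: real
  assumes "lwc G \<mu>" and "\<beta> \<ge> 0"
  shows "(\<forall>B>0.
            (\<lambda>n. ising_phi_n G \<beta> B n) \<longlonglongrightarrow>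
               bethe_mu spins (ising_psi \<beta>) (ising_psibar B) \<mu> (h_free \<beta> B) \<and>
            bethe_mu spins (ising_psi \<beta>) (ising_psibar B) \<mu> (h_free \<beta> B) =
               bethe_mu spins (ising_psi \<beta>) (ising_psibar B) \<mu> (h_plus \<beta> B) \<and>
            convergent (\<lambda>n. ising_phi_n G \<beta> (-B) n) \<and>
            lim (\<lambda>n. ising_phi_n G \<beta> B n) = lim (\<lambda>n. ising_phi_n G \<beta> (-B) n))
       \<and> convergent (\<lambda>n. ising_phi_n G \<beta> 0 n)
       \<and> ((\<lambda>B. lim (\<lambda>n. ising_phi_n G \<beta> B n)) \<longlongrightarrow> lim (\<lambda>n. ising_phi_n G \<beta> 0 n)) (at 0)"
proof -
  interpret local_weak_limit G \<mu> by unfold_locales (rule assms(1))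
  have bethe: "bethe_mu spins (ising_psi \<beta>) (ising_psibar B) \<mu> (h_free \<beta> B) = integral\<^sup>L \<mu> (bethe_fun \<beta> B)"
    "bethe_mu spins (ising_psi \<beta>) (ising_psibar B) \<mu> (h_plus \<beta> B) = integral\<^sup>L \<mu> (bethe_fun \<beta> B)"
    if "0 < B" for B
    unfolding bethe_mu_def bethe_T_free[OF assms(2) that] bethe_T_plus[OF assms(2) that] by simp_all
  have pos: "convergent (\<lambda>n. ising_phi_n G \<beta> B n)" if "0 < B" for B
    using ising_phi_n_tendsto[OF assms(2) that] by (rule convergentI)
  \<comment> \<open>The limit at 0 is two-sided, so convergence is needed at negative fields too;
    evenness in \<open>B\<close> supplies it.\<close>
  have nonzero: "convergent (\<lambda>n. ising_phi_n G \<beta> B n)" if "B \<noteq> 0" for B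
    using pos[of B] pos[of "- B"] that by (cases "0 < B") (auto simp: ising_phi_n_uminus)
  note zero = convergent_extend_lipschitz[where f = "\<lambda>B n. ising_phi_n G \<beta> B n" and a = 0,
      OF ising_phi_n_lipschitz nonzero]
  show ?thesis
    using zero ising_phi_n_tendsto[OF assms(2)] bethe pos by (simp add: ising_phi_n_uminus)
qed

end
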